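(* Let $n\ge2$ and let $\Sigma_1,\Sigma_2$ be ($C^\infty$) hypersurfaces in the Heisenberg group $H_n$ that are tangent at $p_0$ vertically, i.e. their common tangent space at $p_0$ is a hyperplane perpendicular to the $x^1x^2\cdots x^{2n}$ hyperplane. Suppose (without loss of generality) that the Euclidean unit normal to this tangent space at $p_0$ is $-\frac{\partial}{\partial x^1}$. Let $l_a$ denote the Heisenberg translation $$l_a(x^1,\dots,x^{2n},z):=(x^1+a,x^2,\dots,x^{2n},z-ax^{n+1}).$$ Let $p\ge0$ and assume that for $q\in\Sigma_1$ near $p_0$ there is $a(q)\ge0$ with $l_{a(q)}(q)\in\Sigma_2$ and $$H_{\Sigma_2,p}(l_{a(q)}(q))\le H_{\Sigma_1,p}(q).$$ Then $\Sigma_2$ coincides with $\Sigma_1$ near $p_0$.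
   Context: $H_n=\mathbb{R}^{2n+1}$ has coordinates $(x^1,\dots,x^{2n},z)$ and group law $(a_1,\dots,a_n,b_1,\dots,b_n,c)\circ(x_1,\dots,x_n,y_1,\dots,y_n,z)=(a_1+x_1,\dots,b_n+y_n,\,c+z+\sum_{j}(b_jx_j-a_jy_j))$, where $x^j=x_j$, $x^{n+j}=y_j$. Let $\Theta=dz+\sum_{j=1}^n(x^jdx^{n+j}-x^{n+j}dx^j)$. $H_n$ is viewed as a subriemannian manifold with the nonnegative inner product on $T^*H_n$ given by $\langle dx^I,dx^K\rangle^*=\delta_{IK}$ ($1\le I,K\le 2n$), $\langle\Theta,\cdot\rangle^*=0$, and volume form $dv=dx^1\wedge\dots\wedge dx^{2n}\wedge\Theta$; $|\omega|_*=(\langle\omega,\omega\rangle^* )^{1/2}$; for a 1-form $\omega$, $\omega\lrcorner dv$ is the $2n$-form with $\eta\wedge(\omega\lrcorner dv)=\langle\eta,\omega\rangle^*dv$ for all 1-forms $\eta$. For $\Sigma=\{\phi=0\}$ with $|d\phi|_*\ne0$ and $p\ge0$, put $dv_{\phi,p}:=\frac{d\phi}{|d\phi|_*^{1-p}}\lrcorner dv$, let $\nu_p$ be the vector field with $\nu_p\lrcorner dv=dv_{\phi,p}$; $H_{\Sigma,p}$ is defined by $\delta_{f\nu_p}\int_\Sigma dv_{\phi,p}=\int_\Sigma fH_{\Sigma,p}\,dv_{\phi,p}$ for compactly supported smooth $f$, where the left side is $\int_\Sigma L_{f\nu_p}(dv_{\phi,p})$; equivalently $H_{\Sigma,p}=H_{\phi,p}|_\Sigma$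 where $d(dv_{\phi,p})=H_{\phi,p}dv$. Here the defining functions $\phi,\psi$ of $\Sigma_1,\Sigma_2$ near $p_0$ used to compute $H_{\Sigma_1,p}$, $H_{\Sigma_2,p}$ are the ones compatible with $\{l_a\}$: $\phi(l_a(x))=\phi(x)-a$, $\psi(l_a(x))=\psi(x)-a$. *)

theory Defs
  imports "HOL-Analysis.Analysis"
begin

section \<open>The Heisenberg group\<close>

text \<open>
  \<open>'n heis\<close> is \<open>H_n\<close> with \<open>n = CARD('n)\<close>. A point is a pair \<open>(x, z)\<close>; for \<open>j :: 'n\<close>, the
  coordinate \<open>x^j\<close> is \<open>x $ Inl j\<close> and \<open>x^(n+j)\<close> is \<open>x $ Inr j\<close>. The linear order on the index
  type only serves to single out the first index and to order the factors of the volume form.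
\<close>

type_synonym 'n heis = "(real ^ ('n + 'n)) \<times> real"

definition first_index :: "'n::{finite,linorder}" where
  "first_index = Min UNIV"

definition heis_mult :: "'n::finite heis \<Rightarrow> 'n heis \<Rightarrow> 'n heis" where
  "heis_mult p q =
     (fst p + fst q,
      snd p + snd q + (\<Sum>j\<in>UNIV. fst p $ Inr j * fst q $ Inl j - fst p $ Inl j * fst q $ Inr j))"

definition l_transl :: "real \<Rightarrow> 'n::{finite,linorder} heis \<Rightarrow> 'n heis" where
  "l_transl a q = (fst q + axis (Inl first_index) a, snd q - a * fst q $ Inr first_index)"

definition d_x1 :: "'n::{finite,linorder} heis" where
  "d_x1 = (axis (Inl first_index) 1, 0)"

lemma l_transl_eq_heis_mult:
  "l_transl a q = heis_mult (axis (Inl first_index) a, 0) q"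
  by (auto simp: l_transl_def heis_mult_def axis_def if_distrib[of "\<lambda>x. x * _"] sum_negf
      cong: if_cong)


section \<open>Smooth maps, hypersurfaces, tangent spaces\<close>

text \<open>\<open>Ck_on k U f\<close> is continuous differentiability of order \<open>k\<close>; it is meant for open \<open>U\<close>.\<close>

fun Ck_on :: "nat \<Rightarrow> 'a::real_normed_vector set \<Rightarrow> ('a \<Rightarrow> 'b::real_normed_vector) \<Rightarrow> bool" where
  "Ck_on 0 U f \<longleftrightarrow> continuous_on U f"
| "Ck_on (Suc k) U f \<longleftrightarrow>
     (\<forall>x\<in>U. f differentiable (at x)) \<and> (\<forall>v. Ck_on k U (\<lambda>x. frechet_derivative f (at x) v))"

definition smooth_on :: "'a::real_normed_vector set \<Rightarrow> ('a \<Rightarrow> 'b::real_normed_vector) \<Rightarrow> bool" where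
  "smooth_on U f \<longleftrightarrow> (\<forall>k. Ck_on k U f)"

definition hypersurface :: "'a::euclidean_space set \<Rightarrow> bool" where
  "hypersurface \<Sigma> \<longleftrightarrow>
     (\<forall>q\<in>\<Sigma>. \<exists>U (\<phi> :: 'a \<Rightarrow> real). open U \<and> q \<in> U \<and> smooth_on U \<phi> \<and>
        (\<forall>x\<in>U. frechet_derivative \<phi> (at x) \<noteq> (\<lambda>v. 0)) \<and> \<Sigma> \<inter> U = {x \<in> U. \<phi> x = 0})"

definition tangent_space :: "'a::euclidean_space set \<Rightarrow> 'a \<Rightarrow> 'a set" where
  "tangent_space \<Sigma> q =
     {v. \<exists>e>0. \<exists>\<gamma> :: real \<Rightarrow> 'a. smooth_on {-e<..<e} \<gamma> \<and> (\<forall>t\<in>{-e<..<e}. \<gamma> t \<in> \<Sigma>) \<and>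
           \<gamma> 0 = q \<and> (\<gamma> has_vector_derivative v) (at 0)}"


section \<open>Differential forms\<close>

text \<open>
  A \<open>k\<close>-covector is an alternating multilinear function of \<open>k\<close> vectors, represented as a function
  on lists that vanishes on lists of any other length. 1-forms are represented directly as
  functions of a point and a vector.
\<close>

definition omit_nth :: "nat \<Rightarrow> 'a list \<Rightarrow> 'a list" where
  "omit_nth i vs = take i vs @ drop (Suc i) vs"

definition alternating_form :: "nat \<Rightarrow> ('a::real_vector list \<Rightarrow> real) \<Rightarrow> bool" where
  "alternating_form k \<alpha> \<longleftrightarrow>
     (\<forall>vs. length vs \<noteq> k \<longrightarrow> \<alpha> vs = 0) \<and>
     (\<forall>vs i. length vs = k \<longrightarrow> i < k \<longrightarrow> linear (\<lambda>v. \<alpha> (vs[i := v]))) \<and>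
     (\<forall>vs. length vs = k \<longrightarrow> \<not> distinct vs \<longrightarrow> \<alpha> vs = 0)"

text \<open>Exterior product \<open>\<eta> \<and> \<alpha>\<close> of a 1-covector with a \<open>k\<close>-covector (no factorial normalisation).\<close>

definition wedge1 :: "('a \<Rightarrow> real) \<Rightarrow> ('a list \<Rightarrow> real) \<Rightarrow> 'a list \<Rightarrow> real" where
  "wedge1 \<eta> \<alpha> vs = (\<Sum>i<length vs. (-1) ^ i * \<eta> (vs ! i) * \<alpha> (omit_nth i vs))"

definition one_form0 :: "'a list \<Rightarrow> real" where
  "one_form0 vs = (if vs = [] then 1 else 0)"

text \<open>
  On a vector space, by the formula for constant vector fields:
  \<open>d\<omega>(v_0, \<dots>, v_k) = \<Sum>i. (-1)^i D_(v_i) \<omega>(v_0, \<dots>, omit v_i, \<dots>, v_k)\<close>.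
\<close>

definition ext_deriv ::
  "('a::real_normed_vector \<Rightarrow> 'a list \<Rightarrow> real) \<Rightarrow> 'a \<Rightarrow> 'a list \<Rightarrow> real" where
  "ext_deriv \<omega> x vs =
     (\<Sum>i<length vs. (-1) ^ i * frechet_derivative (\<lambda>y. \<omega> y (omit_nth i vs)) (at x) (vs ! i))"


section \<open>The subriemannian structure\<close>

definition dx :: "'n::finite + 'n \<Rightarrow> 'n heis \<Rightarrow> real" where
  "dx I v = fst v $ I"

definition Theta :: "'n::finite heis \<Rightarrow> 'n heis \<Rightarrow> real" where
  "Theta q v = snd v + (\<Sum>j\<in>UNIV. fst q $ Inl j * dx (Inr j) v - fst q $ Inr j * dx (Inl j) v)"

text \<open>\<open>dv = dx^1 \<and> \<dots> \<and> dx^(2n) \<and> \<Theta>\<close>\<close>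

definition vol :: "'n::{finite,linorder} heis \<Rightarrow> 'n heis list \<Rightarrow> real" where
  "vol q =
     (let ns = sorted_list_of_set (UNIV :: 'n set) in
      foldr wedge1 (map (\<lambda>j. dx (Inl j)) ns @ map (\<lambda>j. dx (Inr j)) ns @ [Theta q]) one_form0)"

text \<open>
  \<open>frame q I\<close> is the horizontal vector dual to \<open>dx^I\<close> in the coframe \<open>dx^1, \<dots>, dx^(2n), \<Theta>\<close>, so
  that \<open>\<eta> (frame q I)\<close> is the \<open>dx^I\<close>-coefficient of the covector \<open>\<eta>\<close>
  (lemma \<open>coframe_expansion\<close>). Hence \<open>co_inner\<close> is the bilinear form \<open>\<langle>_,_\<rangle>\<^sup>*\<close> with
  \<open>\<langle>dx^I, dx^K\<rangle>\<^sup>* = \<delta>_IK\<close> and \<open>\<langle>\<Theta>, _\<rangle>\<^sup>* = 0\<close>.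
\<close>

definition frame :: "'n::finite heis \<Rightarrow> 'n + 'n \<Rightarrow> 'n heis" where
  "frame q I = (axis I 1, - Theta q (axis I 1, 0))"

definition co_inner :: "'n::finite heis \<Rightarrow> ('n heis \<Rightarrow> real) \<Rightarrow> ('n heis \<Rightarrow> real) \<Rightarrow> real" where
  "co_inner q \<eta> \<omega> = (\<Sum>I\<in>UNIV. \<eta> (frame q I) * \<omega> (frame q I))"

definition co_norm :: "'n::finite heis \<Rightarrow> ('n heis \<Rightarrow> real) \<Rightarrow> real" where
  "co_norm q \<omega> = sqrt (co_inner q \<omega> \<omega>)"

lemma linear_Theta: "linear (Theta q)"
  by (rule linearI)
     (auto simp: Theta_def dx_def algebra_simps sum.distrib sum_subtractf sum_distrib_left)

lemma Theta_frame: "Theta q (frame q I) = 0"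
  by (simp add: frame_def) (simp add: Theta_def dx_def)

lemma dx_frame: "dx K (frame q I) = (if I = K then 1 else 0)"
  by (auto simp: frame_def dx_def axis_def)

lemma coframe_expansion:
  assumes "linear \<eta>"
  shows "\<eta> v = (\<Sum>I\<in>UNIV. \<eta> (frame q I) * dx I v) + \<eta> (0, 1) * Theta q v"
proof -
  have f: "fst v = (\<Sum>I\<in>UNIV. dx I v *\<^sub>R axis I 1)"
    by (simp add: vec_eq_iff dx_def axis_def if_distrib cong: if_cong)
  let ?w = "(\<Sum>I\<in>UNIV. dx I v *\<^sub>R frame q I) + Theta q v *\<^sub>R (0, 1)"
  have fw: "fst ?w = fst v"
    by (simp add: fst_sum frame_def f)
  have "Theta q ?w = Theta q v"
    using linear_Theta[of q]
    by (simp add: linear_add linear_sum linear_scale Theta_frame) (simp add: Theta_def dx_def)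
  then have "snd ?w = snd v"
    using fw by (simp add: Theta_def dx_def)
  then have "v = ?w" using fw by (simp only: prod_eq_iff)
  then have "\<eta> v = \<eta> ?w" by (rule arg_cong)
  then show ?thesis
    using assms
    by (simp add: linear_add linear_sum linear_scale mult.commute del: scaleR_Pair)
qed

lemma co_inner_dx: "co_inner q (dx I) (dx K) = (if I = K then 1 else 0)"
  by (simp add: co_inner_def dx_frame if_distrib[of "\<lambda>x. x * _"] cong: if_cong)

lemma co_inner_Theta: "co_inner q (Theta q) \<eta> = 0" "co_inner q \<eta> (Theta q) = 0"
  by (simp_all add: co_inner_def Theta_frame)

text \<open>\<open>hook q \<omega>\<close> is \<open>\<omega> \<lrcorner> dv\<close>: the \<open>2n\<close>-covector with \<open>\<eta> \<and> (\<omega> \<lrcorner> dv) = \<langle>\<eta>,\<omega>\<rangle>\<^sup>* dv\<close> for all \<open>\<eta>\<close>.\<close>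

definition hook ::
  "'n::{finite,linorder} heis \<Rightarrow> ('n heis \<Rightarrow> real) \<Rightarrow> 'n heis list \<Rightarrow> real" where
  "hook q \<omega> =
     (THE \<alpha>. alternating_form (2 * CARD('n)) \<alpha> \<and>
             (\<forall>\<eta>. linear \<eta> \<longrightarrow> wedge1 \<eta> \<alpha> = (\<lambda>vs. co_inner q \<eta> \<omega> * vol q vs)))"


section \<open>Mean curvature\<close>

abbreviation diff1 :: "('n::finite heis \<Rightarrow> real) \<Rightarrow> 'n heis \<Rightarrow> 'n heis \<Rightarrow> real" where
  "diff1 \<phi> q \<equiv> frechet_derivative \<phi> (at q)"

definition surf_form ::
  "('n::{finite,linorder} heis \<Rightarrow> real) \<Rightarrow> real \<Rightarrow> 'n heis \<Rightarrow> 'n heis list \<Rightarrow> real" where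
  "surf_form \<phi> p q = hook q (\<lambda>v. diff1 \<phi> q v / co_norm q (diff1 \<phi> q) powr (1 - p))"

text \<open>\<open>H_(\<phi>,p)\<close>, determined by \<open>d(dv_(\<phi>,p)) = H_(\<phi>,p) dv\<close>.\<close>

definition mean_curv ::
  "('n::{finite,linorder} heis \<Rightarrow> real) \<Rightarrow> real \<Rightarrow> 'n heis \<Rightarrow> real" where
  "mean_curv \<phi> p q = (THE h. ext_deriv (surf_form \<phi> p) q = (\<lambda>vs. h * vol q vs))"

text \<open>
  \<open>\<phi>\<close> is a defining function of \<open>\<Sigma>\<close> on the neighbourhood \<open>U\<close> of \<open>p0\<close> that is compatible with the
  translations. The compatibility concerns all \<open>x\<close> and \<open>a\<close> for which both \<open>x\<close> and its translate lie
  in \<open>U\<close>; thus \<open>\<Sigma> \<inter> U\<close> meets every orbit in at most one point.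
\<close>

definition compatible_defining ::
  "'n::{finite,linorder} heis set \<Rightarrow> 'n heis \<Rightarrow> 'n heis set \<Rightarrow> ('n heis \<Rightarrow> real) \<Rightarrow> bool" where
  "compatible_defining \<Sigma> p0 U \<phi> \<longleftrightarrow>
     open U \<and> p0 \<in> U \<and> smooth_on U \<phi> \<and> \<Sigma> \<inter> U = {x \<in> U. \<phi> x = 0} \<and>
     (\<forall>x\<in>U. co_norm x (diff1 \<phi> x) \<noteq> 0) \<and>
     (\<forall>x\<in>U. \<forall>a. l_transl a x \<in> U \<longrightarrow> \<phi> (l_transl a x) = \<phi> x - a)"

end

theory Submission
  imports Defs
begin

text \<open>
  By left invariance of the structure and compatibility with the translations, the hypothesis on
  \<open>\<Sigma>1\<close> becomes \<open>\<psi> \<ge> \<phi>\<close> and \<open>H_(\<psi>,p) \<le> H_(\<phi>,p)\<close> on a neighbourhood of \<open>p0\<close>, with \<open>\<psi> = \<phi>\<close> at \<open>p0\<close>.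
  Here \<open>H_(\<phi>,p)\<close> is the horizontal divergence of \<open>|\<nabla>\<phi>|^(p-1) \<nabla>\<phi>\<close>, \<open>\<nabla>\<close> the horizontal gradient: a
  quasilinear operator, elliptic in horizontal directions except, if \<open>p = 0\<close>, in the direction of
  \<open>\<nabla>\<phi>\<close>. Following Bony, consider the contact set \<open>Z = {\<psi> = \<phi>}\<close> and a vector \<open>\<nu>\<close> from a point of
  \<open>Z\<close> to a point to which it is nearest in \<open>Z\<close>. A Hopf type comparison shows that \<open>\<nu>\<close> is orthogonal
  to all horizontal vectors in the kernel of \<open>d\<phi>\<close>; translation invariance of \<open>Z\<close> makes it orthogonal
  to the generator of the translations. If all such normals are orthogonal to two vector fields,
  they are orthogonal to their bracket, and since \<open>n \<ge> 2\<close> and \<open>d\<phi> = - dx^1\<close> at \<open>p0\<close>, these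
  directions span the whole space near \<open>p0\<close>. So \<open>\<nu> = 0\<close>, and \<open>Z\<close> is a neighbourhood of \<open>p0\<close>.
\<close>

section \<open>Alternating forms\<close>

text \<open>The contact set is only known to be closed, so its boundary has no tangent planes to
  work with. What replaces them are the vectors \<open>c - y\<close> with \<open>y\<close> nearest
  to \<open>c\<close>: every point has a nearest point in a closed set, so absence of nonzero
  vectors of this kind near \<open>p0\<close> already puts all points near \<open>p0\<close> into
  the set. The obstacle is that the operator controls only horizontal directions tangent to the
  level sets of \<phi>. For n = 1 these form a line field, whose brackets give nothing new; from n =
  2 on there is a pair \<open>Inl j\<close>, \<open>Inr j\<close> with
  \<open>j \<noteq> first_index\<close>, which at \<open>p0\<close> does not commute modulo
  horizontal vectors. The bracket step works without flows: an explicit loop, correct to second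
  order, is followed, and its squared distance from the set is estimated although this function need
  not be differentiable. The forms disappear early. \<Theta> differs from dz by a combination of the
  dx^I, so dv has constant coefficients, and the exterior derivative of a contraction of dv is an
  ordinary Euclidean divergence.\<close>

lemma length_omit_nth: "i < length vs \<Longrightarrow> length (omit_nth i vs) = length vs - 1"
  by (auto simp: omit_nth_def)

lemma nth_omit_nth:
  assumes "i < length vs" "m < length vs - 1"
  shows "omit_nth i vs ! m = (if m < i then vs ! m else vs ! Suc m)"
  using assms by (auto simp: omit_nth_def nth_append min_def)

lemma omit_nth_Suc: "omit_nth (Suc i) (v # vs) = v # omit_nth i vs"
  by (simp add: omit_nth_def)

lemma omit_nth_0: "omit_nth 0 (v # vs) = vs"
  by (simp add: omit_nth_def)

lemma omit_nth_update_same: "omit_nth i (vs[i := u]) = omit_nth i vs"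
  by (simp add: omit_nth_def)

lemma omit_nth_update_other:
  assumes "i < length vs" "j < length vs" "i \<noteq> j"
  shows "omit_nth i (vs[j := u]) = (omit_nth i vs)[(if j < i then j else j - 1) := u]"
  using assms
  by (intro nth_equalityI) (auto simp: length_omit_nth nth_omit_nth nth_list_update)

lemma alternating_formD:
  assumes "alternating_form k \<alpha>"
  shows "length vs \<noteq> k \<Longrightarrow> \<alpha> vs = 0"
    and "length vs = k \<Longrightarrow> i < k \<Longrightarrow> linear (\<lambda>v. \<alpha> (vs[i := v]))"
    and "\<not> distinct vs \<Longrightarrow> \<alpha> vs = 0"
  using assms unfolding alternating_form_def by blast+

lemma alternating_form_repeat:
  assumes "alternating_form k \<alpha>" "i < length vs" "j < length vs" "i \<noteq> j" "vs ! i = vs ! j"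
  shows "\<alpha> vs = 0"
  using alternating_formD(3)[OF assms(1)] assms(2-) by (auto simp: distinct_conv_nth)

lemma alternating_form_swap:
  assumes \<alpha>: "alternating_form k \<alpha>" and "length vs = k" "i < k" "j < k" "i \<noteq> j"
  shows "\<alpha> (vs[i := x, j := y]) = - \<alpha> (vs[i := y, j := x])"
proof -
  have z: "\<alpha> (vs[i := u, j := u]) = 0" for u
    using assms by (intro alternating_form_repeat[OF \<alpha>, of i _ j]) auto
  have lj: "linear (\<lambda>v. \<alpha> (vs[i := u, j := v]))" for u
    using assms by (intro alternating_formD(2)[OF \<alpha>]) auto
  have li: "linear (\<lambda>v. \<alpha> (vs[i := v, j := u]))" for u
    using alternating_formD(2)[OF \<alpha>, of "vs[j := u]" i] assms by (simp add: list_update_swap)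
  have "0 = \<alpha> (vs[i := x + y, j := x + y])" by (simp only: z)
  also have "\<dots> = \<alpha> (vs[i := x, j := y]) + \<alpha> (vs[i := y, j := x])"
    unfolding linear_add[OF lj] linear_add[OF li] by (simp add: z)
  finally show ?thesis by simp
qed

text \<open>One sign per adjacent swap. The length of the list is arbitrary: for a wrong length both
  sides are 0, the default value built into \<open>alternating_form\<close>.\<close>

lemma alternating_form_move:
  assumes \<alpha>: "alternating_form k \<alpha>"
  shows "\<alpha> (A @ B @ v # C) = (- 1) ^ length B * \<alpha> (A @ v # B @ C)"
proof (induction B arbitrary: A)
  case Nil
  then show ?case by simp
next
  case (Cons b B)
  have sw: "\<alpha> (A @ b # v # B @ C) = - \<alpha> (A @ v # b # B @ C)"
  proof (cases "length (A @ b # v # B @ C) = k")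
    case True
    then show ?thesis
      using alternating_form_swap[OF \<alpha> True, of "length A" "Suc (length A)" b v]
      by (simp add: list_update_append)
  next
    case False
    then show ?thesis using alternating_formD(1)[OF \<alpha>] by auto
  qed
  show ?case using Cons.IH[of "A @ [b]"] sw by simp
qed

lemma alternating_form_Cons_omit_nth:
  assumes "alternating_form k \<alpha>" "i < length vs"
  shows "\<alpha> (b # omit_nth i vs) = (- 1) ^ i * \<alpha> (vs[i := b])"
proof -
  have "\<alpha> (vs[i := b]) = (- 1) ^ i * \<alpha> (b # omit_nth i vs)"
    using alternating_form_move[OF assms(1), of "[]" "take i vs" b "drop (Suc i) vs"] assms(2)
    by (simp add: upd_conv_take_nth_drop omit_nth_def)
  moreover have "(- 1 :: real) ^ i * ((- 1) ^ i * c) = c" for c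
    by (metis left_minus_one_mult_self)
  ultimately show ?thesis by simp
qed

lemma alternating_form_wedge1:
  assumes \<alpha>: "alternating_form k \<alpha>" and \<eta>: "linear \<eta>"
  shows "alternating_form (Suc k) (wedge1 \<eta> \<alpha>)"
  unfolding alternating_form_def
proof (intro conjI allI impI)
  fix vs :: "'a list" assume "length vs \<noteq> Suc k"
  then show "wedge1 \<eta> \<alpha> vs = 0"
    by (auto simp: wedge1_def length_omit_nth intro!: sum.neutral alternating_formD(1)[OF \<alpha>])
next
  fix vs :: "'a list" and i assume *: "length vs = Suc k" "i < Suc k"
  have "linear (\<lambda>v. (- 1) ^ l * \<eta> (vs[i := v] ! l) * \<alpha> (omit_nth l (vs[i := v])))"
    if l: "l < Suc k" for l
  proof (cases "l = i")
    case True
    have "linear (\<lambda>v. ((- 1) ^ l * \<alpha> (omit_nth l vs)) *\<^sub>R \<eta> v)"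
      by (intro linear_compose_scale_right \<eta>)
    then show ?thesis using True * by (simp add: omit_nth_update_same mult.commute mult.left_commute)
  next
    case False
    have "linear (\<lambda>v. ((- 1) ^ l * \<eta> (vs ! l)) *\<^sub>R
        \<alpha> ((omit_nth l vs)[(if i < l then i else i - 1) := v]))"
      using False * l
      by (intro linear_compose_scale_right alternating_formD(2)[OF \<alpha>]) (auto simp: length_omit_nth)
    then show ?thesis using False * l by (simp add: omit_nth_update_other)
  qed
  then show "linear (\<lambda>v. wedge1 \<eta> \<alpha> (vs[i := v]))"
    unfolding wedge1_def using * by (simp add: linear_compose_sum del: sum.lessThan_Suc)
next
  fix vs :: "'a list" assume *: "length vs = Suc k" "\<not> distinct vs"
  then obtain i j where ij: "i < j" "j < Suc k" "vs ! i = vs ! j"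
    unfolding distinct_conv_nth by (metis linorder_neqE_nat)
  \<comment> \<open>Only the terms that omit one of the two equal entries survive. The lists left
    over differ by carrying \<open>v\<close> across \<open>B\<close>, with sign (-1)^(j-i-1), which
    is opposite to the ratio (-1)^(j-i) of the signs in the sum; so the two terms cancel.\<close>
  define t where "t l = (- 1) ^ l * \<eta> (vs ! l) * \<alpha> (omit_nth l vs)" for l
  have z: "t l = 0" if l: "l < Suc k" "l \<noteq> i" "l \<noteq> j" for l
  proof -
    have "\<alpha> (omit_nth l vs) = 0"
      using l ij *
      by (intro alternating_form_repeat[OF \<alpha>, of "if i < l then i else i - 1" _
            "if j < l then j else j - 1"])
        (auto simp: length_omit_nth nth_omit_nth)
    then show ?thesis by (simp add: t_def)
  qed
  define v where "v = vs ! i"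
  define A B C where "A = take i vs" and "B = drop (Suc i) (take j vs)" and "C = drop (Suc j) vs"
  have lB: "length B = j - Suc i" using ij * by (simp add: B_def)
  have tj: "take j vs = A @ v # B"
    using ij * id_take_nth_drop[of i "take j vs"] by (simp add: A_def B_def v_def min_def)
  have oj: "omit_nth j vs = A @ v # B @ C" by (simp add: omit_nth_def tj C_def)
  have di: "drop (Suc i) vs = B @ v # C"
  proof -
    have "vs = take j vs @ vs ! j # C" using ij * by (simp add: C_def id_take_nth_drop[symmetric])
    then have "vs = A @ v # B @ v # C" using tj ij(3) by (simp add: v_def)
    moreover have "length A = i" using ij * by (simp add: A_def)
    moreover have "drop (Suc (length A)) (A @ v # B @ v # C) = B @ v # C" by simp
    ultimately show ?thesis by metis
  qed
  have oi: "omit_nth i vs = A @ B @ v # C" by (simp add: omit_nth_def di A_def)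
  have "\<alpha> (omit_nth i vs) = (- 1) ^ (j - Suc i) * \<alpha> (omit_nth j vs)"
    unfolding oi oj using alternating_form_move[OF \<alpha>] lB by metis
  moreover have "(- 1 :: real) ^ j = - ((- 1) ^ i * (- 1) ^ (j - Suc i))"
    using ij(1) by (auto simp: less_iff_Suc_add power_add)
  ultimately have "t i + t j = 0"
    using ij(3) by (simp add: t_def)
  moreover have "wedge1 \<eta> \<alpha> vs = (\<Sum>l\<in>{i, j}. t l)"
    unfolding wedge1_def t_def[symmetric] using z ij * by (intro sum.mono_neutral_right) auto
  ultimately show "wedge1 \<eta> \<alpha> vs = 0" using ij(1) by simp
qed

text \<open>More vectors than the dimension are dependent, and expanding one entry in the others
  repeats an entry in every term.\<close>

lemma alternating_form_eq_0:
  fixes \<alpha> :: "'a::euclidean_space list \<Rightarrow> real"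
  assumes \<alpha>: "alternating_form k \<alpha>" and k: "DIM('a) < k"
  shows "\<alpha> vs = 0"
proof (cases "length vs = k \<and> distinct vs")
  case True
  then have "card (set vs) > DIM('a)" using k distinct_card by metis
  then have "dependent (set vs)" using independent_card_le by (metis linorder_not_less)
  then obtain v where v: "v \<in> set vs" "v \<in> span (set vs - {v})" by (auto simp: dependent_def)
  then obtain i where i: "i < k" "vs ! i = v" using True by (metis in_set_conv_nth)
  have l: "linear (\<lambda>u. \<alpha> (vs[i := u]))" using alternating_formD(2)[OF \<alpha>] True i by blast
  have "\<alpha> (vs[i := u]) = 0" if "u \<in> set vs - {v}" for u
  proof -
    from that have "u \<in> set vs" by simp
    then obtain j where "j < k" "vs ! j = u" using True by (auto simp: in_set_conv_nth)
    then show ?thesis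
      using that i True by (intro alternating_form_repeat[OF \<alpha>, of i _ j]) (auto simp: nth_list_update)
  qed
  then have "\<alpha> (vs[i := v]) = 0"
    using linear_eq_0_on_span[OF l _ v(2)] by blast
  then show ?thesis using i by (metis list_update_id)
next
  case False
  then show ?thesis using alternating_formD(1,3)[OF \<alpha>] by blast
qed

text \<open>The wedge of \<eta> with a top form is 0 by degree; expanding it on
  \<open>b # vs\<close> gives this coordinate-free Cramer rule. Uniqueness, trace and contraction of
  top forms all follow from it without determinants.\<close>

lemma top_form_exchange:
  fixes \<alpha> :: "'a::euclidean_space list \<Rightarrow> real"
  assumes \<alpha>: "alternating_form DIM('a) \<alpha>" and \<eta>: "linear \<eta>"
  shows "(\<Sum>i<length vs. \<eta> (vs ! i) * \<alpha> (vs[i := b])) = \<eta> b * \<alpha> vs"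
proof -
  have "0 = wedge1 \<eta> \<alpha> (b # vs)"
    using alternating_form_eq_0[OF alternating_form_wedge1[OF \<alpha> \<eta>], of "b # vs"] by simp
  also have "\<dots> = \<eta> b * \<alpha> vs + (\<Sum>i<length vs. (- 1) ^ Suc i * \<eta> (vs ! i) * \<alpha> (b # omit_nth i vs))"
    by (simp add: wedge1_def sum.lessThan_Suc_shift omit_nth_0 omit_nth_Suc del: sum.lessThan_Suc)
  also have "(\<Sum>i<length vs. (- 1) ^ Suc i * \<eta> (vs ! i) * \<alpha> (b # omit_nth i vs))
      = - (\<Sum>i<length vs. \<eta> (vs ! i) * \<alpha> (vs[i := b]))"
    unfolding sum_negf[symmetric]
    by (intro sum.cong) (auto simp: alternating_form_Cons_omit_nth[OF \<alpha>] mult.left_commute)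
  finally show ?thesis by simp
qed

text \<open>Descending induction on the length of an initial segment shared by \<open>vs\<close> and
  \<open>B\<close>. In the exchange identity for \<open>f k\<close> and \<open>B ! k\<close>, the
  slots before \<open>k\<close> drop out by triangularity; inserting \<open>B ! k\<close> in any
  other slot gives, up to a swap, a list that shares one entry more.\<close>

lemma top_form_unique:
  fixes \<alpha> \<beta> :: "'a::euclidean_space list \<Rightarrow> real" and f :: "nat \<Rightarrow> 'a \<Rightarrow> real"
  assumes \<alpha>: "alternating_form DIM('a) \<alpha>" and \<beta>: "alternating_form DIM('a) \<beta>"
    and B: "length B = DIM('a)" and eq: "\<alpha> B = \<beta> B"
    and f: "\<And>k. k < DIM('a) \<Longrightarrow> linear (f k)" "\<And>k. k < DIM('a) \<Longrightarrow> f k (B ! k) \<noteq> 0"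
      "\<And>k i. k < DIM('a) \<Longrightarrow> i < k \<Longrightarrow> f k (B ! i) = 0"
  shows "\<alpha> = \<beta>"
proof
  fix vs
  define \<gamma> where "\<gamma> vs = \<alpha> vs - \<beta> vs" for vs
  have \<gamma>: "alternating_form DIM('a) \<gamma>"
    using \<alpha> \<beta> unfolding alternating_form_def \<gamma>_def by (auto intro!: linear_compose_sub)
  have "\<gamma> vs = 0" if "length vs = DIM('a)" "take k vs = take k B" "k \<le> DIM('a)" for k vs
    using that(3,1,2)
  proof (induction k arbitrary: vs rule: inc_induct)
    case base
    then have "vs = B" using B by simp
    then show ?case using eq by (simp add: \<gamma>_def)
  next
    case (step k)
    let ?b = "B ! k"
    have nth: "vs ! i = B ! i" if "i < k" for i
      using step.prems(2) that by (metis nth_take)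
    have "f k (vs ! i) * \<gamma> (vs[i := ?b]) = 0" if i: "i < DIM('a)" for i
    proof (cases "i < k")
      case True
      then show ?thesis using f(3) step.hyps nth by auto
    next
      case False
      have "\<gamma> (vs[i := ?b]) = 0"
      proof (cases "i = k")
        case True
        have "take (Suc k) (vs[k := ?b]) = take (Suc k) B"
          using step B by (simp add: take_Suc_conv_app_nth)
        then show ?thesis using step.IH[of "vs[k := ?b]"] step.prems True by simp
      next
        case False
        let ?us = "vs[k := ?b, i := vs ! k]"
        have "take (Suc k) ?us = take (Suc k) B"
          using step B False \<open>\<not> i < k\<close> by (simp add: take_Suc_conv_app_nth)
        then have "\<gamma> ?us = 0" using step.IH[of ?us] step.prems by simp
        moreover have "\<gamma> (vs[k := vs ! k, i := ?b]) = - \<gamma> ?us"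
          using step False i by (intro alternating_form_swap[OF \<gamma>]) auto
        ultimately show ?thesis by simp
      qed
      then show ?thesis by simp
    qed
    then have "(\<Sum>i<length vs. f k (vs ! i) * \<gamma> (vs[i := ?b])) = 0"
      using step.prems(1) by (intro sum.neutral) simp
    then have "f k ?b * \<gamma> vs = 0"
      using top_form_exchange[OF \<gamma> f(1), of k vs ?b] step.hyps by simp
    then show ?case using f(2) step.hyps by auto
  qed
  from this[of vs 0] have "\<gamma> vs = 0" using alternating_formD(1)[OF \<gamma>] by fastforce
  then show "\<alpha> vs = \<beta> vs" by (simp add: \<gamma>_def)
qed

text \<open>The derivative of the determinant at the identity is the trace. The alternating sum is
  what \<open>ext_deriv\<close> produces from a contraction whose vector field has derivative
  \<open>T\<close>.\<close>

lemma top_form_trace: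
  fixes \<alpha> :: "'a::euclidean_space list \<Rightarrow> real"
  assumes \<alpha>: "alternating_form DIM('a) \<alpha>" and T: "linear T"
  shows "(\<Sum>i<length vs. (- 1) ^ i * \<alpha> (T (vs ! i) # omit_nth i vs)) = (\<Sum>b\<in>Basis. T b \<bullet> b) * \<alpha> vs"
proof (cases "length vs = DIM('a)")
  case True
  have "(\<Sum>i<length vs. (- 1) ^ i * \<alpha> (T (vs ! i) # omit_nth i vs))
      = (\<Sum>i<length vs. \<alpha> (vs[i := T (vs ! i)]))"
    by (intro sum.cong) (auto simp: alternating_form_Cons_omit_nth[OF \<alpha>])
  also have "\<dots> = (\<Sum>i<length vs. \<Sum>b\<in>Basis. (T (vs ! i) \<bullet> b) * \<alpha> (vs[i := b]))"
  proof (intro sum.cong refl)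
    fix i assume "i \<in> {..<length vs}"
    then have l: "linear (\<lambda>v. \<alpha> (vs[i := v]))" using alternating_formD(2)[OF \<alpha> True] True by simp
    have "\<alpha> (vs[i := T (vs ! i)]) = \<alpha> (vs[i := (\<Sum>b\<in>Basis. (T (vs ! i) \<bullet> b) *\<^sub>R b)])"
      by (simp add: euclidean_representation)
    also have "\<dots> = (\<Sum>b\<in>Basis. (T (vs ! i) \<bullet> b) * \<alpha> (vs[i := b]))"
      by (simp add: linear_sum[OF l] linear_scale[OF l])
    finally show "\<alpha> (vs[i := T (vs ! i)]) = (\<Sum>b\<in>Basis. (T (vs ! i) \<bullet> b) * \<alpha> (vs[i := b]))" .
  qed
  also have "\<dots> = (\<Sum>b\<in>Basis. \<Sum>i<length vs. (T (vs ! i) \<bullet> b) * \<alpha> (vs[i := b]))"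
    by (rule sum.swap)
  also have "\<dots> = (\<Sum>b\<in>Basis. (T b \<bullet> b) * \<alpha> vs)"
  proof (intro sum.cong refl)
    fix b :: 'a
    have "linear (\<lambda>v. T v \<bullet> b)"
      using T by (auto intro!: linearI simp: linear_add linear_scale inner_add_left)
    from top_form_exchange[OF \<alpha> this, of vs b]
    show "(\<Sum>i<length vs. (T (vs ! i) \<bullet> b) * \<alpha> (vs[i := b])) = (T b \<bullet> b) * \<alpha> vs" .
  qed
  finally show ?thesis by (simp add: sum_distrib_right)
next
  case False
  then have "\<alpha> (T (vs ! i) # omit_nth i vs) = 0" if "i < length vs" for i
    using that by (intro alternating_formD(1)[OF \<alpha>]) (simp add: length_omit_nth)
  then show ?thesis using alternating_formD(1)[OF \<alpha> False] by simp
qed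

section \<open>Curvature as a divergence\<close>

lemma alternating_form_foldr_wedge1:
  assumes "\<And>f. f \<in> set fs \<Longrightarrow> linear f"
  shows "alternating_form (length fs) (foldr wedge1 fs one_form0)"
  using assms
proof (induction fs)
  case Nil
  then show ?case by (simp add: alternating_form_def one_form0_def)
next
  case (Cons f fs)
  then show ?case by (simp add: alternating_form_wedge1)
qed

text \<open>The first functional vanishes on all later vectors, so the outermost wedge contributes a
  single term.\<close>

lemma foldr_wedge1_triangular:
  assumes "length fs = length bs"
    and "\<And>i. i < length fs \<Longrightarrow> (fs ! i) (bs ! i) = 1"
    and "\<And>i j. i < j \<Longrightarrow> j < length fs \<Longrightarrow> (fs ! i) (bs ! j) = 0"
  shows "foldr wedge1 fs one_form0 bs = 1"
  using assms
proof (induction fs arbitrary: bs)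
  case Nil
  then show ?case by (simp add: one_form0_def)
next
  case (Cons f fs)
  then obtain b cs where bs: "bs = b # cs" by (cases bs) auto
  have "f b = 1" using Cons.prems(2)[of 0] by (simp add: bs)
  moreover have "f (cs ! j) = 0" if "j < length cs" for j
    using Cons.prems(3)[of 0 "Suc j"] Cons.prems(1) that by (simp add: bs)
  moreover have "foldr wedge1 fs one_form0 cs = 1"
    using Cons.prems(1) Cons.prems(2)[of "Suc _"] Cons.prems(3)[of "Suc _" "Suc _"]
    by (intro Cons.IH) (auto simp: bs)
  ultimately show ?case
    unfolding bs foldr_Cons comp_apply wedge1_def
    by (simp add: sum.lessThan_Suc_shift omit_nth_0 omit_nth_Suc del: sum.lessThan_Suc)
qed

section \<open>The volume form in coordinates\<close>

definition index_list :: "('n::{finite,linorder} + 'n) list" where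
  "index_list = map Inl (sorted_list_of_set UNIV) @ map Inr (sorted_list_of_set UNIV)"

lemma distinct_index_list: "distinct (index_list :: ('n::{finite,linorder} + 'n) list)"
  by (auto simp: index_list_def distinct_map)

lemma length_index_list: "length (index_list :: ('n::{finite,linorder} + 'n) list) = 2 * CARD('n)"
  by (simp add: index_list_def)

lemma vol_eq: "vol q = foldr wedge1 (map dx index_list @ [Theta q]) one_form0"
  by (simp add: vol_def index_list_def comp_def Let_def)

definition std_basis :: "'n::{finite,linorder} heis list" where
  "std_basis = map (\<lambda>I. (axis I 1, 0)) index_list @ [(0, 1)]"

lemma length_std_basis: "length (std_basis :: 'n::{finite,linorder} heis list) = DIM('n heis)"
  by (simp add: std_basis_def length_index_list)

lemma linear_dx: "linear (dx I)"
  by (rule linearI) (auto simp: dx_def)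

lemma coframe_std_basis:
  fixes q :: "'n::{finite,linorder} heis" and fs
  defines "fs \<equiv> map dx index_list @ [Theta q]"
  shows "i < DIM('n heis) \<Longrightarrow> (fs ! i) (std_basis ! i) = 1"
    and "i < j \<Longrightarrow> j < DIM('n heis) \<Longrightarrow> (fs ! i) (std_basis ! j) = 0"
proof -
  let ?L = "index_list :: ('n + 'n) list"
  have L: "?L ! i \<noteq> ?L ! j" if "i < j" "j < length ?L" for i j
    using that distinct_index_list[where 'n='n] by (simp add: nth_eq_iff_index_eq)
  have *: "i = length ?L \<and> fs ! i = Theta q \<and> std_basis ! i = ((0, 1) :: 'n heis) \<or>
      i < length ?L \<and> fs ! i = dx (?L ! i) \<and> std_basis ! i = (axis (?L ! i) 1, 0)"
    if "i < DIM('n heis)" for i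
    using that unfolding fs_def std_basis_def
    by (cases "i = length ?L") (auto simp: nth_append length_index_list)
  show "(fs ! i) (std_basis ! i) = 1" if "i < DIM('n heis)"
    using *[OF that] by (auto simp: dx_def Theta_def)
  show "(fs ! i) (std_basis ! j) = 0" if "i < j" "j < DIM('n heis)"
    using *[of i] *[of j] that L[of i j] by (auto simp: dx_def Theta_def axis_def)
qed

lemma vol_std_basis: "vol (q :: 'n::{finite,linorder} heis) std_basis = 1"
  unfolding vol_eq
proof (rule foldr_wedge1_triangular)
  show len: "length (map dx index_list @ [Theta q]) = length (std_basis :: 'n heis list)"
    by (simp add: std_basis_def)
  show "((map dx index_list @ [Theta q]) ! i) (std_basis ! i) = 1"
    if "i < length (map dx index_list @ [Theta q])" for i
    using that coframe_std_basis(1) unfolding len length_std_basis by blast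
  show "((map dx index_list @ [Theta q]) ! i) (std_basis ! j) = 0"
    if "i < j" "j < length (map dx index_list @ [Theta q])" for i j
    using that coframe_std_basis(2) unfolding len length_std_basis by blast
qed

lemma alternating_form_vol: "alternating_form DIM('n heis) (vol (q :: 'n::{finite,linorder} heis))"
proof -
  have "alternating_form (length (map dx index_list @ [Theta q])) (vol q)"
    unfolding vol_eq by (rule alternating_form_foldr_wedge1) (auto simp: linear_dx linear_Theta)
  then show ?thesis by (simp add: length_index_list mult_2)
qed

text \<open>The point enters only through \<Theta>, and there only through multiples of the dx^I,
  which the wedge with all dx^I kills. Formally: both top forms have the value 1 on the standard
  basis.\<close>

lemma vol_const: "vol q = vol (r :: 'n::{finite,linorder} heis)"
proof (rule top_form_unique[OF alternating_form_vol alternating_form_vol length_std_basis])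
  let ?L = "index_list :: ('n + 'n) list"
  let ?f = "\<lambda>k. (map dx ?L @ [snd]) ! k"
  have L: "?L ! i \<noteq> ?L ! j" if "i < j" "j < length ?L" for i j
    using that distinct_index_list[where 'n='n] by (simp add: nth_eq_iff_index_eq)
  have *: "i = length ?L \<and> ?f i = snd \<and> std_basis ! i = ((0, 1) :: 'n heis) \<or>
      i < length ?L \<and> ?f i = dx (?L ! i) \<and> std_basis ! i = (axis (?L ! i) 1, 0)"
    if "i < DIM('n heis)" for i
    using that unfolding std_basis_def
    by (cases "i = length ?L") (auto simp: nth_append length_index_list)
  fix k assume k: "k < DIM('n heis)"
  show "linear (?f k)"
    using *[OF k] by (auto simp: linear_dx linear_snd)
  show "?f k (std_basis ! k) \<noteq> 0"
    using *[OF k] by (auto simp: dx_def)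
  fix i assume i: "i < k"
  show "?f k (std_basis ! i) = 0"
    using *[of i] *[of k] i k L[of i k] by (auto simp: dx_def axis_def)
qed (simp add: vol_std_basis)

text \<open>The hook is contraction of dv with the horizontal vector dual to \<omega>; its defining
  property is again the exchange identity.\<close>

lemma hook_eq:
  fixes q :: "'n::{finite,linorder} heis"
  shows "hook q \<omega> = (\<lambda>ws. vol q ((\<Sum>I\<in>UNIV. \<omega> (frame q I) *\<^sub>R frame q I) # ws))"
    (is "_ = (\<lambda>ws. vol q (?V # ws))")
  unfolding hook_def
proof (rule the_equality)
  note vol = alternating_form_vol[of q]
  have inner: "\<eta> ?V = co_inner q \<eta> \<omega>" if "linear \<eta>" for \<eta>
    by (simp add: linear_sum[OF that] linear_scale[OF that] co_inner_def mult.commute)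
  have "linear (\<lambda>v. vol q (?V # vs[i := v]))" if "length vs = 2 * CARD('n)" "i < 2 * CARD('n)" for vs i
    using alternating_formD(2)[OF vol, of "?V # vs" "Suc i"] that by simp
  then have alt: "alternating_form (2 * CARD('n)) (\<lambda>ws. vol q (?V # ws))"
    using alternating_formD(1,3)[OF vol, of "?V # _"] by (simp add: alternating_form_def)
  have wedge: "wedge1 \<eta> (\<lambda>ws. vol q (?V # ws)) = (\<lambda>vs. co_inner q \<eta> \<omega> * vol q vs)"
    if "linear \<eta>" for \<eta>
  proof
    fix vs
    have "wedge1 \<eta> (\<lambda>ws. vol q (?V # ws)) vs = (\<Sum>i<length vs. \<eta> (vs ! i) * vol q (vs[i := ?V]))"
      unfolding wedge1_def
      by (intro sum.cong) (auto simp: alternating_form_Cons_omit_nth[OF vol] mult.left_commute)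
    also have "\<dots> = co_inner q \<eta> \<omega> * vol q vs"
      using top_form_exchange[OF vol that] inner[OF that] by simp
    finally show "wedge1 \<eta> (\<lambda>ws. vol q (?V # ws)) vs = co_inner q \<eta> \<omega> * vol q vs" .
  qed
  show "alternating_form (2 * CARD('n)) (\<lambda>ws. vol q (?V # ws)) \<and>
    (\<forall>\<eta>. linear \<eta> \<longrightarrow> wedge1 \<eta> (\<lambda>ws. vol q (?V # ws)) = (\<lambda>vs. co_inner q \<eta> \<omega> * vol q vs))"
    using alt wedge by blast
  fix \<alpha>
  assume "alternating_form (2 * CARD('n)) \<alpha> \<and>
    (\<forall>\<eta>. linear \<eta> \<longrightarrow> wedge1 \<eta> \<alpha> = (\<lambda>vs. co_inner q \<eta> \<omega> * vol q vs))"
  then have \<alpha>: "alternating_form (2 * CARD('n)) \<alpha>"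
    and w\<alpha>: "\<And>\<eta>. linear \<eta> \<Longrightarrow> wedge1 \<eta> \<alpha> = (\<lambda>vs. co_inner q \<eta> \<omega> * vol q vs)" by blast+
  show "\<alpha> = (\<lambda>ws. vol q (?V # ws))"
  proof
    fix ws
    show "\<alpha> ws = vol q (?V # ws)"
    proof (cases "length ws = 2 * CARD('n)")
      case True
      \<comment> \<open>Uniqueness: 2n vectors leave a direction \<open>v\<close> orthogonal to all
        of them. With \<eta> equal to 1 on \<open>v\<close> and 0 on \<open>ws\<close>, the wedge
        with \<eta> on \<open>v # ws\<close> reads off the value on \<open>ws\<close>.\<close>
      have "dim (set ws) < DIM('n heis)"
        using dim_le_card'[of "set ws"] card_length[of ws] True by simp
      then obtain v where v: "v \<noteq> 0" "\<And>w. w \<in> span (set ws) \<Longrightarrow> v \<bullet> w = 0"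
        using orthogonal_to_subspace_exists[of "set ws"] by (metis orthogonal_def)
      define \<eta> where "\<eta> u = (v \<bullet> u) / (v \<bullet> v)" for u
      have \<eta>: "linear \<eta>" by (rule linearI) (auto simp: \<eta>_def inner_add_right add_divide_distrib)
      have "\<eta> v = 1" using v(1) by (simp add: \<eta>_def)
      moreover have "\<eta> (ws ! i) = 0" if "i < length ws" for i
        using v(2)[of "ws ! i"] that by (simp add: \<eta>_def span_base)
      ultimately have "wedge1 \<eta> \<beta> (v # ws) = \<beta> ws" for \<beta>
        by (simp add: wedge1_def sum.lessThan_Suc_shift omit_nth_0 omit_nth_Suc del: sum.lessThan_Suc)
      from this[of \<alpha>] this[of "\<lambda>ws. vol q (?V # ws)"] show ?thesis
        unfolding w\<alpha>[OF \<eta>] wedge[OF \<eta>] by simp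
    next
      case False
      then show ?thesis using alternating_formD(1)[OF \<alpha>] alternating_formD(1)[OF alt] by simp
    qed
  qed
qed

text \<open>By \<open>vol_const\<close> only the vector field is differentiated, and the trace of
  its derivative comes out.\<close>

lemma ext_deriv_contraction:
  fixes V :: "'n::{finite,linorder} heis \<Rightarrow> 'n heis"
  assumes V: "(V has_derivative V') (at q)"
  shows "ext_deriv (\<lambda>y ws. vol y (V y # ws)) q = (\<lambda>vs. (\<Sum>b\<in>Basis. V' b \<bullet> b) * vol q vs)"
proof
  fix vs
  note vol = alternating_form_vol[of q]
  have "frechet_derivative (\<lambda>y. vol y (V y # ws)) (at q) v = vol q (V' v # ws)" for ws v
  proof (cases "length ws = 2 * CARD('n)")
    case True
    have "linear (\<lambda>u. vol q (u # ws))"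
      using alternating_formD(2)[OF vol, of "0 # ws" 0] True by simp
    then have *: "((\<lambda>u. vol q (u # ws)) has_derivative (\<lambda>u. vol q (u # ws))) (at (V q))"
      by (simp add: bounded_linear_imp_has_derivative linear_linear)
    have "(\<lambda>y. vol y (V y # ws)) = (\<lambda>y. vol q (V y # ws))"
      using vol_const by metis
    then show ?thesis
      using fun_cong[OF frechet_derivative_at[OF has_derivative_compose[OF V *]], of v] by simp
  next
    case False
    then have "vol y (u # ws) = 0" for y u
      by (intro alternating_formD(1)[OF alternating_form_vol]) simp
    then show ?thesis by (simp add: frechet_derivative_const)
  qed
  then show "ext_deriv (\<lambda>y ws. vol y (V y # ws)) q vs = (\<Sum>b\<in>Basis. V' b \<bullet> b) * vol q vs"
    using top_form_trace[OF vol has_derivative_linear[OF V], of vs] by (simp add: ext_deriv_def)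
qed

lemma mean_curv_eq_divergence:
  fixes \<phi> :: "'n::{finite,linorder} heis \<Rightarrow> real" and p :: real
  defines "V \<equiv> (\<lambda>y. \<Sum>I\<in>UNIV. (diff1 \<phi> y (frame y I) / co_norm y (diff1 \<phi> y) powr (1 - p)) *\<^sub>R frame y I)"
  assumes V: "(V has_derivative V') (at q)"
  shows "mean_curv \<phi> p q = (\<Sum>b\<in>Basis. V' b \<bullet> b)"
  unfolding mean_curv_def
proof (rule the_equality)
  have "surf_form \<phi> p = (\<lambda>y ws. vol y (V y # ws))"
    unfolding surf_form_def hook_eq V_def ..
  then have *: "ext_deriv (surf_form \<phi> p) q = (\<lambda>vs. (\<Sum>b\<in>Basis. V' b \<bullet> b) * vol q vs)"
    using ext_deriv_contraction[OF V] by simp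
  then show "ext_deriv (surf_form \<phi> p) q = (\<lambda>vs. (\<Sum>b\<in>Basis. V' b \<bullet> b) * vol q vs)" .
  fix h assume "ext_deriv (surf_form \<phi> p) q = (\<lambda>vs. h * vol q vs)"
  then have "h * vol q std_basis = (\<Sum>b\<in>Basis. V' b \<bullet> b) * vol q std_basis"
    using * by metis
  then show "h = (\<Sum>b\<in>Basis. V' b \<bullet> b)" by (simp add: vol_std_basis)
qed

section \<open>Normals to a closed set and brackets\<close>

text \<open>\<open>f\<close> need not be differentiable; at each time a differentiable function
  touches it from above. The barrier \<open>G\<close> satisfies G' = M G + 2 \<kappa> exp (M t), and
  the factor 2 makes its slope strictly larger than the bound on \<open>F'\<close> wherever f =
  G.\<close>

lemma gronwall_touching:
  fixes f :: "real \<Rightarrow> real"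
  assumes T: "0 \<le> T" and cont: "continuous_on {0..T} f" and f0: "f 0 \<le> 0" and \<kappa>: "\<kappa> > 0" "M \<ge> 0"
    and touch: "\<And>t. 0 \<le> t \<Longrightarrow> t < T \<Longrightarrow>
      \<exists>F F'. F t = f t \<and> (F has_real_derivative F') (at t) \<and> F' \<le> M * f t + \<kappa> \<and> (\<forall>s. f s \<le> F s)"
  shows "f T \<le> 2 * \<kappa> * T * exp (M * T)"
proof (rule ccontr)
  define G where "G t = 2 * \<kappa> * t * exp (M * t)" for t
  have G': "(G has_real_derivative M * G t + 2 * \<kappa> * exp (M * t)) (at t)" for t
    unfolding G_def by (auto intro!: derivative_eq_intros simp: algebra_simps)
  have contG: "continuous_on A G" for A
    unfolding G_def by (intro continuous_intros)
  assume "\<not> f T \<le> 2 * \<kappa> * T * exp (M * T)"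
  then have fT: "f T > G T" by (simp add: G_def)
  \<comment> \<open>Its supremum is the last time at which \<open>f\<close> is not above the
    barrier. Later \<open>f\<close>, and with it \<open>F\<close>, exceeds \<open>G\<close>; at that
    time F = G, but \<open>F - G\<close> has negative derivative.\<close>
  define S where "S = {t \<in> {0..T}. f t - G t \<le> 0}"
  have "closed S"
    unfolding S_def using cont contG
    using continuous_on_closed_Collect_le[of "{0..T}" "\<lambda>t. f t - G t" "\<lambda>_. 0"]
    by (auto intro: continuous_intros)
  have "0 \<in> S" using T f0 by (simp add: S_def G_def)
  moreover have bdd: "bdd_above S" by (auto simp: S_def bdd_above_def)
  ultimately have t: "Sup S \<in> S" using \<open>closed S\<close> closed_contains_Sup by blast
  define t where "t = Sup S"
  have t: "0 \<le> t" "t \<le> T" "f t \<le> G t" using t by (auto simp: S_def t_def)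
  then have "t < T" using fT by (cases "t = T") auto
  have above: "f s > G s" if "t < s" "s \<le> T" for s
  proof (rule ccontr)
    assume "\<not> f s > G s"
    then have "s \<in> S" using that t by (auto simp: S_def)
    then have "s \<le> t" using bdd by (auto simp: t_def intro: cSup_upper)
    then show False using that by simp
  qed
  obtain F F' where F: "F t = f t" "(F has_real_derivative F') (at t)" "F' \<le> M * f t + \<kappa>"
      "\<forall>s. f s \<le> F s"
    using touch[OF t(1) \<open>t < T\<close>] by blast
  have "f t = G t"
  proof (rule antisym[OF t(3)])
    have "((\<lambda>s. F s - G s) \<longlongrightarrow> F t - G t) (at_right t)"
      using F(2) G'[of t] by (intro tendsto_diff)
        (auto dest!: DERIV_isCont simp: isCont_def intro: tendsto_within_subset)
    moreover have "\<forall>\<^sub>F s in at_right t. 0 \<le> F s - G s"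
      unfolding eventually_at_right[OF \<open>t < T\<close>]
      using above F(4) \<open>t < T\<close> by (intro exI[of _ T]) (auto intro: order_trans[OF less_imp_le])
    ultimately have "0 \<le> F t - G t"
      by (rule tendsto_lowerbound) simp
    then show "G t \<le> f t" using F(1) by simp
  qed
  define D where "D = F' - (M * G t + 2 * \<kappa> * exp (M * t))"
  have "((\<lambda>s. F s - G s) has_real_derivative D) (at t)"
    unfolding D_def by (intro DERIV_diff F(2) G')
  moreover have "D < 0"
  proof -
    have "exp (M * t) \<ge> 1" using t \<kappa> by simp
    then have "2 * \<kappa> * exp (M * t) \<ge> 2 * \<kappa> * 1" using \<kappa> by (intro mult_left_mono) auto
    then show ?thesis using F(3) \<kappa>(1) unfolding D_def \<open>f t = G t\<close> by linarith
  qed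
  ultimately obtain d where d: "d > 0" "\<And>h. h > 0 \<Longrightarrow> h < d \<Longrightarrow> F (t + h) - G (t + h) < F t - G t"
    using DERIV_neg_dec_right by blast
  define h where "h = min (d / 2) (T - t)"
  have "h > 0" "h < d" "t + h \<le> T" using d(1) \<open>t < T\<close> by (auto simp: h_def min_def)
  then show False
    using d(2)[of h] above[of "t + h"] F(1) F(4)[rule_format, of "t + h"] \<open>f t = G t\<close> by auto
qed

lemma eventually_mult_less_at_right_0:
  fixes c d :: real
  assumes "d > 0"
  shows "\<forall>\<^sub>F \<epsilon> in at_right 0. \<epsilon> * c < d"
proof -
  have "((\<lambda>\<epsilon>. \<epsilon> * c) \<longlongrightarrow> 0 * c) (at_right 0)"
    by (intro tendsto_intros)
  then show ?thesis using assms by (intro order_tendstoD(2)) auto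
qed

text \<open>
  The loop \<open>\<gamma>\<close> follows \<open>V1\<close> and \<open>V2\<close> along a circle of radius \<open>\<epsilon>\<close>, up to an error \<open>o(\<epsilon>^2)\<close> in the
  velocity. As the normals of \<open>Z\<close> are orthogonal to \<open>V1\<close> and \<open>V2\<close>, its distance from \<open>Z\<close> stays
  \<open>o(\<epsilon>^2)\<close>; but it ends at \<open>q + \<pi> \<epsilon>^2 [V1, V2](q) + o(\<epsilon>^2)\<close>, which would lie too deep in the ball
  around \<open>c\<close> that avoids \<open>Z\<close>.
\<close>

lemma bracket_normal_le:
  fixes Z :: "'a::euclidean_space set"
  assumes Z: "closed Z" "q \<in> Z" and R: "R > 0"
    and L: "L-lipschitz_on (ball q R) V1" "L-lipschitz_on (ball q R) V2"
    and D1: "(V1 has_derivative D1) (at q)" and D2: "(V2 has_derivative D2) (at q)"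
    and normal: "\<And>y c. y \<in> Z \<Longrightarrow> dist q y < R \<Longrightarrow> (\<And>z. z \<in> Z \<Longrightarrow> dist c y \<le> dist c z) \<Longrightarrow>
      (c - y) \<bullet> V1 y = 0 \<and> (c - y) \<bullet> V2 y = 0"
    and c: "\<And>z. z \<in> Z \<Longrightarrow> dist c q \<le> dist c z"
  shows "(c - q) \<bullet> (D2 (V1 q) - D1 (V2 q)) \<le> 0"
proof (rule ccontr)
  define B where "B = D2 (V1 q) - D1 (V2 q)"
  define \<beta> where "\<beta> = (c - q) \<bullet> B"
  define r where "r = norm (c - q)"
  assume "\<not> (c - q) \<bullet> (D2 (V1 q) - D1 (V2 q)) \<le> 0"
  then have \<beta>: "\<beta> > 0" by (simp add: \<beta>_def B_def)
  have L0: "L \<ge> 0" using L(1) by (rule lipschitz_on_nonneg)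
  interpret D1: bounded_linear D1 using D1 by (rule has_derivative_bounded_linear)
  interpret D2: bounded_linear D2 using D2 by (rule has_derivative_bounded_linear)
  \<comment> \<open>\<open>q + \<epsilon> p1 + \<epsilon>^2 p2\<close> solves \<gamma>' = \<epsilon>
    (- sin t V1 + cos t V2) up to second order in \<epsilon>. \<open>A\<close> is the integral of -
    sin^2, so A (2 * pi) = - pi: this enclosed area leaves pi times the bracket at the end of the
    loop, while all terms without \<open>A\<close> return to 0.\<close>
  define p1 where "p1 t = (cos t - 1) *\<^sub>R V1 q + sin t *\<^sub>R V2 q" for t
  define A where "A t = - (t / 2 - sin t * cos t / 2)" for t :: real
  define p2 where "p2 t = ((cos t - 1)\<^sup>2 / 2) *\<^sub>R D1 (V1 q) + ((sin t)\<^sup>2 / 2) *\<^sub>R D2 (V2 q)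
      + A t *\<^sub>R D1 (V2 q) + ((cos t - 1) * sin t - A t) *\<^sub>R D2 (V1 q)" for t
  have p1': "(p1 has_vector_derivative (- sin t *\<^sub>R V1 q + cos t *\<^sub>R V2 q)) (at t)" for t
    unfolding p1_def by (auto intro!: derivative_eq_intros)
  have cs: "cos t * cos t = 1 - sin t * sin t" for t :: real
    using sin_cos_squared_add[of t] by (simp add: power2_eq_square)
  have A': "(A has_real_derivative (- sin t * sin t)) (at t)" for t
    unfolding A_def by (auto intro!: derivative_eq_intros simp: cs field_simps)
  have p2': "(p2 has_vector_derivative (- sin t *\<^sub>R D1 (p1 t) + cos t *\<^sub>R D2 (p1 t))) (at t)" for t
  proof -
    have "((\<lambda>t. (cos t - 1)\<^sup>2 / 2) has_real_derivative (- sin t * (cos t - 1))) (at t)"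
      "((\<lambda>t. (sin t)\<^sup>2 / 2) has_real_derivative (cos t * sin t)) (at t)"
      "((\<lambda>t. (cos t - 1) * sin t - A t) has_real_derivative (cos t * (cos t - 1))) (at t)"
      by (auto intro!: derivative_eq_intros A' simp: cs algebra_simps diff_divide_distrib)
    note this[THEN has_vector_derivative_scaleR[OF _ has_vector_derivative_const]]
      A'[THEN has_vector_derivative_scaleR[OF _ has_vector_derivative_const]]
    note d = has_vector_derivative_add[OF has_vector_derivative_add[OF
          has_vector_derivative_add[OF this(1,2)] this(4)] this(3)]
    show ?thesis
      unfolding p2_def[abs_def]
      by (rule has_vector_derivative_eq_rhs[OF d])
        (simp add: p1_def D1.add D2.add D1.diff D2.diff D1.scaleR D2.scaleR scaleR_add_right algebra_simps)
  qed
  have cont: "continuous_on X p1" "continuous_on X p2" for X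
    using p1' p2' by (auto intro!: continuous_at_imp_continuous_on has_vector_derivative_continuous)
  have "bounded (p1 ` {0..2*pi} \<union> p2 ` {0..2*pi})"
    by (intro bounded_Un[THEN iffD2] conjI compact_imp_bounded compact_continuous_image cont) auto
  then obtain K where K: "K > 0" "\<And>t. t \<in> {0..2*pi} \<Longrightarrow> norm (p1 t) \<le> K \<and> norm (p2 t) \<le> K"
    by (auto simp: bounded_pos)
  obtain C1 where C1: "\<And>v. norm (D1 v) \<le> norm v * C1" using D1.bounded by blast
  obtain C2 where C2: "\<And>v. norm (D2 v) \<le> norm v * C2" using D2.bounded by blast
  define C where "C = max 0 (max C1 C2)"
  have C: "C \<ge> 0" "norm (D1 v) \<le> C * norm v" "norm (D2 v) \<le> C * norm v" for v
  proof -
    have "C1 \<le> C" "C2 \<le> C" by (auto simp: C_def)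
    then show "norm (D1 v) \<le> C * norm v" "norm (D2 v) \<le> C * norm v"
      using order_trans[OF C1 mult_left_mono[of C1 C "norm v"]]
        order_trans[OF C2 mult_left_mono[of C2 C "norm v"]] by (simp_all add: mult.commute)
  qed (simp add: C_def)
  \<comment> \<open>4 L comes from the squared distance along two Lipschitz fields, 1 from absorbing
    the mixed error term. \<open>E\<close> is the square root of the Gronwall factor and converts
    the estimate to the distance itself. \<eta> is so small that, on the scale \<epsilon>^2, this
    distance costs at most half of pi * \<beta>; the 1 in \<open>X + 1\<close> excludes a zero
    denominator.\<close>
  define M where "M = 4 * L + 1"
  define E where "E = sqrt (4 * pi * exp (M * (2 * pi)))"
  have E: "E \<ge> 0" "E\<^sup>2 = 4 * pi * exp (M * (2 * pi))" by (auto simp: E_def)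
  define X where "X = 12 * r * K * E"
  have X: "X \<ge> 0" using K E by (simp add: X_def r_def)
  define \<eta> where "\<eta> = pi * \<beta> / 2 / (X + 1)"
  have \<eta>: "\<eta> > 0" using \<beta> X unfolding \<eta>_def by (intro divide_pos_pos mult_pos_pos) auto
  have \<eta>_le: "12 * r * K * E * \<eta> \<le> pi * \<beta> / 2"
  proof -
    have "a \<noteq> 0 \<Longrightarrow> a * (b / a) = b" for a b :: real by simp
    moreover have "X + 1 \<noteq> 0" using X by linarith
    ultimately have "(X + 1) * \<eta> = pi * \<beta> / 2" unfolding \<eta>_def by blast
    then show ?thesis using \<eta> by (simp add: X_def algebra_simps)
  qed
  obtain d1 where d1: "d1 > 0" "\<And>y. norm (y - q) < d1 \<Longrightarrow> norm (V1 y - V1 q - D1 (y - q)) \<le> \<eta> * norm (y - q)"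
    using D1[unfolded has_derivative_at_alt] \<eta> by blast
  obtain d2 where d2: "d2 > 0" "\<And>y. norm (y - q) < d2 \<Longrightarrow> norm (V2 y - V2 q - D2 (y - q)) \<le> \<eta> * norm (y - q)"
    using D2[unfolded has_derivative_at_alt] \<eta> by blast
  have "\<forall>\<^sub>F \<epsilon> in at_right 0. 0 < \<epsilon> \<and> \<epsilon> * 1 < 1 \<and> \<epsilon> * C < \<eta> \<and> \<epsilon> * (2 * K) < d1 \<and> \<epsilon> * (2 * K) < d2 \<and>
      \<epsilon> * (2 * K) < R / 2 \<and> \<epsilon> * (pi * (norm B)\<^sup>2) < \<beta> / 2"
    using \<eta> d1 d2 R \<beta>
    by (intro eventually_conj eventually_mult_less_at_right_0) (auto simp: eventually_at_right_less)
  \<comment> \<open>\<epsilon> C < \<eta> absorbs the third order terms; 2 K \<epsilon> bounds the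
    size of the loop, and R / 2 keeps the points of \<open>Z\<close> nearest to it within
    \<open>R\<close> of \<open>q\<close>; the last bound makes the square of the displacement
    negligible.\<close>
  then obtain \<epsilon> where \<epsilon>: "0 < \<epsilon>" "\<epsilon> < 1" "\<epsilon> * C < \<eta>" "\<epsilon> * (2 * K) < d1" "\<epsilon> * (2 * K) < d2"
      "\<epsilon> * (2 * K) < R / 2" "\<epsilon> * (pi * (norm B)\<^sup>2) < \<beta> / 2"
    using eventually_happens by force
  define \<gamma> where "\<gamma> t = q + \<epsilon> *\<^sub>R p1 t + (\<epsilon>\<^sup>2) *\<^sub>R p2 t" for t
  define \<gamma>' where "\<gamma>' t = \<epsilon> *\<^sub>R (- sin t *\<^sub>R V1 q + cos t *\<^sub>R V2 q)
      + (\<epsilon>\<^sup>2) *\<^sub>R (- sin t *\<^sub>R D1 (p1 t) + cos t *\<^sub>R D2 (p1 t))" for t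
  have \<gamma>': "(\<gamma> has_vector_derivative \<gamma>' t) (at t)" for t
    unfolding \<gamma>_def \<gamma>'_def
    by (rule has_vector_derivative_eq_rhs,
        (rule has_vector_derivative_add has_vector_derivative_const
          has_vector_derivative_scaleR[OF DERIV_const] p1' p2')+) simp
  have "\<epsilon>\<^sup>2 \<le> \<epsilon>" using \<epsilon> by (simp add: power2_eq_square)
  have \<gamma>_near: "norm (\<gamma> t - q) \<le> \<epsilon> * (2 * K)" if t: "t \<in> {0..2*pi}" for t
  proof -
    have "norm (\<gamma> t - q) \<le> \<epsilon> * norm (p1 t) + \<epsilon>\<^sup>2 * norm (p2 t)"
      unfolding \<gamma>_def using norm_triangle_ineq[of "\<epsilon> *\<^sub>R p1 t" "(\<epsilon>\<^sup>2) *\<^sub>R p2 t"] \<epsilon>(1) by simp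
    also have "\<dots> \<le> \<epsilon> * K + \<epsilon> * K"
      using K(2)[OF t] \<epsilon>(1) \<open>\<epsilon>\<^sup>2 \<le> \<epsilon>\<close> by (intro add_mono mult_mono) auto
    finally show ?thesis by (simp add: algebra_simps)
  qed
  \<comment> \<open>The velocity error. All terms up to order \<epsilon>^2 cancel, leaving
    \<epsilon>^3 times \<open>D1 (p2 t)\<close>, \<open>D2 (p2 t)\<close> and \<epsilon> times the
    Taylor remainders of the fields.\<close>
  define res where "res t = \<gamma>' t - (\<epsilon> * - sin t) *\<^sub>R V1 (\<gamma> t) - (\<epsilon> * cos t) *\<^sub>R V2 (\<gamma> t)" for t
  have res: "norm (res t) \<le> 6 * K * \<eta> * \<epsilon>\<^sup>2" if t: "t \<in> {0..2*pi}" for t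
  proof -
    define r1 where "r1 = V1 (\<gamma> t) - V1 q - D1 (\<gamma> t - q)"
    define r2 where "r2 = V2 (\<gamma> t) - V2 q - D2 (\<gamma> t - q)"
    have g: "\<gamma> t - q = \<epsilon> *\<^sub>R p1 t + (\<epsilon>\<^sup>2) *\<^sub>R p2 t" by (simp add: \<gamma>_def)
    have V: "V1 (\<gamma> t) = V1 q + (\<epsilon> *\<^sub>R D1 (p1 t) + (\<epsilon>\<^sup>2) *\<^sub>R D1 (p2 t)) + r1"
      "V2 (\<gamma> t) = V2 q + (\<epsilon> *\<^sub>R D2 (p1 t) + (\<epsilon>\<^sup>2) *\<^sub>R D2 (p2 t)) + r2"
      by (simp_all add: r1_def r2_def g D1.add D1.scaleR D2.add D2.scaleR)
    have r: "norm r1 \<le> \<eta> * (\<epsilon> * (2 * K))" "norm r2 \<le> \<eta> * (\<epsilon> * (2 * K))"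
      using d1(2)[of "\<gamma> t"] d2(2)[of "\<gamma> t"] \<gamma>_near[OF t] \<epsilon>(4,5) \<eta>
      by (auto simp: r1_def r2_def intro: order_trans mult_left_mono)
    have b: "norm ((\<epsilon>\<^sup>2) *\<^sub>R D (p2 t) + s) \<le> \<epsilon> * (3 * K * \<eta>)"
      if "norm (D (p2 t)) \<le> C * norm (p2 t)" "norm s \<le> \<eta> * (\<epsilon> * (2 * K))" for D :: "'a \<Rightarrow> 'a" and s
    proof -
      have "norm ((\<epsilon>\<^sup>2) *\<^sub>R D (p2 t) + s) \<le> \<epsilon>\<^sup>2 * norm (D (p2 t)) + norm s"
        using norm_triangle_ineq[of "(\<epsilon>\<^sup>2) *\<^sub>R D (p2 t)" s] by simp
      also have "\<dots> \<le> \<epsilon>\<^sup>2 * (C * K) + \<eta> * (\<epsilon> * (2 * K))"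
        using that K(2)[OF t] C(1) by (intro add_mono mult_left_mono) (auto intro: order_trans mult_left_mono)
      also have "\<epsilon>\<^sup>2 * (C * K) = \<epsilon> * K * (\<epsilon> * C)" by (simp add: power2_eq_square)
      also have "\<epsilon> * K * (\<epsilon> * C) \<le> \<epsilon> * K * \<eta>" using \<epsilon> K by (intro mult_left_mono) auto
      finally show ?thesis by (simp add: algebra_simps)
    qed
    have "res t = (\<epsilon> * sin t) *\<^sub>R ((\<epsilon>\<^sup>2) *\<^sub>R D1 (p2 t) + r1) - (\<epsilon> * cos t) *\<^sub>R ((\<epsilon>\<^sup>2) *\<^sub>R D2 (p2 t) + r2)"
      unfolding res_def V \<gamma>'_def by (simp add: algebra_simps power2_eq_square)
    also have "norm \<dots> \<le> \<bar>\<epsilon> * sin t\<bar> * norm ((\<epsilon>\<^sup>2) *\<^sub>R D1 (p2 t) + r1)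
        + \<bar>\<epsilon> * cos t\<bar> * norm ((\<epsilon>\<^sup>2) *\<^sub>R D2 (p2 t) + r2)"
      by (rule order_trans[OF norm_triangle_ineq4]) simp
    also have "\<dots> \<le> \<epsilon> * (\<epsilon> * (3 * K * \<eta>)) + \<epsilon> * (\<epsilon> * (3 * K * \<eta>))"
      using \<epsilon>(1) C r b by (intro add_mono mult_mono) (auto simp: abs_mult)
    finally show ?thesis by (simp add: algebra_simps power2_eq_square)
  qed
  define \<eta>' where "\<eta>' = 6 * K * \<eta>"
  have \<eta>': "\<eta>' > 0" using K \<eta> by (simp add: \<eta>'_def)
  define f where "f t = (infdist (\<gamma> t) Z)\<^sup>2" for t
  define \<kappa> where "\<kappa> = (\<eta>' * \<epsilon>\<^sup>2)\<^sup>2"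
  have "Z \<noteq> {}" using Z by auto
  have touch: "\<exists>F F'. F t = f t \<and> (F has_real_derivative F') (at t) \<and> F' \<le> M * f t + \<kappa> \<and> (\<forall>s. f s \<le> F s)"
    if "0 \<le> t" "t < 2 * pi" for t
  proof -
    have t: "t \<in> {0..2*pi}" using that by simp
    \<comment> \<open>The squared distance from the fixed point \<open>z\<close> touches
      \<open>f\<close> from above at \<open>t\<close>. Since \<open>\<gamma> t - z\<close> is a
      normal at \<open>z\<close>, the fields may be replaced by their increments from
      \<open>z\<close> to \<open>\<gamma> t\<close>, of size at most L d.\<close>
    obtain z where z: "z \<in> Z" "infdist (\<gamma> t) Z = dist (\<gamma> t) z"
      using infdist_attains_inf[OF Z(1) \<open>Z \<noteq> {}\<close>] by metis
    define d where "d = norm (\<gamma> t - z)"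
    have fd: "f t = d\<^sup>2" by (simp add: f_def z(2) d_def dist_norm)
    have zmin: "dist (\<gamma> t) z \<le> dist (\<gamma> t) y" if "y \<in> Z" for y
      using infdist_le[OF that, of "\<gamma> t"] z by simp
    have dq: "dist (\<gamma> t) q < R / 2" using \<gamma>_near[OF t] \<epsilon>(6) by (simp add: dist_norm)
    then have zR: "dist q z < R"
      using dist_triangle[of q z "\<gamma> t"] zmin[OF Z(2)] by (simp add: dist_commute)
    have \<gamma>R: "dist q (\<gamma> t) < R" using dq R by (simp add: dist_commute)
    have n: "(\<gamma> t - z) \<bullet> V1 z = 0" "(\<gamma> t - z) \<bullet> V2 z = 0"
      using normal[OF z(1) zR, of "\<gamma> t"] zmin by auto
    have Vd: "norm (V1 (\<gamma> t) - V1 z) \<le> L * d" "norm (V2 (\<gamma> t) - V2 z) \<le> L * d"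
      using lipschitz_on_normD[OF L(1), of "\<gamma> t" z] lipschitz_on_normD[OF L(2), of "\<gamma> t" z] zR \<gamma>R
      by (auto simp: d_def)
    have \<gamma>'_eq: "\<gamma>' t = (\<epsilon> * - sin t) *\<^sub>R V1 (\<gamma> t) + (\<epsilon> * cos t) *\<^sub>R V2 (\<gamma> t) + res t"
      by (simp add: res_def)
    have "(\<gamma> t - z) \<bullet> \<gamma>' t = (\<gamma> t - z) \<bullet> ((\<epsilon> * - sin t) *\<^sub>R (V1 (\<gamma> t) - V1 z)
        + (\<epsilon> * cos t) *\<^sub>R (V2 (\<gamma> t) - V2 z) + res t)"
      unfolding \<gamma>'_eq inner_add_right inner_scaleR_right inner_diff_right n by simp
    also have "\<dots> \<le> d * norm ((\<epsilon> * - sin t) *\<^sub>R (V1 (\<gamma> t) - V1 z)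
        + (\<epsilon> * cos t) *\<^sub>R (V2 (\<gamma> t) - V2 z) + res t)"
      unfolding d_def by (rule norm_cauchy_schwarz)
    also have "\<dots> \<le> d * (L * d + L * d + \<eta>' * \<epsilon>\<^sup>2)"
    proof (intro mult_left_mono norm_triangle_le add_mono)
      have e: "\<bar>\<epsilon> * - sin t\<bar> \<le> 1" "\<bar>\<epsilon> * cos t\<bar> \<le> 1"
        using \<epsilon>(1,2) by (auto simp: abs_mult intro!: mult_le_one)
      show "norm ((\<epsilon> * - sin t) *\<^sub>R (V1 (\<gamma> t) - V1 z)) \<le> L * d"
        using mult_mono[OF e(1) Vd(1)] by (simp add: d_def)
      show "norm ((\<epsilon> * cos t) *\<^sub>R (V2 (\<gamma> t) - V2 z)) \<le> L * d"
        using mult_mono[OF e(2) Vd(2)] by (simp add: d_def)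
      show "norm (res t) \<le> \<eta>' * \<epsilon>\<^sup>2" using res[OF t] by (simp add: \<eta>'_def)
    qed (simp add: d_def)
    finally have 1: "2 * ((\<gamma> t - z) \<bullet> \<gamma>' t) \<le> 4 * L * d\<^sup>2 + 2 * d * (\<eta>' * \<epsilon>\<^sup>2)"
      by (simp add: algebra_simps power2_eq_square)
    have "2 * d * (\<eta>' * \<epsilon>\<^sup>2) \<le> d\<^sup>2 + \<kappa>"
      unfolding \<kappa>_def using sum_squares_bound[of d "\<eta>' * \<epsilon>\<^sup>2"] by simp
    with 1 have 2: "2 * ((\<gamma> t - z) \<bullet> \<gamma>' t) \<le> M * f t + \<kappa>" by (simp add: M_def fd algebra_simps)
    have "((\<lambda>s. (\<gamma> s - z) \<bullet> (\<gamma> s - z)) has_real_derivative 2 * ((\<gamma> t - z) \<bullet> \<gamma>' t)) (at t)"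
      using \<gamma>'[of t] unfolding has_vector_derivative_def has_field_derivative_def
      by (auto intro!: derivative_eq_intros simp: inner_commute algebra_simps)
    moreover have "f s \<le> (\<gamma> s - z) \<bullet> (\<gamma> s - z)" for s
      using power_mono[OF infdist_le[OF z(1), of "\<gamma> s"] infdist_nonneg, of 2]
      by (simp add: f_def dist_norm power2_norm_eq_inner)
    ultimately show ?thesis
      using 2 by (intro exI[of _ "\<lambda>s. (\<gamma> s - z) \<bullet> (\<gamma> s - z)"] exI[of _ "2 * ((\<gamma> t - z) \<bullet> \<gamma>' t)"])
        (simp add: fd d_def power2_norm_eq_inner)
  qed
  have cont\<gamma>: "continuous_on {0..2*pi} \<gamma>"
    using \<gamma>' by (auto intro!: continuous_at_imp_continuous_on has_vector_derivative_continuous)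
  have "f (2 * pi) \<le> 2 * \<kappa> * (2 * pi) * exp (M * (2 * pi))"
  proof (rule gronwall_touching[OF _ _ _ _ _ touch])
    show "continuous_on {0..2*pi} f"
      unfolding f_def by (intro continuous_intros cont\<gamma>)
    show "f 0 \<le> 0" using Z by (simp add: f_def \<gamma>_def p1_def p2_def A_def)
    show "\<kappa> > 0" using \<eta>' \<epsilon> by (simp add: \<kappa>_def)
    show "M \<ge> 0" using L0 by (simp add: M_def)
  qed simp_all
  also have "\<dots> = (\<eta>' * \<epsilon>\<^sup>2 * E)\<^sup>2"
    by (simp add: \<kappa>_def power_mult_distrib E(2))
  finally have dist_le: "infdist (\<gamma> (2 * pi)) Z \<le> \<eta>' * \<epsilon>\<^sup>2 * E"
    unfolding f_def by (rule power2_le_imp_le) (use \<eta>' E in auto)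
  obtain z where z: "z \<in> Z" "infdist (\<gamma> (2 * pi)) Z = dist (\<gamma> (2 * pi)) z"
    using infdist_attains_inf[OF Z(1) \<open>Z \<noteq> {}\<close>] by metis
  \<comment> \<open>Moving from \<open>q\<close> to the end of the loop changes the squared distance
    from \<open>c\<close> by - 2 P + T. As \<open>z\<close> is not inside the ball of radius
    \<open>r\<close> around \<open>c\<close>, the decrease 2 P - T is at most 2 r d; but
    \<open>2 * r * d\<close> and \<open>T\<close> are each at most P / 2.\<close>
  define P where "P = \<epsilon>\<^sup>2 * (pi * \<beta>)"
  define T where "T = (\<epsilon>\<^sup>2 * pi)\<^sup>2 * (norm B)\<^sup>2"
  define x where "x = norm (c - \<gamma> (2 * pi))"
  define d where "d = dist (\<gamma> (2 * pi)) z"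
  have "r \<le> x + d"
    using c[OF z(1)] dist_triangle[of c z "\<gamma> (2 * pi)"] by (simp add: r_def x_def d_def dist_norm)
  moreover have "0 \<le> x" "0 \<le> d" "0 \<le> r" by (auto simp: x_def d_def r_def)
  ultimately have "r\<^sup>2 - 2 * r * d \<le> x\<^sup>2"
  proof (cases "r \<le> d")
    case True
    then have "r * r \<le> 2 * r * d" using \<open>0 \<le> r\<close> \<open>0 \<le> d\<close> mult_left_mono[of r "2 * d" r] by simp
    moreover have "0 \<le> x * x" by simp
    ultimately show ?thesis unfolding power2_eq_square by linarith
  next
    case False
    then have "(r - d)\<^sup>2 \<le> x\<^sup>2" using \<open>r \<le> x + d\<close> by (intro power_mono) auto
    then show ?thesis unfolding power2_diff using zero_le_power2[of d] by linarith
  qed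
  moreover have "\<gamma> (2 * pi) = q + (\<epsilon>\<^sup>2 * pi) *\<^sub>R B"
    by (simp add: \<gamma>_def p1_def p2_def A_def B_def scaleR_diff_right)
  then have "x\<^sup>2 = r\<^sup>2 - 2 * P + T"
    unfolding x_def r_def \<beta>_def power2_norm_eq_inner P_def T_def
    by (simp add: inner_diff_left inner_diff_right inner_add_left inner_add_right inner_commute
        power2_eq_square algebra_simps)
  moreover have "2 * r * d \<le> P / 2"
  proof -
    have "2 * r * d \<le> 2 * r * (\<eta>' * \<epsilon>\<^sup>2 * E)"
      using dist_le z(2) \<open>0 \<le> r\<close> by (intro mult_left_mono) (auto simp: d_def)
    also have "\<dots> = \<epsilon>\<^sup>2 * (12 * r * K * E * \<eta>)"
      by (simp add: \<eta>'_def)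
    also have "\<dots> \<le> \<epsilon>\<^sup>2 * (pi * \<beta> / 2)"
      using \<eta>_le by (intro mult_left_mono) auto
    finally show ?thesis by (simp add: P_def)
  qed
  moreover have "T \<le> P / 2"
  proof -
    have "T = \<epsilon>\<^sup>2 * (pi * (\<epsilon> * (\<epsilon> * (pi * (norm B)\<^sup>2))))"
      by (simp add: T_def power2_eq_square algebra_simps)
    also have "\<dots> \<le> \<epsilon>\<^sup>2 * (pi * (1 * (\<epsilon> * (pi * (norm B)\<^sup>2))))"
      using \<epsilon>(1,2) by (intro mult_left_mono mult_right_mono) auto
    also have "\<dots> \<le> \<epsilon>\<^sup>2 * (pi * (\<beta> / 2))"
      using \<epsilon>(7) by (intro mult_left_mono) auto
    finally show ?thesis by (simp add: P_def)
  qed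
  ultimately have "P \<le> 0" by linarith
  moreover have "P > 0" using \<epsilon>(1) \<beta> by (simp add: P_def)
  ultimately show False by simp
qed

text \<open>Exchanging the fields reverses the sign of the bracket.\<close>

lemma bracket_normal_eq_0:
  fixes Z :: "'a::euclidean_space set"
  assumes Z: "closed Z" "q \<in> Z" and R: "R > 0"
    and L: "L-lipschitz_on (ball q R) V1" "L-lipschitz_on (ball q R) V2"
    and D: "(V1 has_derivative D1) (at q)" "(V2 has_derivative D2) (at q)"
    and normal: "\<And>y c. y \<in> Z \<Longrightarrow> dist q y < R \<Longrightarrow> (\<And>z. z \<in> Z \<Longrightarrow> dist c y \<le> dist c z) \<Longrightarrow>
      (c - y) \<bullet> V1 y = 0 \<and> (c - y) \<bullet> V2 y = 0"
    and c: "\<And>z. z \<in> Z \<Longrightarrow> dist c q \<le> dist c z"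
  shows "(c - q) \<bullet> (D2 (V1 q) - D1 (V2 q)) = 0"
proof -
  have "(c - q) \<bullet> (D1 (V2 q) - D2 (V1 q)) \<le> 0"
    by (rule bracket_normal_le[OF Z R L(2,1) D(2,1) _ c]) (use normal in blast)
  moreover have "(c - q) \<bullet> (D2 (V1 q) - D1 (V2 q)) \<le> 0"
    by (rule bracket_normal_le[OF Z R L D _ c]) (use normal in blast)
  ultimately show ?thesis by (simp add: inner_diff_right)
qed

section \<open>Horizontal derivatives\<close>

text \<open>Valid even where no derivative exists: \<open>frechet_derivative\<close> is a choice
  among the derivatives, and both functions have the same ones.\<close>

lemma frechet_derivative_cong_ev:
  fixes f g :: "'a::real_normed_vector \<Rightarrow> 'b::real_normed_vector"
  assumes "\<forall>\<^sub>F y in nhds x. f y = g y"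
  shows "frechet_derivative f (at x) = frechet_derivative g (at x)"
proof -
  have "(g has_derivative D) (at x)"
    if "(f has_derivative D) (at x)" "\<forall>\<^sub>F y in nhds x. f y = g y" for f g :: "'a \<Rightarrow> 'b" and D
    using that(1)
    by (rule has_derivative_transform_eventually)
      (use that(2) in \<open>auto simp: eventually_at_filter elim: eventually_mono dest: eventually_nhds_x_imp_x\<close>)
  then have "(f has_derivative D) (at x) \<longleftrightarrow> (g has_derivative D) (at x)" for D
    using assms by (auto simp: eq_commute)
  then show ?thesis by (simp add: frechet_derivative_def)
qed

text \<open>The z-component of the frame vector. Being linear in \<open>y\<close>, it makes the
  frame fields affine.\<close>

definition slope :: "'n + 'n \<Rightarrow> 'n::finite heis \<Rightarrow> real" where
  "slope I y = (case I of Inl j \<Rightarrow> fst y $ Inr j | Inr j \<Rightarrow> - fst y $ Inl j)"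

lemma frame_eq: "frame y I = (axis I 1, slope I y)"
  by (cases I) (auto simp: frame_def slope_def Theta_def dx_def axis_def if_distrib[of "\<lambda>x. _ * x"]
      sum_subtractf sum_negf cong: if_cong)

lemma frame_eq_add: "frame y I = (axis I 1, 0) + slope I y *\<^sub>R (0, 1)"
  by (simp add: frame_eq)

lemma bounded_linear_slope: "bounded_linear (slope I :: 'n::finite heis \<Rightarrow> real)"
  unfolding linear_conv_bounded_linear[symmetric]
  by (rule linearI) (auto simp: slope_def split: sum.split)

lemma slope_simps: "slope I (0, z) = 0" "slope I (0 :: 'n::finite heis) = 0"
  by (auto simp: slope_def split: sum.split)

lemma frame_has_derivative:
  "((\<lambda>y. frame y I) has_derivative (\<lambda>u. (0, slope I u))) (at (x :: 'n::finite heis))"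
  unfolding frame_eq
  by (rule has_derivative_Pair[OF has_derivative_const
        bounded_linear_imp_has_derivative[OF bounded_linear_slope]])

lemma continuous_frame: "continuous_on A (\<lambda>y. frame y I :: 'n::finite heis)"
  by (intro continuous_at_imp_continuous_on ballI has_derivative_continuous[OF frame_has_derivative])

section \<open>Second derivatives and the conditions at a minimum\<close>

definition twice_diff_on :: "'a::real_normed_vector set \<Rightarrow> ('a \<Rightarrow> real) \<Rightarrow> bool" where
  "twice_diff_on U f \<longleftrightarrow> open U \<and> (\<forall>x\<in>U. f differentiable (at x)) \<and>
     (\<forall>v. \<forall>x\<in>U. (\<lambda>y. frechet_derivative f (at y) v) differentiable (at x))"

definition second_deriv :: "('a::real_normed_vector \<Rightarrow> real) \<Rightarrow> 'a \<Rightarrow> 'a \<Rightarrow> 'a \<Rightarrow> real" where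
  "second_deriv f x u v = frechet_derivative (\<lambda>y. frechet_derivative f (at y) v) (at x) u"

lemma second_deriv_eqI:
  "((\<lambda>y. frechet_derivative f (at y) v) has_derivative D) (at x) \<Longrightarrow> second_deriv f x u v = D u"
  by (simp add: second_deriv_def frechet_derivative_at[symmetric])

lemma twice_diff_onD:
  assumes "twice_diff_on U f" "x \<in> U"
  shows "(f has_derivative frechet_derivative f (at x)) (at x)"
    and "((\<lambda>y. frechet_derivative f (at y) v) has_derivative (\<lambda>u. second_deriv f x u v)) (at x)"
    and "linear (frechet_derivative f (at x))"
    and "linear (\<lambda>u. second_deriv f x u v)"
  using assms unfolding twice_diff_on_def second_deriv_def
  by (auto simp: frechet_derivative_works[symmetric] linear_frechet_derivative)

lemma twice_diff_on_eventually:
  assumes "twice_diff_on U f" "x \<in> U"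
  shows "\<forall>\<^sub>F y in nhds x. y \<in> U"
  using assms by (auto simp: twice_diff_on_def eventually_nhds_in_open)

lemma twice_diff_on_linear:
  assumes f: "twice_diff_on U f" and g: "twice_diff_on U g"
  shows "twice_diff_on U (\<lambda>x. f x + c * g x)"
    and "x \<in> U \<Longrightarrow> frechet_derivative (\<lambda>x. f x + c * g x) (at x)
      = (\<lambda>v. frechet_derivative f (at x) v + c * frechet_derivative g (at x) v)"
    and "x \<in> U \<Longrightarrow> second_deriv (\<lambda>x. f x + c * g x) x u v = second_deriv f x u v + c * second_deriv g x u v"
proof -
  have d: "((\<lambda>x. f x + c * g x) has_derivative
      (\<lambda>v. frechet_derivative f (at x) v + c * frechet_derivative g (at x) v)) (at x)" if "x \<in> U" for x
    using twice_diff_onD(1)[OF f that] twice_diff_onD(1)[OF g that] by (auto intro!: derivative_eq_intros)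
  show fd: "frechet_derivative (\<lambda>x. f x + c * g x) (at x)
      = (\<lambda>v. frechet_derivative f (at x) v + c * frechet_derivative g (at x) v)" if "x \<in> U" for x
    using d[OF that] by (rule frechet_derivative_at[symmetric])
  have dd: "((\<lambda>y. frechet_derivative (\<lambda>x. f x + c * g x) (at y) v) has_derivative
      (\<lambda>u. second_deriv f x u v + c * second_deriv g x u v)) (at x)" if "x \<in> U" for x v
  proof (rule has_derivative_transform_eventually[where f = "\<lambda>y. frechet_derivative f (at y) v + c * frechet_derivative g (at y) v"])
    show "((\<lambda>y. frechet_derivative f (at y) v + c * frechet_derivative g (at y) v) has_derivative
      (\<lambda>u. second_deriv f x u v + c * second_deriv g x u v)) (at x)"
      using twice_diff_onD(2)[OF f that] twice_diff_onD(2)[OF g that] by (auto intro!: derivative_eq_intros)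
    show "\<forall>\<^sub>F y in at x. frechet_derivative f (at y) v + c * frechet_derivative g (at y) v =
       frechet_derivative (\<lambda>x. f x + c * g x) (at y) v"
      using twice_diff_on_eventually[OF f that] by (auto simp: eventually_at_filter fd elim: eventually_mono)
    show "frechet_derivative f (at x) v + c * frechet_derivative g (at x) v =
       frechet_derivative (\<lambda>x. f x + c * g x) (at x) v" by (simp add: fd that)
  qed simp
  show "twice_diff_on U (\<lambda>x. f x + c * g x)"
    using f differentiableI[OF d] differentiableI[OF dd] by (simp add: twice_diff_on_def)
  show "second_deriv (\<lambda>x. f x + c * g x) x u v = second_deriv f x u v + c * second_deriv g x u v" if "x \<in> U"
    by (rule second_deriv_eqI[OF dd[OF that]])
qed

lemma second_deriv_linear_right:
  assumes f: "twice_diff_on U f" and x: "x \<in> U"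
  shows "linear (second_deriv f x u)"
proof (rule linearI)
  note ev = twice_diff_on_eventually[OF f x]
  fix v w c
  have "((\<lambda>y. frechet_derivative f (at y) (v + w)) has_derivative (\<lambda>u. second_deriv f x u v + second_deriv f x u w)) (at x)"
    using has_derivative_add[OF twice_diff_onD(2)[OF f x, of v] twice_diff_onD(2)[OF f x, of w]]
    by (rule has_derivative_transform_eventually)
      (use ev x f in \<open>auto simp: eventually_at_filter twice_diff_onD linear_add elim!: eventually_mono\<close>)
  then show "second_deriv f x u (v + w) = second_deriv f x u v + second_deriv f x u w"
    by (rule second_deriv_eqI)
  have "((\<lambda>y. frechet_derivative f (at y) (c *\<^sub>R v)) has_derivative (\<lambda>u. c *\<^sub>R second_deriv f x u v)) (at x)"
    using has_derivative_scaleR_right[OF twice_diff_onD(2)[OF f x, of v], of c]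
    by (rule has_derivative_transform_eventually)
      (use ev x f in \<open>auto simp: eventually_at_filter twice_diff_onD linear_scale elim!: eventually_mono\<close>)
  then show "second_deriv f x u (c *\<^sub>R v) = c *\<^sub>R second_deriv f x u v"
    by (rule second_deriv_eqI)
qed

lemma local_min_second_deriv_nonneg:
  assumes f: "twice_diff_on U f" and x: "x \<in> U" and min: "\<forall>\<^sub>F y in nhds x. f x \<le> f y"
  shows "frechet_derivative f (at x) = (\<lambda>v. 0)" and "second_deriv f x v v \<ge> 0"
proof -
  obtain W where W: "open W" "x \<in> W" "\<And>y. y \<in> W \<Longrightarrow> f x \<le> f y"
    using min unfolding eventually_nhds by blast
  show z: "frechet_derivative f (at x) = (\<lambda>v. 0)"
    by (rule differential_zero_maxmin[OF W(2,1) twice_diff_onD(1)[OF f x]]) (use W in auto)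
  show "second_deriv f x v v \<ge> 0"
  proof (rule ccontr)
    assume neg: "\<not> second_deriv f x v v \<ge> 0"
    define l where "l t = x + t *\<^sub>R v" for t :: real
    have l: "(l has_derivative (\<lambda>s. s *\<^sub>R v)) (at t)" for t
      unfolding l_def by (auto intro!: derivative_eq_intros)
    have l0: "l 0 = x" by (simp add: l_def)
    have fl: "((\<lambda>t. f (l t)) has_real_derivative frechet_derivative f (at (l t)) v) (at t)"
      if "l t \<in> U" for t
      using has_derivative_compose[OF l twice_diff_onD(1)[OF f that]]
      by (simp add: has_field_derivative_def linear_scale[OF twice_diff_onD(3)[OF f that]] mult.commute[of _ "frechet_derivative _ _ _"])
    have D2l: "((\<lambda>y. frechet_derivative f (at y) v) has_derivative (\<lambda>u. second_deriv f x u v)) (at (l 0))"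
      unfolding l0 by (rule twice_diff_onD(2)[OF f x])
    have "((\<lambda>t. frechet_derivative f (at (l t)) v) has_real_derivative second_deriv f x v v) (at 0)"
      using has_derivative_compose[OF l D2l]
      by (simp add: has_field_derivative_def linear_scale[OF twice_diff_onD(4)[OF f x]] mult.commute[of _ "second_deriv _ _ _ _"])
    then obtain d where d: "d > 0"
      "\<And>h. h > 0 \<Longrightarrow> h < d \<Longrightarrow> frechet_derivative f (at (l h)) v < 0"
      using DERIV_neg_dec_right[of "\<lambda>t. frechet_derivative f (at (l t)) v" "second_deriv f x v v" 0] neg z
      unfolding l0 by auto
    have "isCont l 0" using l has_derivative_continuous by blast
    then have "(l \<longlongrightarrow> x) (nhds 0)" by (simp add: isCont_def l0 tendsto_nhds_iff)
    then have "\<forall>\<^sub>F t in nhds 0. l t \<in> U \<inter> W"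
      using f x W unfolding twice_diff_on_def by (intro topological_tendstoD) auto
    then obtain e where e: "e > 0" "\<And>t. dist t 0 < e \<Longrightarrow> l t \<in> U \<inter> W"
      unfolding eventually_nhds_metric by blast
    define h where "h = min d e / 2"
    have h: "h > 0" "h < d" "h < e" using d e by (auto simp: h_def)
    have "f (l h) < f (l 0)"
    proof (rule DERIV_neg_imp_decreasing_open[OF h(1)])
      fix t assume "0 < t" "t < h"
      then show "\<exists>y. ((\<lambda>t. f (l t)) has_real_derivative y) (at t) \<and> y < 0"
        using fl[of t] d(2)[of t] e(2)[of t] h by (intro exI conjI) auto
    next
      have "isCont (\<lambda>t. f (l t)) t" if "t \<in> {0..h}" for t
        using fl[of t] e(2)[of t] h that by (intro DERIV_isCont) auto
      then show "continuous_on {0..h} (\<lambda>t. f (l t))"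
        by (auto intro: continuous_at_imp_continuous_on)
    qed
    moreover have "l h \<in> W" using e(2)[of h] h by simp
    ultimately show False using W(3)[of "l h"] l0 by simp
  qed
qed

section \<open>Derivatives along the horizontal frame\<close>

definition hderiv :: "'n + 'n \<Rightarrow> ('n::finite heis \<Rightarrow> real) \<Rightarrow> 'n heis \<Rightarrow> real" where
  "hderiv I f y = frechet_derivative f (at y) (frame y I)"

lemma hderiv_cong_ev: "\<forall>\<^sub>F y in nhds x. f y = g y \<Longrightarrow> hderiv I f x = hderiv I g x"
  unfolding hderiv_def by (simp add: frechet_derivative_cong_ev)

lemma hderiv_eq: "(f has_derivative f') (at x) \<Longrightarrow> hderiv I f x = f' (frame x I)"
  by (simp add: hderiv_def frechet_derivative_at[symmetric])

lemma hderiv_has_derivative: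
  assumes f: "twice_diff_on U f" and x: "x \<in> U"
  shows "(hderiv J f has_derivative
      (\<lambda>u. second_deriv f x u (frame x J) + slope J u * frechet_derivative f (at x) (0, 1))) (at x)"
proof (rule has_derivative_transform_eventually)
  have s: "(slope J has_derivative slope J) (at x)"
    by (rule bounded_linear_imp_has_derivative[OF bounded_linear_slope])
  show "((\<lambda>y. frechet_derivative f (at y) (axis J 1, 0) + slope J y * frechet_derivative f (at y) (0, 1))
    has_derivative (\<lambda>u. second_deriv f x u (frame x J) + slope J u * frechet_derivative f (at x) (0, 1))) (at x)"
    unfolding frame_eq_add linear_add[OF second_deriv_linear_right[OF f x]] linear_scale[OF second_deriv_linear_right[OF f x]]
    by (rule has_derivative_eq_rhs[OF has_derivative_add[OF twice_diff_onD(2)[OF f x] has_derivative_mult[OF s twice_diff_onD(2)[OF f x]]]])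
      (auto simp: algebra_simps)
  have *: "frechet_derivative f (at y) (axis J 1, 0) + slope J y * frechet_derivative f (at y) (0, 1) = hderiv J f y"
    if "y \<in> U" for y
    unfolding hderiv_def frame_eq_add linear_add[OF twice_diff_onD(3)[OF f that]] linear_scale[OF twice_diff_onD(3)[OF f that]]
    by simp
  show "\<forall>\<^sub>F y in at x. frechet_derivative f (at y) (axis J 1, 0) +
      slope J y * frechet_derivative f (at y) (0, 1) = hderiv J f y"
    using twice_diff_on_eventually[OF f x] by (auto simp: eventually_at_filter * elim: eventually_mono)
  show "frechet_derivative f (at x) (axis J 1, 0) +
      slope J x * frechet_derivative f (at x) (0, 1) = hderiv J f x"
    using * x by blast
qed auto

text \<open>The first order term, antisymmetric in \<open>I\<close> and \<open>J\<close>, records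
  that the frame fields do not commute.\<close>

lemma hderiv_hderiv_eq:
  assumes "twice_diff_on U f" "x \<in> U"
  shows "hderiv I (hderiv J f) x = second_deriv f x (frame x I) (frame x J)
      + slope J (frame x I) * frechet_derivative f (at x) (0, 1)"
  using hderiv_eq[OF hderiv_has_derivative[OF assms]] .

lemma hderiv_linear:
  assumes f: "twice_diff_on U f" and g: "twice_diff_on U g" and x: "x \<in> U"
  shows "hderiv I (\<lambda>x. f x + c * g x) x = hderiv I f x + c * hderiv I g x"
    and "hderiv I (hderiv J (\<lambda>x. f x + c * g x)) x = hderiv I (hderiv J f) x + c * hderiv I (hderiv J g) x"
proof -
  note l = twice_diff_on_linear[OF f g]
  show "hderiv I (\<lambda>x. f x + c * g x) x = hderiv I f x + c * hderiv I g x"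
    unfolding hderiv_def l(2)[OF x] ..
  show "hderiv I (hderiv J (\<lambda>x. f x + c * g x)) x = hderiv I (hderiv J f) x + c * hderiv I (hderiv J g) x"
    unfolding hderiv_hderiv_eq[OF f x] hderiv_hderiv_eq[OF g x] hderiv_hderiv_eq[OF l(1) x] l(2)[OF x] l(3)[OF x]
    by (simp add: algebra_simps)
qed

text \<open>At a minimum the whole differential vanishes, and with it the commutator term; what
  remains is the Hessian on horizontal vectors.\<close>

lemma local_min_hderiv:
  assumes f: "twice_diff_on U f" and x: "x \<in> U" and min: "\<forall>\<^sub>F y in nhds x. f x \<le> f y"
  shows "hderiv I f x = 0" and "(\<Sum>I\<in>UNIV. \<Sum>J\<in>UNIV. v I * v J * hderiv I (hderiv J f) x) \<ge> 0"
proof -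
  note m = local_min_second_deriv_nonneg[OF assms]
  show "hderiv I f x = 0" by (simp add: hderiv_def m)
  let ?V = "\<Sum>I\<in>UNIV. v I *\<^sub>R frame x I"
  have "second_deriv f x ?V ?V = (\<Sum>I\<in>UNIV. v I * second_deriv f x (frame x I) ?V)"
    by (simp add: linear_sum[OF twice_diff_onD(4)[OF f x]] linear_scale[OF twice_diff_onD(4)[OF f x]])
  also have "\<dots> = (\<Sum>I\<in>UNIV. \<Sum>J\<in>UNIV. v I * v J * hderiv I (hderiv J f) x)"
    by (simp add: linear_sum[OF second_deriv_linear_right[OF f x]] linear_scale[OF second_deriv_linear_right[OF f x]]
        hderiv_hderiv_eq[OF f x] m(1) sum_distrib_left mult.assoc)
  finally show "(\<Sum>I\<in>UNIV. \<Sum>J\<in>UNIV. v I * v J * hderiv I (hderiv J f) x) \<ge> 0" using m(2)[of ?V] by simp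
qed

text \<open>
  The principal symbol of \<open>div (|\<xi>|^(p-1) \<xi>)\<close>, \<open>\<xi> = \<nabla>\<phi>\<close>, applied to the matrix \<open>M\<close> of second
  horizontal derivatives.
\<close>

definition curv :: "real \<Rightarrow> ('i::finite \<Rightarrow> real) \<Rightarrow> ('i \<Rightarrow> 'i \<Rightarrow> real) \<Rightarrow> real" where
  "curv p \<xi> M = (\<Sum>I\<in>UNIV. (\<xi> I)\<^sup>2) powr ((p - 1) / 2) * (\<Sum>I\<in>UNIV. M I I)
     + (p - 1) * (\<Sum>I\<in>UNIV. (\<xi> I)\<^sup>2) powr ((p - 3) / 2) * (\<Sum>I\<in>UNIV. \<Sum>J\<in>UNIV. \<xi> I * \<xi> J * M I J)"

text \<open>The frame fields are divergence free, because \<open>slope I\<close> does not depend on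
  z. So the divergence is the sum of the derivatives of the components \<open>G I\<close> along the
  frame, and the two terms of \<open>curv\<close> are those of the product rule for S^((p-1)/2)
  times the gradient.\<close>

lemma mean_curv_eq:
  fixes \<phi> :: "'n::{finite,linorder} heis \<Rightarrow> real"
  assumes \<phi>: "twice_diff_on U \<phi>" and x: "x \<in> U" and nz: "co_norm x (diff1 \<phi> x) \<noteq> 0"
  shows "mean_curv \<phi> p x = curv p (\<lambda>I. hderiv I \<phi> x) (\<lambda>I J. hderiv I (hderiv J \<phi>) x)"
proof -
  define S where "S y = (\<Sum>I\<in>UNIV. (hderiv I \<phi> y)\<^sup>2)" for y
  have cn: "co_norm y (diff1 \<phi> y) = sqrt (S y)" for y
    by (simp add: co_norm_def co_inner_def S_def hderiv_def power2_eq_square)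
  have S0: "S y \<ge> 0" for y by (simp add: S_def sum_nonneg)
  then have Sx: "S x > 0" using nz cn[of x] by (metis less_eq_real_def real_sqrt_zero)
  define G where "G I y = S y powr ((p - 1) / 2) * hderiv I \<phi> y" for I y
  have G: "diff1 \<phi> y (frame y I) / co_norm y (diff1 \<phi> y) powr (1 - p) = G I y" for y I
  proof -
    have "sqrt (S y) powr (1 - p) = S y powr ((1 - p) / 2)"
      using S0[of y] by (simp add: powr_half_sqrt[symmetric] powr_powr)
    moreover have "(p - 1) / 2 = - ((1 - p) / 2)" by (simp add: field_simps)
    then have "S y powr ((p - 1) / 2) = inverse (S y powr ((1 - p) / 2))"
      by (simp only: powr_minus)
    ultimately show ?thesis unfolding cn G_def hderiv_def by (simp only: divide_inverse mult.commute)
  qed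
  define E' where "E' J u = second_deriv \<phi> x u (frame x J) + slope J u * diff1 \<phi> x (0, 1)" for J u
  have E': "(hderiv J \<phi> has_derivative E' J) (at x)" for J
    unfolding E'_def by (rule hderiv_has_derivative[OF \<phi> x])
  have EE: "E' J (frame x I) = hderiv I (hderiv J \<phi>) x" for I J
    using hderiv_hderiv_eq[OF \<phi> x] by (simp add: E'_def)
  define S' where "S' u = (\<Sum>J\<in>UNIV. 2 * hderiv J \<phi> x * E' J u)" for u
  have S': "(S has_derivative S') (at x)"
    unfolding S_def S'_def by (auto intro!: derivative_eq_intros E' simp: algebra_simps)
  define G' where "G' I u = (p - 1) / 2 * S x powr ((p - 3) / 2) * S' u * hderiv I \<phi> x
      + S x powr ((p - 1) / 2) * E' I u" for I u
  have "((\<lambda>s. s powr ((p - 1) / 2)) has_real_derivative (p - 1) / 2 * S x powr ((p - 1) / 2 - 1)) (at (S x))"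
    using Sx by (rule has_real_derivative_powr)
  moreover have "(p - 1) / 2 - 1 = (p - 3) / 2" by (simp add: field_simps)
  ultimately have "((\<lambda>s. s powr ((p - 1) / 2)) has_derivative
      (\<lambda>s. (p - 1) / 2 * S x powr ((p - 3) / 2) * s)) (at (S x))"
    by (simp only: has_field_derivative_def)
  from has_derivative_mult[OF has_derivative_compose[OF S' this] E']
  have G': "(G I has_derivative G' I) (at x)" for I
    unfolding G_def G'_def by (rule has_derivative_eq_rhs) (auto simp: algebra_simps)
  then have linG': "linear (G' I)" for I by (rule has_derivative_linear)
  define V' where "V' u = (\<Sum>I\<in>UNIV. G I x *\<^sub>R (0, slope I u) + G' I u *\<^sub>R frame x I)" for u
  have "((\<lambda>y. \<Sum>I\<in>UNIV. (diff1 \<phi> y (frame y I) / co_norm y (diff1 \<phi> y) powr (1 - p)) *\<^sub>R frame y I)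
      has_derivative V') (at x)"
    unfolding V'_def G by (intro has_derivative_sum has_derivative_scaleR G' frame_has_derivative)
  then have "mean_curv \<phi> p x = (\<Sum>b\<in>Basis. V' b \<bullet> b)"
    by (rule mean_curv_eq_divergence)
  also have "\<dots> = (\<Sum>I\<in>UNIV. \<Sum>b\<in>Basis. G I x * (slope I b * ((0, 1) \<bullet> b)) + G' I b * (frame x I \<bullet> b))"
    unfolding V'_def
    by (subst sum.swap) (auto simp: inner_sum_left inner_add_left inner_Pair intro!: sum.cong)
  also have "\<dots> = (\<Sum>I\<in>UNIV. G I x * slope I (\<Sum>b\<in>Basis. ((0, 1) \<bullet> b) *\<^sub>R b)
      + G' I (\<Sum>b\<in>Basis. (frame x I \<bullet> b) *\<^sub>R b))"
    unfolding linear_sum[OF linG'] linear_scale[OF linG']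
      linear_sum[OF bounded_linear.linear[OF bounded_linear_slope]]
      linear_scale[OF bounded_linear.linear[OF bounded_linear_slope]]
    by (simp add: sum.distrib sum_distrib_left mult.commute mult.left_commute)
  also have "\<dots> = (\<Sum>I\<in>UNIV. G' I (frame x I))"
    by (simp add: euclidean_representation slope_simps)
  also have "\<dots> = curv p (\<lambda>I. hderiv I \<phi> x) (\<lambda>I J. hderiv I (hderiv J \<phi>) x)"
  proof -
    define T where "T I = (\<Sum>J\<in>UNIV. hderiv J \<phi> x * hderiv I (hderiv J \<phi>) x)" for I
    have "S' (frame x I) = 2 * T I" for I
      unfolding S'_def T_def EE sum_distrib_left by (simp add: mult.assoc)
    then have "G' I (frame x I) = S x powr ((p - 1) / 2) * hderiv I (hderiv I \<phi>) x
        + (p - 1) * S x powr ((p - 3) / 2) * (hderiv I \<phi> x * T I)" for I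
      by (simp add: G'_def EE)
    moreover have "hderiv I \<phi> x * T I = (\<Sum>J\<in>UNIV. hderiv I \<phi> x * hderiv J \<phi> x * hderiv I (hderiv J \<phi>) x)" for I
      by (simp add: T_def sum_distrib_left mult.assoc)
    ultimately show ?thesis
      unfolding curv_def S_def[symmetric] by (simp only: sum.distrib sum_distrib_left)
  qed
  finally show ?thesis .
qed

section \<open>Comparison at a contact point\<close>

lemma lagrange_identity:
  fixes \<xi> \<zeta> :: "'i::finite \<Rightarrow> real"
  shows "(\<Sum>I\<in>UNIV. \<Sum>J\<in>UNIV. (\<xi> I * \<zeta> J - \<xi> J * \<zeta> I)\<^sup>2)
    = 2 * ((\<Sum>I\<in>UNIV. (\<xi> I)\<^sup>2) * (\<Sum>I\<in>UNIV. (\<zeta> I)\<^sup>2) - (\<Sum>I\<in>UNIV. \<xi> I * \<zeta> I)\<^sup>2)"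
proof -
  have "(\<xi> I * \<zeta> J - \<xi> J * \<zeta> I)\<^sup>2
      = (\<xi> I)\<^sup>2 * (\<zeta> J)\<^sup>2 + (\<zeta> I)\<^sup>2 * (\<xi> J)\<^sup>2 - 2 * ((\<xi> I * \<zeta> I) * (\<xi> J * \<zeta> J))" for I J
    by (simp add: power2_eq_square algebra_simps)
  then have "(\<Sum>I\<in>UNIV. \<Sum>J\<in>UNIV. (\<xi> I * \<zeta> J - \<xi> J * \<zeta> I)\<^sup>2)
      = (\<Sum>I\<in>UNIV. \<Sum>J\<in>UNIV. (\<xi> I)\<^sup>2 * (\<zeta> J)\<^sup>2) + (\<Sum>I\<in>UNIV. \<Sum>J\<in>UNIV. (\<zeta> I)\<^sup>2 * (\<xi> J)\<^sup>2)
        - 2 * (\<Sum>I\<in>UNIV. \<Sum>J\<in>UNIV. (\<xi> I * \<zeta> I) * (\<xi> J * \<zeta> J))"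
    by (simp only: sum.distrib sum_subtractf sum_distrib_left)
  then show ?thesis
    unfolding sum_product[symmetric] by (simp add: power2_eq_square algebra_simps)
qed

text \<open>For p = 0 this is exactly the Cauchy-Schwarz gap, which is 0 for parallel vectors: the
  degenerate direction of the operator.\<close>

lemma cauchy_schwarz_strict:
  fixes \<xi> \<zeta> :: "'i::finite \<Rightarrow> real"
  assumes "\<xi> I * \<zeta> J \<noteq> \<xi> J * \<zeta> I" and p: "p \<ge> 0"
  shows "(\<Sum>I\<in>UNIV. (\<xi> I)\<^sup>2) * (\<Sum>I\<in>UNIV. (\<zeta> I)\<^sup>2) + (p - 1) * (\<Sum>I\<in>UNIV. \<xi> I * \<zeta> I)\<^sup>2 > 0"
proof -
  have "0 < (\<xi> I * \<zeta> J - \<xi> J * \<zeta> I)\<^sup>2" using assms(1) by simp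
  also have "\<dots> \<le> (\<Sum>J\<in>UNIV. (\<xi> I * \<zeta> J - \<xi> J * \<zeta> I)\<^sup>2)"
    by (rule member_le_sum[of J]) auto
  also have "\<dots> \<le> (\<Sum>I\<in>UNIV. \<Sum>J\<in>UNIV. (\<xi> I * \<zeta> J - \<xi> J * \<zeta> I)\<^sup>2)"
    by (rule member_le_sum[of I]) (auto intro: sum_nonneg)
  finally have "0 < (\<Sum>I\<in>UNIV. (\<xi> I)\<^sup>2) * (\<Sum>I\<in>UNIV. (\<zeta> I)\<^sup>2) - (\<Sum>I\<in>UNIV. \<xi> I * \<zeta> I)\<^sup>2"
    unfolding lagrange_identity by simp
  moreover have "0 \<le> p * (\<Sum>I\<in>UNIV. \<xi> I * \<zeta> I)\<^sup>2" using p by simp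
  ultimately show ?thesis by (simp add: algebra_simps)
qed

text \<open>Matrix version of the Lagrange identity: twice the gap is the sum over \<open>I\<close>,
  \<open>J\<close> of the values of the quadratic form on the vectors \<xi>_I e_J - \<xi>_J e_I.
  Symmetry of \<open>M\<close> is not assumed, since horizontal second derivatives need not be
  symmetric.\<close>

lemma trace_bound:
  fixes \<xi> :: "'i::finite \<Rightarrow> real"
  assumes psd: "\<And>v. (\<Sum>I\<in>UNIV. \<Sum>J\<in>UNIV. v I * v J * M I J) \<ge> 0"
  shows "(\<Sum>I\<in>UNIV. \<Sum>J\<in>UNIV. \<xi> I * \<xi> J * M I J) \<le> (\<Sum>I\<in>UNIV. (\<xi> I)\<^sup>2) * (\<Sum>I\<in>UNIV. M I I)"
proof -
  have delta: "(\<Sum>K\<in>UNIV. (a * of_bool (K = J) - b * of_bool (K = I)) * g K) = a * g J - b * g I"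
    for a b :: real and g and I J :: 'i
  proof -
    have "(a * of_bool (K = J) - b * of_bool (K = I)) * g K
        = (if K = J then a * g K else 0) - (if K = I then b * g K else 0)" for K
      by (auto simp: algebra_simps)
    then show ?thesis by (simp only: sum_subtractf) simp
  qed
  have "0 \<le> (\<xi> I)\<^sup>2 * M J J + (\<xi> J)\<^sup>2 * M I I - \<xi> I * \<xi> J * M J I - \<xi> J * \<xi> I * M I J" for I J
  proof -
    define v where "v K = \<xi> I * of_bool (K = J) - \<xi> J * of_bool (K = I)" for K
    have "(\<Sum>K\<in>UNIV. \<Sum>L\<in>UNIV. v K * v L * M K L) = (\<Sum>K\<in>UNIV. v K * (\<Sum>L\<in>UNIV. v L * M K L))"
      by (simp add: sum_distrib_left mult.assoc)
    also have "\<dots> = \<xi> I * (\<xi> I * M J J - \<xi> J * M J I) - \<xi> J * (\<xi> I * M I J - \<xi> J * M I I)"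
      unfolding v_def delta ..
    finally show ?thesis using psd[of v] by (simp add: power2_eq_square algebra_simps)
  qed
  then have "0 \<le> (\<Sum>I\<in>UNIV. \<Sum>J\<in>UNIV. (\<xi> I)\<^sup>2 * M J J + (\<xi> J)\<^sup>2 * M I I - \<xi> I * \<xi> J * M J I - \<xi> J * \<xi> I * M I J)"
    by (intro sum_nonneg)
  also have "\<dots> = (\<Sum>I\<in>UNIV. \<Sum>J\<in>UNIV. (\<xi> I)\<^sup>2 * M J J) + (\<Sum>I\<in>UNIV. \<Sum>J\<in>UNIV. (\<xi> J)\<^sup>2 * M I I)
      - (\<Sum>I\<in>UNIV. \<Sum>J\<in>UNIV. \<xi> I * \<xi> J * M J I) - (\<Sum>I\<in>UNIV. \<Sum>J\<in>UNIV. \<xi> J * \<xi> I * M I J)"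
    by (simp only: sum.distrib sum_subtractf)
  also have "(\<Sum>I\<in>UNIV. \<Sum>J\<in>UNIV. \<xi> I * \<xi> J * M J I) = (\<Sum>I\<in>UNIV. \<Sum>J\<in>UNIV. \<xi> J * \<xi> I * M I J)"
    by (rule sum.swap)
  also have "(\<Sum>I\<in>UNIV. \<Sum>J\<in>UNIV. (\<xi> J)\<^sup>2 * M I I) = (\<Sum>I\<in>UNIV. \<Sum>J\<in>UNIV. (\<xi> I)\<^sup>2 * M J J)"
    by (rule sum.swap)
  also have "(\<Sum>I\<in>UNIV. \<Sum>J\<in>UNIV. \<xi> J * \<xi> I * M I J) = (\<Sum>I\<in>UNIV. \<Sum>J\<in>UNIV. \<xi> I * \<xi> J * M I J)"
    by (simp add: mult_ac)
  finally show ?thesis unfolding sum_product by linarith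
qed

lemma powr_shift: "(s :: real) > 0 \<Longrightarrow> s powr ((p - 1) / 2) = s powr ((p - 3) / 2) * s"
  using powr_add[of s "(p - 3) / 2" 1] by (simp add: field_simps)

text \<open>Up to the factor S^((p-3)/2) the value is (S t - X) + p X, where the bracket is the gap
  of \<open>trace_bound\<close>.\<close>

lemma curv_nonneg:
  assumes psd: "\<And>v. (\<Sum>I\<in>UNIV. \<Sum>J\<in>UNIV. v I * v J * M I J) \<ge> 0"
    and p: "p \<ge> 0" and pos: "(\<Sum>I\<in>UNIV. (\<xi> I)\<^sup>2) > 0"
  shows "curv p \<xi> M \<ge> 0"
proof -
  define S where "S = (\<Sum>I\<in>UNIV. (\<xi> I)\<^sup>2)"
  define X where "X = (\<Sum>I\<in>UNIV. \<Sum>J\<in>UNIV. \<xi> I * \<xi> J * M I J)"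
  define t where "t = (\<Sum>I\<in>UNIV. M I I)"
  have "X \<le> S * t" "0 \<le> X" "0 \<le> p * X" using trace_bound[OF psd] psd p by (auto simp: S_def X_def t_def)
  then have "0 \<le> S powr ((p - 3) / 2) * (S * t + (p - 1) * X)"
    by (intro mult_nonneg_nonneg) (auto simp: algebra_simps)
  also have "\<dots> = curv p \<xi> M"
    unfolding curv_def S_def[symmetric] X_def[symmetric] t_def[symmetric]
    using pos by (simp add: powr_shift S_def algebra_simps)
  finally show ?thesis .
qed

lemma curv_diff: "curv p \<xi> (\<lambda>I J. M I J - N I J) = curv p \<xi> M - curv p \<xi> N"
  by (simp add: curv_def sum_subtractf algebra_simps)

text \<open>The derivative of \<open>curv p\<close> at (\<xi>, M) in the direction (\<zeta>, N),
  written out so that its continuity can be read off term by term.\<close>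

definition curv_deriv ::
  "real \<Rightarrow> ('i::finite \<Rightarrow> real) \<Rightarrow> ('i \<Rightarrow> real) \<Rightarrow> ('i \<Rightarrow> 'i \<Rightarrow> real) \<Rightarrow> ('i \<Rightarrow> 'i \<Rightarrow> real) \<Rightarrow> real" where
  "curv_deriv p \<xi> \<zeta> M N =
     (let S = \<Sum>I\<in>UNIV. (\<xi> I)\<^sup>2; X = \<Sum>I\<in>UNIV. \<xi> I * \<zeta> I in
      (p - 1) * S powr ((p - 3) / 2) * X * (\<Sum>I\<in>UNIV. M I I)
      + S powr ((p - 1) / 2) * (\<Sum>I\<in>UNIV. N I I)
      + (p - 1) * ((p - 3) * S powr ((p - 5) / 2) * X * (\<Sum>I\<in>UNIV. \<Sum>J\<in>UNIV. \<xi> I * \<xi> J * M I J)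
        + S powr ((p - 3) / 2) * (\<Sum>I\<in>UNIV. \<Sum>J\<in>UNIV.
            (\<zeta> I * \<xi> J + \<xi> I * \<zeta> J) * M I J + \<xi> I * \<xi> J * N I J)))"

lemma curv_has_derivative:
  fixes \<xi> \<zeta> :: "'i::finite \<Rightarrow> real"
  assumes pos: "(\<Sum>I\<in>UNIV. (\<xi> I + t * \<zeta> I)\<^sup>2) > 0"
  shows "((\<lambda>t. curv p (\<lambda>I. \<xi> I + t * \<zeta> I) (\<lambda>I J. M I J + t * N I J)) has_real_derivative
    curv_deriv p (\<lambda>I. \<xi> I + t * \<zeta> I) \<zeta> (\<lambda>I J. M I J + t * N I J) N) (at t)"
proof -
  define S where "S t = (\<Sum>I\<in>UNIV. (\<xi> I + t * \<zeta> I)\<^sup>2)" for t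
  define X where "X = (\<Sum>I\<in>UNIV. (\<xi> I + t * \<zeta> I) * \<zeta> I)"
  have S: "(S has_real_derivative 2 * X) (at t)"
    unfolding S_def X_def sum_distrib_left
    by (auto intro!: derivative_eq_intros sum.cong)
  have pw: "((\<lambda>t. S t powr a) has_real_derivative a * S t powr (a - 1) * (2 * X)) (at t)" for a
    using pos by (intro DERIV_chain2[OF has_real_derivative_powr S]) (simp add: S_def)
  have tr: "((\<lambda>t. \<Sum>I\<in>UNIV. M I I + t * N I I) has_real_derivative (\<Sum>I\<in>UNIV. N I I)) (at t)"
    by (auto intro!: derivative_eq_intros sum.cong)
  have quad: "((\<lambda>t. \<Sum>I\<in>UNIV. \<Sum>J\<in>UNIV. (\<xi> I + t * \<zeta> I) * (\<xi> J + t * \<zeta> J) * (M I J + t * N I J))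
      has_real_derivative (\<Sum>I\<in>UNIV. \<Sum>J\<in>UNIV. (\<zeta> I * (\<xi> J + t * \<zeta> J) + (\<xi> I + t * \<zeta> I) * \<zeta> J) * (M I J + t * N I J)
        + (\<xi> I + t * \<zeta> I) * (\<xi> J + t * \<zeta> J) * N I J)) (at t)"
    by (auto intro!: derivative_eq_intros sum.cong simp: algebra_simps)
  have e: "(p - 1) / 2 - 1 = (p - 3) / 2" "(p - 3) / 2 - 1 = (p - 5) / 2" by (simp_all add: field_simps)
  have f: "c / 2 * u * (2 * X) = c * u * X" for c u by simp
  show ?thesis
    unfolding curv_def curv_deriv_def Let_def S_def[symmetric] X_def[symmetric]
    by (rule DERIV_cong[OF DERIV_add[OF DERIV_mult[OF pw tr]
            DERIV_mult[OF DERIV_cmult[OF pw, where c = "p - 1"] quad]]])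
      (simp only: e f, simp only: distrib_left mult.assoc mult.commute mult.left_commute
        add.assoc add.commute add.left_commute)
qed

text \<open>\<open>curv_deriv\<close> is affine in \<open>N\<close>, so the increment is the symbol
  on a rank one matrix. Its coefficient is positive by \<open>cauchy_schwarz_strict\<close> if
  \<zeta> is not parallel to \<xi>; a large \<open>k\<close> then outweighs all other terms.\<close>

lemma curv_deriv_add_square:
  fixes \<xi> \<zeta> :: "'i::finite \<Rightarrow> real"
  assumes pos: "(\<Sum>I\<in>UNIV. (\<xi> I)\<^sup>2) > 0"
  shows "curv_deriv p \<xi> \<zeta> M (\<lambda>I J. N I J + k * (\<zeta> I * \<zeta> J)) = curv_deriv p \<xi> \<zeta> M N
    + k * ((\<Sum>I\<in>UNIV. (\<xi> I)\<^sup>2) powr ((p - 3) / 2) *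
      ((\<Sum>I\<in>UNIV. (\<xi> I)\<^sup>2) * (\<Sum>I\<in>UNIV. (\<zeta> I)\<^sup>2) + (p - 1) * (\<Sum>I\<in>UNIV. \<xi> I * \<zeta> I)\<^sup>2))"
proof -
  have "(\<Sum>I\<in>UNIV. \<Sum>J\<in>UNIV. (\<zeta> I * \<xi> J + \<xi> I * \<zeta> J) * M I J + \<xi> I * \<xi> J * (N I J + k * (\<zeta> I * \<zeta> J)))
      = (\<Sum>I\<in>UNIV. \<Sum>J\<in>UNIV. (\<zeta> I * \<xi> J + \<xi> I * \<zeta> J) * M I J + \<xi> I * \<xi> J * N I J)
        + (\<Sum>I\<in>UNIV. \<Sum>J\<in>UNIV. k * ((\<xi> I * \<zeta> I) * (\<xi> J * \<zeta> J)))"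
    unfolding sum.distrib[symmetric] by (simp add: algebra_simps)
  also have "(\<Sum>I\<in>UNIV. \<Sum>J\<in>UNIV. k * ((\<xi> I * \<zeta> I) * (\<xi> J * \<zeta> J))) = k * (\<Sum>I\<in>UNIV. \<xi> I * \<zeta> I)\<^sup>2"
    unfolding power2_eq_square sum_product unfolding sum_distrib_left ..
  finally have 1: "(\<Sum>I\<in>UNIV. \<Sum>J\<in>UNIV. (\<zeta> I * \<xi> J + \<xi> I * \<zeta> J) * M I J + \<xi> I * \<xi> J * (N I J + k * (\<zeta> I * \<zeta> J)))
      = (\<Sum>I\<in>UNIV. \<Sum>J\<in>UNIV. (\<zeta> I * \<xi> J + \<xi> I * \<zeta> J) * M I J + \<xi> I * \<xi> J * N I J)
        + k * (\<Sum>I\<in>UNIV. \<xi> I * \<zeta> I)\<^sup>2" .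
  have 2: "(\<Sum>I\<in>UNIV. N I I + k * (\<zeta> I * \<zeta> I)) = (\<Sum>I\<in>UNIV. N I I) + k * (\<Sum>I\<in>UNIV. (\<zeta> I)\<^sup>2)"
    by (simp add: sum.distrib power2_eq_square sum_distrib_left)
  show ?thesis
    unfolding curv_deriv_def Let_def 1 2 powr_shift[OF pos] by (simp only: distrib_left distrib_right mult.assoc mult.commute mult.left_commute add.assoc add.commute add.left_commute)
qed

lemma isCont_hderiv:
  assumes "twice_diff_on W f" "x \<in> W"
  shows "isCont (hderiv I f) x"
  by (rule has_derivative_continuous[OF hderiv_has_derivative[OF assms]])

lemma twice_diff_on_continuous_on: "twice_diff_on W f \<Longrightarrow> A \<subseteq> W \<Longrightarrow> continuous_on A f"
  by (meson twice_diff_onD(1) continuous_at_imp_continuous_on has_derivative_continuous subsetD)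

text \<open>
  The test function \<open>h = g + k g^2 / 2\<close> vanishes at \<open>q\<close> and is negative at the other nearby contact
  points. If \<open>\<nu>\<close> had a horizontal component not parallel to the gradient, then for large \<open>k\<close> the
  curvature of \<open>\<phi> + t h\<close> would exceed that of \<open>\<phi>\<close> for small \<open>t > 0\<close>, hence that of \<open>\<psi>\<close>, also at an
  interior minimum of \<open>\<psi> - \<phi> - t h\<close>, where second order comparison gives the opposite inequality.
\<close>

lemma normal_parallel_gradient:
  fixes \<phi> \<psi> :: "'n::finite heis \<Rightarrow> real"
  assumes tw: "twice_diff_on W \<phi>" "twice_diff_on W \<psi>"
    and cont: "\<And>I J. continuous_on W (hderiv I (hderiv J \<phi>))"
    and H: "\<And>x. x \<in> W \<Longrightarrow> curv p (\<lambda>I. hderiv I \<psi> x) (\<lambda>I J. hderiv I (hderiv J \<psi>) x)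
        \<le> curv p (\<lambda>I. hderiv I \<phi> x) (\<lambda>I J. hderiv I (hderiv J \<phi>) x)"
    and le: "\<And>x. x \<in> W \<Longrightarrow> \<phi> x \<le> \<psi> x"
    and nz: "\<And>x. x \<in> W \<Longrightarrow> (\<Sum>I\<in>UNIV. (hderiv I \<phi> x)\<^sup>2) > 0"
    and p: "p \<ge> 0" and q: "q \<in> W" "\<phi> q = \<psi> q"
    and c: "\<And>z. z \<in> W \<Longrightarrow> \<phi> z = \<psi> z \<Longrightarrow> dist c q \<le> dist c z"
  shows "hderiv I \<phi> q * ((c - q) \<bullet> frame q J) = hderiv J \<phi> q * ((c - q) \<bullet> frame q I)"
proof (rule ccontr)
  have W: "open W" using tw by (simp add: twice_diff_on_def)
  define \<nu> where "\<nu> = c - q"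
  assume "\<not> ?thesis"
  then have npar: "hderiv I \<phi> q * (\<nu> \<bullet> frame q J) \<noteq> hderiv J \<phi> q * (\<nu> \<bullet> frame q I)" by (simp add: \<nu>_def)
  \<comment> \<open>For nonzero \<nu>, \<open>g\<close> is positive exactly in the open ball with
    diameter from \<open>q\<close> to \<open>c\<close>. Halving the ball around \<open>c\<close>
    that avoids the contact set leaves \<open>q\<close> as the only contact point in its closure.
    \<open>gd\<close> and \<open>N\<close> are the first and the second horizontal derivatives of
    \<open>g\<close>.\<close>
  define g where "g x = \<nu> \<bullet> (x - q) - (x - q) \<bullet> (x - q)" for x
  define gd where "gd x v = \<nu> \<bullet> v - 2 * ((x - q) \<bullet> v)" for x v
  define N where "N x I J = \<nu> \<bullet> (0, slope J (frame x I))
      - 2 * (frame x I \<bullet> frame x J + (x - q) \<bullet> (0, slope J (frame x I)))" for x and I J :: "'n + 'n"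
  define S where "S = (\<Sum>I\<in>UNIV. (hderiv I \<phi> q)\<^sup>2)"
  define \<kappa> where "\<kappa> = S powr ((p - 3) / 2) *
      (S * (\<Sum>I\<in>UNIV. (\<nu> \<bullet> frame q I)\<^sup>2) + (p - 1) * (\<Sum>I\<in>UNIV. hderiv I \<phi> q * (\<nu> \<bullet> frame q I))\<^sup>2)"
  have S: "S > 0" using nz[OF q(1)] by (simp add: S_def)
  have \<kappa>: "\<kappa> > 0"
    unfolding \<kappa>_def using cauchy_schwarz_strict[of "\<lambda>I. hderiv I \<phi> q" I "\<lambda>I. \<nu> \<bullet> frame q I" J, OF npar p] S
    by (simp add: S_def)
  \<comment> \<open>\<open>a\<close> collects what does not depend on \<open>k\<close> in the
    derivative of the curvature at \<open>q\<close>, and \<kappa> is the coefficient of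
    \<open>k\<close>; the choice of \<open>k\<close> gives a + k \<kappa> \<ge> 1.\<close>
  define a where "a = curv_deriv p (\<lambda>I. hderiv I \<phi> q) (\<lambda>I. \<nu> \<bullet> frame q I) (\<lambda>I J. hderiv I (hderiv J \<phi>) q) (N q)"
  define k where "k = (\<bar>a\<bar> + 1) / \<kappa>"
  have k: "k > 0" "a + k * \<kappa> > 0" using \<kappa> by (auto simp: k_def)
  define h where "h x = g x * (1 + k * g x / 2)" for x
  have g': "(g has_derivative gd x) (at x)" for x
    unfolding g_def gd_def
    by (auto intro!: derivative_eq_intros simp: inner_commute algebra_simps)
  have gd': "((\<lambda>y. gd y v) has_derivative (\<lambda>u. - 2 * (u \<bullet> v))) (at x)" for x v
    unfolding gd_def by (auto intro!: derivative_eq_intros simp: inner_commute)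
  have h': "(h has_derivative (\<lambda>v. (1 + k * g x) * gd x v)) (at x)" for x
    unfolding h_def by (auto intro!: derivative_eq_intros g' simp: field_simps)
  have fh: "frechet_derivative h (at x) = (\<lambda>v. (1 + k * g x) * gd x v)" for x
    using h' by (rule frechet_derivative_at[symmetric])
  have fh': "((\<lambda>y. (1 + k * g y) * gd y v) has_derivative
      (\<lambda>u. k * gd x u * gd x v + (1 + k * g x) * (- 2 * (u \<bullet> v)))) (at x)" for x v
    by (auto intro!: derivative_eq_intros g' gd' simp: algebra_simps)
  have twh: "twice_diff_on W h"
    using W differentiableI[OF h'] differentiableI[OF fh'] by (simp add: twice_diff_on_def fh)
  have Eh: "hderiv I h x = (1 + k * g x) * gd x (frame x I)" for I x
    by (simp add: hderiv_def fh)
  have gdf: "((\<lambda>y. gd y (frame y J)) has_derivative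
      (\<lambda>u. \<nu> \<bullet> (0, slope J u) - 2 * (u \<bullet> frame x J + (x - q) \<bullet> (0, slope J u)))) (at x)" for x J
    unfolding gd_def
    by (auto intro!: derivative_eq_intros frame_has_derivative simp del: inner_Pair)
  have EEh: "hderiv I (hderiv J h) x = (1 + k * g x) * N x I J + k * (gd x (frame x I) * gd x (frame x J))" for I J x
  proof -
    have "((\<lambda>y. (1 + k * g y) * gd y (frame y J)) has_derivative
      (\<lambda>u. k * gd x u * gd x (frame x J) + (1 + k * g x) *
        (\<nu> \<bullet> (0, slope J u) - 2 * (u \<bullet> frame x J + (x - q) \<bullet> (0, slope J u))))) (at x)"
      by (auto intro!: derivative_eq_intros g' gdf simp: algebra_simps simp del: inner_Pair)
    moreover have "hderiv J h = (\<lambda>y. (1 + k * g y) * gd y (frame y J))" by (rule ext) (rule Eh)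
    ultimately have "(hderiv J h has_derivative
      (\<lambda>u. k * gd x u * gd x (frame x J) + (1 + k * g x) *
        (\<nu> \<bullet> (0, slope J u) - 2 * (u \<bullet> frame x J + (x - q) \<bullet> (0, slope J u))))) (at x)" by simp
    from hderiv_eq[OF this] show ?thesis by (simp add: N_def algebra_simps del: inner_Pair)
  qed
  have gq: "g q = 0" "h q = 0" and gdq: "gd q v = \<nu> \<bullet> v" for v by (simp_all add: g_def h_def gd_def)
  \<comment> \<open>The point and the parameter \<open>t\<close> form one variable, so that
    continuity at (q, 0) gives a ball and a range of \<open>t\<close> that work together.\<close>
  define \<xi> where "\<xi> z I = hderiv I \<phi> (fst z) + snd z * hderiv I h (fst z)" for z I
  define M where "M z I J = hderiv I (hderiv J \<phi>) (fst z) + snd z * hderiv I (hderiv J h) (fst z)" for z I J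
  define K where "K z = curv_deriv p (\<xi> z) (\<lambda>I. hderiv I h (fst z)) (M z) (\<lambda>I J. hderiv I (hderiv J h) (fst z))" for z
  define S\<xi> where "S\<xi> z = (\<Sum>I\<in>UNIV. (\<xi> z I)\<^sup>2)" for z
  have \<xi>M: "\<xi> (x, t) = (\<lambda>I. hderiv I \<phi> x + t * hderiv I h x)"
    "M (x, t) = (\<lambda>I J. hderiv I (hderiv J \<phi>) x + t * hderiv I (hderiv J h) x)" for x t
    by (intro ext; simp add: \<xi>_def M_def)+
  have \<xi>0: "\<xi> (x, 0) = (\<lambda>I. hderiv I \<phi> x)" "M (x, 0) = (\<lambda>I J. hderiv I (hderiv J \<phi>) x)" for x
    by (intro ext; simp add: \<xi>_def M_def)+
  have "K (q, 0) = a + k * \<kappa>"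
    using curv_deriv_add_square[of "\<lambda>I. hderiv I \<phi> q" p "\<lambda>I. \<nu> \<bullet> frame q I" "\<lambda>I J. hderiv I (hderiv J \<phi>) q" "N q" k] S
    by (simp add: K_def \<xi>0 Eh EEh gq gdq S_def \<kappa>_def a_def)
  then have K0: "K (q, 0) > 0" using k by simp
  have S\<xi>0: "S\<xi> (q, 0) > 0" using S by (simp add: S\<xi>_def \<xi>0 S_def)
  have cfst: "isCont (\<lambda>z. f (fst z)) (q, 0 :: real)" if "isCont f q" for f :: "'n heis \<Rightarrow> real"
    by (rule isCont_o2[where f = fst and g = f]) (auto intro: that continuous_intros)
  have cE: "isCont (\<lambda>z. hderiv I f (fst z)) (q, 0 :: real)" if "twice_diff_on W f" for I f
    using cfst[OF isCont_hderiv[OF that q(1)]] .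
  have cEE\<phi>: "isCont (\<lambda>z. hderiv I (hderiv J \<phi>) (fst z)) (q, 0 :: real)" for I J
    by (rule cfst) (use cont W q(1) in \<open>simp add: continuous_on_eq_continuous_at\<close>)
  have cframe: "isCont (\<lambda>y. frame y I) x" for I and x :: "'n heis"
    by (rule has_derivative_continuous[OF frame_has_derivative])
  have cslope: "isCont (\<lambda>y. slope J (frame y I)) x" for I J and x :: "'n heis"
    by (rule isCont_o2[where f = "\<lambda>y. frame y I" and g = "slope J", OF cframe
          bounded_linear.isCont[OF bounded_linear_slope continuous_ident]])
  have cg: "isCont g x" and ch: "isCont h x" for x
    using g' h' has_derivative_continuous by blast+
  have cEEh: "isCont (\<lambda>z. hderiv I (hderiv J h) (fst z)) (q, 0 :: real)" for I J
    unfolding EEh N_def gd_def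
    by (rule cfst) (intro continuous_intros cframe cslope cg)
  have c\<xi>: "isCont (\<lambda>z. \<xi> z I) (q, 0)" for I
    unfolding \<xi>_def by (intro continuous_intros cE[OF tw(1)] cE[OF twh])
  have cM: "isCont (\<lambda>z. M z I J) (q, 0)" for I J
    unfolding M_def by (intro continuous_intros cEE\<phi> cEEh)
  have cS: "isCont S\<xi> (q, 0)"
    unfolding S\<xi>_def by (intro continuous_intros c\<xi>)
  have "isCont K (q, 0)"
    unfolding K_def curv_deriv_def Let_def S\<xi>_def[symmetric]
    by (intro continuous_intros cS c\<xi> cM cE[OF twh] cEEh) (use S\<xi>0 in \<open>simp_all\<close>)
  then have "\<forall>\<^sub>F z in nhds (q, 0). K z > 0"
    using order_tendstoD(1)[OF _ K0] by (simp add: isCont_def tendsto_at_iff_tendsto_nhds)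
  moreover have "\<forall>\<^sub>F z in nhds (q, 0). S\<xi> z > 0"
    using order_tendstoD(1)[OF _ S\<xi>0] cS by (simp add: isCont_def tendsto_at_iff_tendsto_nhds)
  ultimately have "\<forall>\<^sub>F z in nhds q \<times>\<^sub>F nhds 0. K z > 0 \<and> S\<xi> z > 0"
    unfolding nhds_prod by (rule eventually_conj)
  then obtain Pf Pg where Pf: "eventually Pf (nhds q)" and Pg: "eventually Pg (nhds 0)"
    and KS: "\<And>x t. Pf x \<Longrightarrow> Pg t \<Longrightarrow> K (x, t) > 0 \<and> S\<xi> (x, t) > 0"
    unfolding eventually_prod_filter by blast
  have "((\<lambda>x. 1 + k * g x / 2) \<longlongrightarrow> 1 + k * g q / 2) (nhds q)"
    using cg[of q] unfolding isCont_def tendsto_at_iff_tendsto_nhds by (intro tendsto_intros) auto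
  then have "\<forall>\<^sub>F x in nhds q. 1 + k * g x / 2 > 0"
    by (rule order_tendstoD(1)) (simp add: gq)
  with Pf have "\<forall>\<^sub>F x in nhds q. Pf x \<and> x \<in> W \<and> 1 + k * g x / 2 > 0"
    using eventually_nhds_in_open[OF W q(1)] by (intro eventually_conj)
  then obtain \<rho> where \<rho>: "\<rho> > 0" "\<And>x. dist x q < \<rho> \<Longrightarrow> Pf x \<and> x \<in> W \<and> 1 + k * g x / 2 > 0"
    unfolding eventually_nhds_metric by blast
  obtain \<delta>0 where \<delta>0: "\<delta>0 > 0" "\<And>t. dist t 0 < \<delta>0 \<Longrightarrow> Pg t"
    using Pg unfolding eventually_nhds_metric by blast
  define r where "r = \<rho> / 2"
  have r: "r > 0" and cb: "\<And>x. x \<in> cball q r \<Longrightarrow> Pf x \<and> x \<in> W \<and> 1 + k * g x / 2 > 0"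
    using \<rho> by (auto simp: r_def dist_commute)
  have increasing: "curv p (\<xi> (x, 0)) (M (x, 0)) < curv p (\<xi> (x, t)) (M (x, t))"
    if x: "x \<in> cball q r" and t: "0 < t" "t < \<delta>0" for x t
  proof (rule DERIV_pos_imp_increasing[OF t(1), of "\<lambda>t. curv p (\<xi> (x, t)) (M (x, t))"])
    fix s assume s: "0 \<le> s" "s \<le> t"
    then have "K (x, s) > 0 \<and> S\<xi> (x, s) > 0"
      using t cb[OF x] by (intro KS \<delta>0(2)) (auto simp: dist_real_def)
    then show "\<exists>y. ((\<lambda>t. curv p (\<xi> (x, t)) (M (x, t))) has_real_derivative y) (at s) \<and> 0 < y"
      using curv_has_derivative[where \<xi> = "\<lambda>I. hderiv I \<phi> x" and \<zeta> = "\<lambda>I. hderiv I h x" and t = s and p = p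
          and M = "\<lambda>I J. hderiv I (hderiv J \<phi>) x" and N = "\<lambda>I J. hderiv I (hderiv J h) x"]
      by (intro exI[of _ "K (x, s)"]) (simp add: K_def S\<xi>_def \<xi>M)
  qed
  \<comment> \<open>On this compact part of the sphere \<psi> - \<phi> has a positive lower bound,
    which beats t h for small \<open>t\<close>; on the rest h < 0. So \<psi> - \<phi> - t h is
    positive on the whole sphere but 0 at \<open>q\<close>, and its minimum is interior.\<close>
  define T where "T = sphere q r \<inter> {x. 0 \<le> h x}"
  have hcont: "continuous_on A h" and gcont: "continuous_on A g" for A
    using ch cg by (auto intro: continuous_at_imp_continuous_on)
  have "compact T"
    unfolding T_def by (intro compact_Int_closed compact_sphere closed_Collect_le continuous_on_const hcont)
  have T_pos: "\<psi> x - \<phi> x > 0" if x: "x \<in> T" for x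
  proof (rule ccontr)
    have xW: "x \<in> W" "1 + k * g x / 2 > 0" using x cb[of x] by (auto simp: T_def)
    assume "\<not> \<psi> x - \<phi> x > 0"
    then have "\<phi> x = \<psi> x" using le[OF xW(1)] by simp
    then have "dist c q \<le> dist c x" using c xW by blast
    then have "\<nu> \<bullet> \<nu> \<le> (\<nu> - (x - q)) \<bullet> (\<nu> - (x - q))"
      by (simp add: \<nu>_def dist_norm norm_le)
    then have "2 * (\<nu> \<bullet> (x - q)) \<le> (x - q) \<bullet> (x - q)"
      unfolding inner_diff_left[of \<nu>] inner_diff_right[of _ \<nu>] by (simp add: inner_commute)
    moreover have "(x - q) \<bullet> (x - q) > 0" using x r by (auto simp: T_def)
    ultimately have "g x < 0" unfolding g_def by linarith
    then have "h x < 0" using xW(2) by (simp add: h_def mult_neg_pos)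
    then show False using x by (simp add: T_def)
  qed
  have cont\<phi>\<psi>: "continuous_on A \<phi>" "continuous_on A \<psi>" if "A \<subseteq> W" for A
    using tw that by (auto intro: twice_diff_on_continuous_on)
  obtain m B where mB: "m > 0" "\<And>x. x \<in> T \<Longrightarrow> m \<le> \<psi> x - \<phi> x \<and> h x \<le> B"
  proof (cases "T = {}")
    case False
    have "T \<subseteq> W" using cb by (auto simp: T_def)
    then have "continuous_on T (\<lambda>x. \<psi> x - \<phi> x)" by (intro continuous_intros cont\<phi>\<psi>)
    then obtain x1 where "x1 \<in> T" "\<And>x. x \<in> T \<Longrightarrow> \<psi> x1 - \<phi> x1 \<le> \<psi> x - \<phi> x"
      using continuous_attains_inf[OF \<open>compact T\<close> False] by blast
    moreover obtain x2 where "x2 \<in> T" "\<And>x. x \<in> T \<Longrightarrow> h x \<le> h x2"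
      using continuous_attains_sup[OF \<open>compact T\<close> False hcont] by blast
    ultimately show thesis using T_pos by (intro that[of "\<psi> x1 - \<phi> x1" "h x2"]) auto
  qed (use that[of 1] in auto)
  have "\<forall>\<^sub>F t in at_right 0. 0 < t \<and> t * 1 < \<delta>0 \<and> t * B < m"
    using \<delta>0 mB by (intro eventually_conj eventually_mult_less_at_right_0) (auto simp: eventually_at_right_less)
  then obtain t where t: "0 < t" "t < \<delta>0" "t * B < m"
    using eventually_happens by force
  define F where "F = (\<lambda>x. (\<psi> x + (- 1) * \<phi> x) + (- t) * h x)"
  note tw\<psi>\<phi> = twice_diff_on_linear(1)[OF tw(2,1), of "- 1"]
  have twF: "twice_diff_on W F" unfolding F_def by (rule twice_diff_on_linear(1)[OF tw\<psi>\<phi> twh])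
  have "continuous_on (cball q r) F"
    unfolding F_def using cb by (intro continuous_intros cont\<phi>\<psi> hcont) auto
  then obtain x0 where x0: "x0 \<in> cball q r" "\<And>x. x \<in> cball q r \<Longrightarrow> F x0 \<le> F x"
    using continuous_attains_inf[OF compact_cball, of q r F] r by auto
  have "F x > 0" if "x \<in> sphere q r" for x
  proof (cases "h x \<ge> 0")
    case True
    then have "x \<in> T" using that by (simp add: T_def)
    then have "t * h x \<le> t * B" "m \<le> \<psi> x - \<phi> x" using mB(2) t(1) by (auto intro: mult_left_mono)
    then show ?thesis using t(3) by (simp add: F_def)
  next
    case False
    then have "t * h x < 0" using t(1) by (simp add: mult_pos_neg)
    moreover have "\<phi> x \<le> \<psi> x" using le cb[of x] that by auto
    ultimately show ?thesis by (simp add: F_def)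
  qed
  moreover have "F x0 \<le> 0" using x0(2)[of q] r q(2) by (simp add: F_def gq)
  ultimately have "x0 \<notin> sphere q r" by fastforce
  then have "x0 \<in> ball q r" using x0(1) by auto
  then have "\<forall>\<^sub>F y in nhds x0. y \<in> ball q r" by (intro eventually_nhds_in_open) auto
  then have min: "\<forall>\<^sub>F y in nhds x0. F x0 \<le> F y"
    by (rule eventually_mono) (use x0(2) in auto)
  have x0W: "x0 \<in> W" using cb x0(1) by blast
  note lm = local_min_hderiv[OF twF x0W min]
  have EF: "hderiv I F x0 = hderiv I \<psi> x0 - \<xi> (x0, t) I" for I
    unfolding F_def hderiv_linear(1)[OF tw\<psi>\<phi> twh x0W] hderiv_linear(1)[OF tw(2,1) x0W] by (simp add: \<xi>_def)
  have EEF: "hderiv I (hderiv J F) x0 = hderiv I (hderiv J \<psi>) x0 - M (x0, t) I J" for I J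
    unfolding F_def hderiv_linear(2)[OF tw\<psi>\<phi> twh x0W] hderiv_linear(2)[OF tw(2,1) x0W] by (simp add: M_def)
  \<comment> \<open>At the minimum \<psi> and \<phi> + t h have the same horizontal gradient, so the
    quasilinear operator has the same coefficients for both and the difference of the curvatures is
    linear in the second derivatives of \<open>F\<close>.\<close>
  have \<xi>: "\<xi> (x0, t) = (\<lambda>I. hderiv I \<psi> x0)" using lm(1) EF by fastforce
  have "S\<xi> (x0, t) > 0" using KS[of x0 t] cb[OF x0(1)] \<delta>0(2)[of t] t by (simp add: dist_real_def)
  then have "0 \<le> curv p (\<lambda>I. hderiv I \<psi> x0) (\<lambda>I J. hderiv I (hderiv J F) x0)"
    by (intro curv_nonneg lm(2) p) (simp add: S\<xi>_def \<xi>)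
  then have "curv p (\<xi> (x0, t)) (M (x0, t)) \<le> curv p (\<lambda>I. hderiv I \<psi> x0) (\<lambda>I J. hderiv I (hderiv J \<psi>) x0)"
    unfolding EEF curv_diff \<xi> by simp
  also have "\<dots> \<le> curv p (\<lambda>I. hderiv I \<phi> x0) (\<lambda>I J. hderiv I (hderiv J \<phi>) x0)" by (rule H[OF x0W])
  also have "\<dots> < curv p (\<xi> (x0, t)) (M (x0, t))"
    using increasing[OF x0(1) t(1,2)] unfolding \<xi>0 .
  finally show False by simp
qed

section \<open>Regularity and translation invariance\<close>

text \<open>In finite dimension continuity on each fixed vector suffices: expand \<open>V x\<close>
  in the basis.\<close>

lemma continuous_on_linear_apply:
  fixes F :: "'a::topological_space \<Rightarrow> 'b::euclidean_space \<Rightarrow> 'c::real_normed_vector"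
  assumes "\<And>x. x \<in> A \<Longrightarrow> linear (F x)" and "\<And>b. continuous_on A (\<lambda>x. F x b)"
    and "continuous_on A V"
  shows "continuous_on A (\<lambda>x. F x (V x))"
proof -
  have "continuous_on A (\<lambda>x. \<Sum>b\<in>Basis. (V x \<bullet> b) *\<^sub>R F x b)"
    by (intro continuous_on_sum continuous_on_scaleR continuous_on_inner continuous_on_const assms(2,3))
  moreover have "(\<Sum>b\<in>Basis. (V x \<bullet> b) *\<^sub>R F x b) = F x (V x)" if "x \<in> A" for x
  proof -
    have "F x (V x) = F x (\<Sum>b\<in>Basis. (V x \<bullet> b) *\<^sub>R b)" by (simp add: euclidean_representation)
    then show ?thesis by (simp add: linear_sum[OF assms(1)[OF that]] linear_scale[OF assms(1)[OF that]])
  qed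
  ultimately show ?thesis by (simp cong: continuous_on_cong)
qed

lemma C1_lipschitz_on_cball:
  fixes F :: "'a::euclidean_space \<Rightarrow> 'b::real_normed_vector"
  assumes F: "\<And>y. y \<in> cball q r \<Longrightarrow> (F has_derivative F' y) (at y)"
    and cont: "\<And>b. continuous_on (cball q r) (\<lambda>y. F' y b)"
  shows "\<exists>L. L-lipschitz_on (cball q r) F"
proof -
  have "\<exists>C. \<forall>y\<in>cball q r. norm (F' y b) \<le> C" for b
  proof -
    have "bounded ((\<lambda>y. F' y b) ` cball q r)"
      by (intro compact_imp_bounded compact_continuous_image cont compact_cball)
    then show ?thesis by (auto simp: bounded_iff)
  qed
  then obtain C where C: "\<And>b y. y \<in> cball q r \<Longrightarrow> norm (F' y b) \<le> C b" by metis
  define M where "M = (\<Sum>b\<in>Basis. \<bar>C b\<bar>)"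
  have "onorm (F' y) \<le> M" if y: "y \<in> cball q r" for y
  proof (rule onorm_le)
    fix u
    have l: "linear (F' y)" by (rule has_derivative_linear[OF F[OF y]])
    have "F' y u = F' y (\<Sum>b\<in>Basis. (u \<bullet> b) *\<^sub>R b)" by (simp add: euclidean_representation)
    also have "\<dots> = (\<Sum>b\<in>Basis. (u \<bullet> b) *\<^sub>R F' y b)" by (simp add: linear_sum[OF l] linear_scale[OF l])
    also have "norm \<dots> \<le> (\<Sum>b\<in>Basis. \<bar>C b\<bar> * norm u)"
    proof (rule sum_norm_le)
      fix b :: 'a assume b: "b \<in> Basis"
      have "norm (F' y b) \<le> \<bar>C b\<bar>" using C[OF y, of b] by simp
      then show "norm ((u \<bullet> b) *\<^sub>R F' y b) \<le> \<bar>C b\<bar> * norm u"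
        using mult_mono[OF Basis_le_norm[OF b, of u], of "norm (F' y b)" "\<bar>C b\<bar>"] by (simp add: mult.commute)
    qed
    finally show "norm (F' y u) \<le> M * norm u" by (simp add: M_def sum_distrib_right)
  qed
  moreover have "M \<ge> 0" by (simp add: M_def sum_nonneg)
  ultimately show ?thesis
    using F by (intro exI[of _ M] bounded_derivative_imp_lipschitz[where f' = F'])
      (auto intro: has_derivative_at_withinI)
qed

lemma smooth_on_imp_twice_diff_on:
  assumes "open U" "smooth_on U f"
  shows "twice_diff_on U f" and "continuous_on U (\<lambda>x. second_deriv f x u v)"
proof -
  have "Ck_on (Suc (Suc 0)) U f" using assms(2) by (simp only: smooth_on_def)
  then show "twice_diff_on U f" "continuous_on U (\<lambda>x. second_deriv f x u v)"
    using assms(1) by (auto simp: twice_diff_on_def second_deriv_def)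
qed

section \<open>Symmetry of second derivatives\<close>

lemma second_difference:
  assumes f: "twice_diff_on U f" and s: "s > 0"
    and sub: "\<And>a b. 0 \<le> a \<Longrightarrow> a \<le> s \<Longrightarrow> 0 \<le> b \<Longrightarrow> b \<le> s \<Longrightarrow> x + a *\<^sub>R u + b *\<^sub>R v \<in> U"
  obtains a b where "0 \<le> a" "a \<le> s" "0 \<le> b" "b \<le> s"
    "f (x + s *\<^sub>R u + s *\<^sub>R v) - f (x + s *\<^sub>R u) - f (x + s *\<^sub>R v) + f x
      = s * s * second_deriv f (x + a *\<^sub>R u + b *\<^sub>R v) u v"
proof -
  have line: "((\<lambda>t. g (y + t *\<^sub>R w)) has_real_derivative g' w) (at t)"
    if "(g has_derivative g') (at (y + t *\<^sub>R w))" for g :: "'a \<Rightarrow> real" and g' y w t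
  proof -
    have "((\<lambda>t. y + t *\<^sub>R w) has_derivative (\<lambda>h. h *\<^sub>R w)) (at t)"
      by (auto intro!: derivative_eq_intros)
    from has_derivative_compose[OF this that] show ?thesis
      using linear_scale[OF has_derivative_linear[OF that]]
      by (simp add: has_field_derivative_def mult.commute[of _ "g' w"])
  qed
  define k where "k b = f (x + s *\<^sub>R u + b *\<^sub>R v) - f (x + b *\<^sub>R v)" for b
  define k' where "k' b = frechet_derivative f (at (x + s *\<^sub>R u + b *\<^sub>R v)) v
      - frechet_derivative f (at (x + b *\<^sub>R v)) v" for b
  have "(k has_real_derivative k' b) (at b)" if "0 \<le> b" "b \<le> s" for b
    unfolding k_def k'_def
    using sub[of s b] sub[of 0 b] that s by (intro DERIV_diff line twice_diff_onD(1)[OF f]) auto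
  then obtain b where b: "0 < b" "b < s" "k s - k 0 = (s - 0) * k' b"
    using MVT2[of 0 s k k'] s by blast
  define l where "l a = frechet_derivative f (at (x + b *\<^sub>R v + a *\<^sub>R u)) v" for a
  have "(l has_real_derivative second_deriv f (x + b *\<^sub>R v + a *\<^sub>R u) u v) (at a)" if "0 \<le> a" "a \<le> s" for a
  proof -
    have "x + b *\<^sub>R v + a *\<^sub>R u \<in> U" using sub[of a b] that b by (simp add: algebra_simps)
    from line[OF twice_diff_onD(2)[OF f this, of v]] show ?thesis unfolding l_def .
  qed
  then obtain a where a: "0 < a" "a < s" "l s - l 0 = (s - 0) * second_deriv f (x + b *\<^sub>R v + a *\<^sub>R u) u v"
    using MVT2[of 0 s l "\<lambda>a. second_deriv f (x + b *\<^sub>R v + a *\<^sub>R u) u v"] s by blast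
  have "k' b = l s - l 0" by (simp add: k'_def l_def add_ac)
  then have "k s - k 0 = s * s * second_deriv f (x + a *\<^sub>R u + b *\<^sub>R v) u v"
    using a(3) b(3) by (simp add: add_ac)
  then show thesis using a b that[of a b] by (simp add: k_def)
qed

text \<open>The second difference is symmetric in \<open>u\<close> and \<open>v\<close> and equals
  s^2 times either mixed derivative at points near \<open>x\<close>. The tolerance \<open>e\<close>,
  half of a supposed gap between the two, is then contradictory.\<close>

lemma second_deriv_symmetric:
  assumes f: "twice_diff_on U f" and cont: "\<And>u v. continuous_on U (\<lambda>x. second_deriv f x u v)" and x: "x \<in> U"
  shows "second_deriv f x u v = second_deriv f x v u"
proof (rule ccontr)
  have U: "open U" using f by (simp add: twice_diff_on_def)
  define e where "e = \<bar>second_deriv f x u v - second_deriv f x v u\<bar> / 2"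
  assume "second_deriv f x u v \<noteq> second_deriv f x v u"
  then have e: "e > 0" by (simp add: e_def)
  have ev: "\<forall>\<^sub>F y in nhds x. dist (second_deriv f y u v) (second_deriv f x u v) < e" for u v
  proof -
    have "isCont (\<lambda>y. second_deriv f y u v) x"
      using cont[of u v] U x by (simp add: continuous_on_eq_continuous_at)
    then have "((\<lambda>y. second_deriv f y u v) \<longlongrightarrow> second_deriv f x u v) (nhds x)"
      unfolding isCont_def by (rule tendsto_at_iff_tendsto_nhds[THEN iffD1])
    then show ?thesis using e by (rule tendstoD)
  qed
  have "\<forall>\<^sub>F y in nhds x. y \<in> U \<and> dist (second_deriv f y u v) (second_deriv f x u v) < e \<and> dist (second_deriv f y v u) (second_deriv f x v u) < e"
    by (intro eventually_conj ev eventually_nhds_in_open U x)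
  then obtain d where d: "d > 0" "\<And>y. dist y x < d \<Longrightarrow>
      y \<in> U \<and> dist (second_deriv f y u v) (second_deriv f x u v) < e \<and> dist (second_deriv f y v u) (second_deriv f x v u) < e"
    unfolding eventually_nhds_metric by blast
  \<comment> \<open>Chosen so that the parallelogram with sides \<open>s *\<^sub>R u\<close> and
    \<open>s *\<^sub>R v\<close> stays within \<open>d\<close> of \<open>x\<close>; the 1 covers u =
    v = 0.\<close>
  define n where "n = norm u + norm v + 1"
  define s where "s = d / (n * 2)"
  have n: "n > 0" by (simp add: n_def add_nonneg_pos)
  then have s: "s > 0" using d(1) by (simp add: s_def)
  have near: "dist (x + a *\<^sub>R u + b *\<^sub>R v) x < d" if "0 \<le> a" "a \<le> s" "0 \<le> b" "b \<le> s" for a b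
  proof -
    have "dist (x + a *\<^sub>R u + b *\<^sub>R v) x \<le> norm (a *\<^sub>R u) + norm (b *\<^sub>R v)"
      using norm_triangle_ineq[of "a *\<^sub>R u" "b *\<^sub>R v"] by (simp add: dist_norm add.assoc)
    also have "\<dots> \<le> s * norm u + s * norm v"
      using that by (auto intro!: add_mono mult_right_mono)
    also have "\<dots> < s * n * 2"
    proof -
      have "0 < s * (norm u + norm v + 2)" using s by (intro mult_pos_pos add_nonneg_pos) auto
      then show ?thesis by (simp add: n_def algebra_simps)
    qed
    also have "\<dots> = d" using n by (simp add: s_def)
    finally show ?thesis .
  qed
  obtain a b where ab: "0 \<le> a" "a \<le> s" "0 \<le> b" "b \<le> s"
    "f (x + s *\<^sub>R u + s *\<^sub>R v) - f (x + s *\<^sub>R u) - f (x + s *\<^sub>R v) + f x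
      = s * s * second_deriv f (x + a *\<^sub>R u + b *\<^sub>R v) u v"
    using second_difference[OF f s, of x u v] near d(2) by metis
  have near': "dist (x + b *\<^sub>R v + a *\<^sub>R u) x < d" if "0 \<le> a" "a \<le> s" "0 \<le> b" "b \<le> s" for a b
    using near[OF that] by (simp add: add_ac)
  obtain a' b' where ab': "0 \<le> a'" "a' \<le> s" "0 \<le> b'" "b' \<le> s"
    "f (x + s *\<^sub>R v + s *\<^sub>R u) - f (x + s *\<^sub>R v) - f (x + s *\<^sub>R u) + f x
      = s * s * second_deriv f (x + a' *\<^sub>R v + b' *\<^sub>R u) v u"
    using second_difference[OF f s, of x v u] near' d(2) by metis
  have e1: "x + s *\<^sub>R v + s *\<^sub>R u = x + s *\<^sub>R u + s *\<^sub>R v" by (simp add: add_ac)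
  have "s * s * second_deriv f (x + a *\<^sub>R u + b *\<^sub>R v) u v = s * s * second_deriv f (x + a' *\<^sub>R v + b' *\<^sub>R u) v u"
    using ab(5) ab'(5) unfolding e1 by linarith
  then have "second_deriv f (x + a *\<^sub>R u + b *\<^sub>R v) u v = second_deriv f (x + a' *\<^sub>R v + b' *\<^sub>R u) v u"
    using s by simp
  then have "dist (second_deriv f x u v) (second_deriv f x v u) < e + e"
    using d(2)[OF near[OF ab(1-4)]] d(2)[OF near'[OF ab'(3,4,1,2)]]
    by (metis add_strict_mono dist_triangle3 le_less_trans)
  then show False by (simp add: dist_real_def e_def)
qed

lemma continuous_on_diff1:
  assumes "twice_diff_on U f"
  shows "continuous_on U (\<lambda>x. frechet_derivative f (at x) v)"
  by (intro continuous_at_imp_continuous_on ballI has_derivative_continuous[OF twice_diff_onD(2)[OF assms]])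

definition dhderiv :: "'n + 'n \<Rightarrow> ('n::finite heis \<Rightarrow> real) \<Rightarrow> 'n heis \<Rightarrow> 'n heis \<Rightarrow> real" where
  "dhderiv J f x u = second_deriv f x u (frame x J) + slope J u * frechet_derivative f (at x) (0, 1)"

lemma hderiv_has_derivative_dhderiv: "twice_diff_on U f \<Longrightarrow> x \<in> U \<Longrightarrow> (hderiv J f has_derivative dhderiv J f x) (at x)"
  unfolding dhderiv_def[abs_def] by (rule hderiv_has_derivative)

lemma continuous_on_dhderiv:
  assumes f: "twice_diff_on U f" and cont: "\<And>u v. continuous_on U (\<lambda>x. second_deriv f x u v)"
  shows "continuous_on U (\<lambda>x. dhderiv J f x u)"
  unfolding dhderiv_def
proof (intro continuous_on_add continuous_on_mult continuous_on_const)
  show "continuous_on U (\<lambda>x. second_deriv f x u (frame x J))"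
    by (rule continuous_on_linear_apply[where F = "\<lambda>x. second_deriv f x u",
          OF second_deriv_linear_right[OF f] cont continuous_frame])
  show "continuous_on U (\<lambda>x. frechet_derivative f (at x) (0, 1))"
    by (rule continuous_on_diff1[OF f])
qed

lemma continuous_on_hderiv_hderiv:
  assumes f: "twice_diff_on U f" and cont: "\<And>u v. continuous_on U (\<lambda>x. second_deriv f x u v)"
  shows "continuous_on U (hderiv I (hderiv J f))"
proof -
  have "continuous_on U (\<lambda>x. dhderiv J f x (frame x I))"
    by (rule continuous_on_linear_apply[where F = "dhderiv J f" and V = "\<lambda>x. frame x I",
          OF has_derivative_linear[OF hderiv_has_derivative_dhderiv[OF f]] continuous_on_dhderiv[OF assms]
            continuous_frame])
  moreover have "dhderiv J f x (frame x I) = hderiv I (hderiv J f) x" if "x \<in> U" for x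
    using hderiv_eq[OF hderiv_has_derivative_dhderiv[OF f that]] by simp
  ultimately show ?thesis by (simp cong: continuous_on_cong)
qed

lemma continuous_on_hderiv: "twice_diff_on U f \<Longrightarrow> continuous_on U (hderiv I f)"
  by (intro continuous_at_imp_continuous_on ballI has_derivative_continuous[OF hderiv_has_derivative])

text \<open>The generator of left translations, hence a right invariant field: its z-component is
  opposite to that of the left invariant \<open>frame y (Inl first_index)\<close>, and it is
  horizontal only where x^(n+1) = 0.\<close>

definition transl_field :: "'n::{finite,linorder} heis \<Rightarrow> 'n heis" where
  "transl_field y = (axis (Inl first_index) 1, - fst y $ Inr first_index)"

lemma l_transl_eq: "l_transl a y = y + a *\<^sub>R transl_field y"
  by (simp add: l_transl_def transl_field_def prod_eq_iff vec_eq_iff axis_def)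

lemma transl_field_has_derivative:
  "(transl_field has_derivative (\<lambda>u. (0, - fst u $ Inr first_index))) (at (x :: 'n::{finite,linorder} heis))"
  unfolding transl_field_def[abs_def]
  by (rule has_derivative_Pair[OF has_derivative_const has_derivative_minus[OF
        bounded_linear_imp_has_derivative[OF bounded_linear_compose[OF bounded_linear_vec_nth bounded_linear_fst]]]])

lemma l_transl_has_derivative:
  "(l_transl a has_derivative (\<lambda>u. u + a *\<^sub>R (0, - fst u $ Inr first_index))) (at (x :: 'n::{finite,linorder} heis))"
  unfolding l_transl_eq[abs_def]
  by (rule has_derivative_add[OF has_derivative_ident
        has_derivative_scaleR_right[OF transl_field_has_derivative]])

text \<open>Left invariance: the differential of the translation carries the frame at
  \<open>x\<close> to the frame at the image point.\<close>

lemma l_transl_frame: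
  "frame x I + a *\<^sub>R (0, - fst (frame x I) $ Inr first_index) = frame (l_transl a x) I"
  by (cases I) (auto simp: frame_eq slope_def l_transl_def axis_def)

lemma hderiv_l_transl:
  assumes "f differentiable (at (l_transl a x))"
  shows "hderiv I (\<lambda>y. f (l_transl a y)) x = hderiv I f (l_transl a x)"
proof -
  have "(f has_derivative frechet_derivative f (at (l_transl a x))) (at (l_transl a x))"
    using assms frechet_derivative_works by blast
  from hderiv_eq[OF has_derivative_compose[OF l_transl_has_derivative this]] show ?thesis
    by (simp only: l_transl_frame) (simp add: hderiv_def)
qed

lemma isCont_l_transl: "isCont (l_transl a) x"
  by (rule has_derivative_continuous[OF l_transl_has_derivative])

text \<open>Invariance is available only while both points lie in \<open>V\<close>, but this is an
  open condition and derivatives are local. The constant \<open>b\<close> serves \<phi> itself, with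
  b = - a, and its horizontal derivatives, with b = 0.\<close>

lemma hderiv_l_transl_invariant:
  assumes "open V" "x \<in> V" "l_transl a x \<in> V"
    and diff: "\<And>y. y \<in> V \<Longrightarrow> f differentiable (at y)"
    and inv: "\<And>y. y \<in> V \<Longrightarrow> l_transl a y \<in> V \<Longrightarrow> f (l_transl a y) = f y + b"
  shows "hderiv I f (l_transl a x) = hderiv I f x"
proof -
  have "\<forall>\<^sub>F y in nhds x. y \<in> V \<and> l_transl a y \<in> V"
    using assms(1-3) isCont_l_transl[of x a]
    by (intro eventually_conj eventually_nhds_in_open)
      (auto simp: isCont_def tendsto_at_iff_tendsto_nhds dest: topological_tendstoD)
  then have "\<forall>\<^sub>F y in nhds x. f (l_transl a y) = f y + b"
    by (rule eventually_mono) (use inv in auto)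
  then have "hderiv I (\<lambda>y. f (l_transl a y)) x = hderiv I (\<lambda>y. f y + b) x"
    by (rule hderiv_cong_ev)
  also have "\<dots> = hderiv I f x"
  proof -
    have "(f has_derivative frechet_derivative f (at x)) (at x)"
      using diff[OF assms(2)] frechet_derivative_works by blast
    then have "((\<lambda>y. f y + b) has_derivative frechet_derivative f (at x)) (at x)"
      by (auto intro!: derivative_eq_intros)
    from hderiv_eq[OF this] show ?thesis by (simp add: hderiv_def)
  qed
  finally show ?thesis using hderiv_l_transl[OF diff[OF assms(3)]] by simp
qed

lemma compatible_definingD:
  assumes "compatible_defining \<Sigma> p0 U \<phi>"
  shows "open U" "p0 \<in> U" "twice_diff_on U \<phi>" "continuous_on U (\<lambda>x. second_deriv \<phi> x u v)"
    "x \<in> U \<Longrightarrow> x \<in> \<Sigma> \<longleftrightarrow> \<phi> x = 0"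
    "x \<in> U \<Longrightarrow> co_norm x (diff1 \<phi> x) \<noteq> 0"
    "x \<in> U \<Longrightarrow> l_transl a x \<in> U \<Longrightarrow> \<phi> (l_transl a x) = \<phi> x - a"
  using assms smooth_on_imp_twice_diff_on[of U \<phi>] unfolding compatible_defining_def by blast+

lemma mean_curv_compatible:
  assumes "compatible_defining \<Sigma> p0 U \<phi>" "x \<in> U"
  shows "mean_curv \<phi> p x = curv p (\<lambda>I. hderiv I \<phi> x) (\<lambda>I J. hderiv I (hderiv J \<phi>) x)"
  using mean_curv_eq compatible_definingD(3,6)[OF assms(1)] assms(2) by blast

lemma mean_curv_l_transl:
  assumes c: "compatible_defining \<Sigma> p0 U \<phi>" and x: "x \<in> U" "l_transl a x \<in> U"
  shows "mean_curv \<phi> p (l_transl a x) = mean_curv \<phi> p x"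
proof -
  note U = compatible_definingD(1,3,7)[OF c]
  have hderiv: "hderiv I \<phi> (l_transl a y) = hderiv I \<phi> y" if "y \<in> U" "l_transl a y \<in> U" for I y
    using U that by (intro hderiv_l_transl_invariant[where b = "- a"]) (auto simp: twice_diff_on_def)
  have "hderiv I (hderiv J \<phi>) (l_transl a x) = hderiv I (hderiv J \<phi>) x" for I J
    using U(1) x hderiv differentiableI[OF hderiv_has_derivative[OF U(2)]]
    by (intro hderiv_l_transl_invariant[where b = 0]) auto
  then show ?thesis by (simp add: mean_curv_compatible[OF c] x hderiv)
qed

section \<open>Propagation of the contact set\<close>

text \<open>For \<open>I \<noteq> x^1\<close>, the fields \<open>hor \<phi> I\<close> span the horizontal vectors in the kernel of \<open>d\<phi>\<close>.\<close>

definition hor :: "('n::{finite,linorder} heis \<Rightarrow> real) \<Rightarrow> 'n + 'n \<Rightarrow> 'n heis \<Rightarrow> 'n heis" where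
  "hor \<phi> I y = hderiv (Inl first_index) \<phi> y *\<^sub>R frame y I - hderiv I \<phi> y *\<^sub>R frame y (Inl first_index)"

definition dhor :: "('n::{finite,linorder} heis \<Rightarrow> real) \<Rightarrow> 'n + 'n \<Rightarrow> 'n heis \<Rightarrow> 'n heis \<Rightarrow> 'n heis" where
  "dhor \<phi> I y u =
     (hderiv (Inl first_index) \<phi> y *\<^sub>R (0, slope I u) + dhderiv (Inl first_index) \<phi> y u *\<^sub>R frame y I)
     - (hderiv I \<phi> y *\<^sub>R (0, slope (Inl first_index) u) + dhderiv I \<phi> y u *\<^sub>R frame y (Inl first_index))"

definition hor_bracket :: "('n::{finite,linorder} heis \<Rightarrow> real) \<Rightarrow> 'n + 'n \<Rightarrow> 'n + 'n \<Rightarrow> 'n heis \<Rightarrow> 'n heis" where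
  "hor_bracket \<phi> I J y = dhor \<phi> J y (hor \<phi> I y) - dhor \<phi> I y (hor \<phi> J y)"

lemma hor_has_derivative:
  assumes "twice_diff_on U \<phi>" "y \<in> U"
  shows "(hor \<phi> I has_derivative dhor \<phi> I y) (at y)"
  unfolding hor_def[abs_def] dhor_def[abs_def]
  by (rule has_derivative_diff[OF has_derivative_scaleR[OF hderiv_has_derivative_dhderiv[OF assms] frame_has_derivative]
        has_derivative_scaleR[OF hderiv_has_derivative_dhderiv[OF assms] frame_has_derivative]])

lemma continuous_on_hor: "twice_diff_on U \<phi> \<Longrightarrow> continuous_on U (hor \<phi> I)"
  by (intro continuous_at_imp_continuous_on ballI has_derivative_continuous[OF hor_has_derivative])

lemma continuous_on_dhor:
  fixes \<phi> :: "'n::{finite,linorder} heis \<Rightarrow> real"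
  assumes f: "twice_diff_on U \<phi>" and cont: "\<And>u v. continuous_on U (\<lambda>x. second_deriv \<phi> x u v)"
  shows "continuous_on U (\<lambda>y. dhor \<phi> I y u)"
  unfolding dhor_def
  by (intro continuous_on_diff continuous_on_add continuous_on_scaleR continuous_on_const
      continuous_on_hderiv[OF f] continuous_on_dhderiv[OF assms] continuous_frame)

lemma continuous_on_hor_bracket:
  fixes \<phi> :: "'n::{finite,linorder} heis \<Rightarrow> real"
  assumes f: "twice_diff_on U \<phi>" and cont: "\<And>u v. continuous_on U (\<lambda>x. second_deriv \<phi> x u v)"
  shows "continuous_on U (hor_bracket \<phi> I J)"
proof -
  have "continuous_on U (\<lambda>y. dhor \<phi> I y (hor \<phi> J y))" for I J
    by (rule continuous_on_linear_apply[where F = "dhor \<phi> I" and V = "hor \<phi> J",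
          OF has_derivative_linear[OF hor_has_derivative[OF f]] continuous_on_dhor[OF assms]
            continuous_on_hor[OF f]])
  then show ?thesis unfolding hor_bracket_def[abs_def] by (intro continuous_on_diff)
qed

lemma hor_lipschitz:
  fixes \<phi> :: "'n::{finite,linorder} heis \<Rightarrow> real"
  assumes f: "twice_diff_on U \<phi>" and cont: "\<And>u v. continuous_on U (\<lambda>x. second_deriv \<phi> x u v)"
    and sub: "cball q r \<subseteq> U"
  shows "\<exists>L. L-lipschitz_on (cball q r) (hor \<phi> I)"
  by (rule C1_lipschitz_on_cball[where F' = "dhor \<phi> I"])
    (use sub in \<open>auto intro: hor_has_derivative[OF f] continuous_on_subset[OF continuous_on_dhor[OF f cont]]\<close>)

text \<open>The bracket supplies the missing \<open>\<partial>/\<partial>z\<close>: this is where \<open>n \<ge> 2\<close> enters.\<close>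

lemma normal_eq_0:
  fixes p0 \<nu> :: "'n::{finite,linorder} heis"
  assumes f: "twice_diff_on U \<phi>" and cont: "\<And>u v. continuous_on U (\<lambda>x. second_deriv \<phi> x u v)" and p0: "p0 \<in> U"
    and d: "\<And>v. diff1 \<phi> p0 v = - (fst v $ Inl first_index)" and j: "j \<noteq> first_index"
    and W: "\<And>I. \<nu> \<bullet> hor \<phi> I p0 = 0" and X: "\<nu> \<bullet> transl_field p0 = 0"
    and B: "\<nu> \<bullet> hor_bracket \<phi> (Inl j) (Inr j) p0 = 0"
  shows "\<nu> = 0"
proof -
  let ?o = "Inl first_index :: 'n + 'n"
  have hderiv: "hderiv I \<phi> p0 = (if I = ?o then - 1 else 0)" for I
    by (simp add: hderiv_def d frame_eq axis_def)
  have W0: "hor \<phi> I p0 = - frame p0 I" if "I \<noteq> ?o" for I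
    using that by (simp add: hor_def hderiv)
  have fr: "\<nu> \<bullet> frame p0 I = 0" if "I \<noteq> ?o" for I
    using W[of I] W0[OF that] by simp
  have ne: "Inl j \<noteq> ?o" "Inr j \<noteq> ?o" using j by auto
  have lin: "linear (dhor \<phi> I p0)" for I
    by (rule has_derivative_linear[OF hor_has_derivative[OF f p0]])
  have dh: "\<nu> \<bullet> dhor \<phi> I p0 u = - slope I u * snd \<nu> - dhderiv I \<phi> p0 u * (\<nu> \<bullet> frame p0 ?o)"
    if "I \<noteq> ?o" for I u
    using that fr[OF that] by (simp add: dhor_def hderiv inner_diff_right inner_add_right inner_Pair_0)
  have dhderiv: "dhderiv I \<phi> p0 u = second_deriv \<phi> p0 u (frame p0 I)" for I u
    by (simp add: dhderiv_def d)
  have sl: "slope (Inr j) (frame p0 (Inl j)) = - 1" "slope (Inl j) (frame p0 (Inr j)) = 1"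
    by (simp_all add: slope_def frame_eq axis_def)
  \<comment> \<open>The unknown component of \<nu> along the frame vector of x^1 is multiplied by a
    difference of mixed second derivatives of \<phi>, which vanishes by symmetry. The slopes -1 and
    1 do not cancel: they leave twice the z-component.\<close>
  have "0 = \<nu> \<bullet> dhor \<phi> (Inr j) p0 (- frame p0 (Inl j)) - \<nu> \<bullet> dhor \<phi> (Inl j) p0 (- frame p0 (Inr j))"
    using B unfolding hor_bracket_def W0[OF ne(1)] W0[OF ne(2)] inner_diff_right by simp
  also have "\<dots> = - 2 * snd \<nu>"
    unfolding linear_neg[OF lin] inner_minus_right dh[OF ne(1)] dh[OF ne(2)] dhderiv sl
    using second_deriv_symmetric[OF f cont p0, of "frame p0 (Inl j)" "frame p0 (Inr j)"] by simp
  finally have z: "snd \<nu> = 0" by simp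
  have "fst \<nu> $ I = 0" for I
  proof (cases "I = ?o")
    case True
    then show ?thesis using X z by (simp add: transl_field_def inner_prod_def inner_axis)
  next
    case False
    then show ?thesis using fr[OF False] z by (simp add: frame_eq inner_prod_def inner_axis)
  qed
  then show ?thesis using z by (simp add: prod_eq_iff vec_eq_iff)
qed

text \<open>The equations are homogeneous in \<nu>, so unit vectors suffice. As a sum of squares,
  \<Phi> turns them into one closed condition on a compact set; the points admitting a unit solution
  form a compact projection that misses \<open>p0\<close>.\<close>

lemma normal_eq_0_nearby:
  fixes p0 :: "'n::{finite,linorder} heis"
  assumes U: "open U" and f: "twice_diff_on U \<phi>" and cont: "\<And>u v. continuous_on U (\<lambda>x. second_deriv \<phi> x u v)" and p0: "p0 \<in> U"
    and d: "\<And>v. diff1 \<phi> p0 v = - (fst v $ Inl first_index)" and j: "j \<noteq> first_index"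
  obtains r where "r > 0" "\<And>y \<nu>. dist p0 y < r \<Longrightarrow> (\<And>I. \<nu> \<bullet> hor \<phi> I y = 0) \<Longrightarrow>
    \<nu> \<bullet> transl_field y = 0 \<Longrightarrow> \<nu> \<bullet> hor_bracket \<phi> (Inl j) (Inr j) y = 0 \<Longrightarrow> \<nu> = 0"
proof -
  obtain r0 where r0: "r0 > 0" "cball p0 r0 \<subseteq> U" using U p0 open_contains_cball by blast
  define \<Phi> where "\<Phi> z = (\<Sum>I\<in>UNIV. (snd z \<bullet> hor \<phi> I (fst z))\<^sup>2) + (snd z \<bullet> transl_field (fst z))\<^sup>2
      + (snd z \<bullet> hor_bracket \<phi> (Inl j) (Inr j) (fst z))\<^sup>2" for z :: "'n heis \<times> 'n heis"
  have \<Phi>: "\<Phi> z = 0 \<longleftrightarrow> (\<forall>I. snd z \<bullet> hor \<phi> I (fst z) = 0) \<and> snd z \<bullet> transl_field (fst z) = 0 \<and>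
      snd z \<bullet> hor_bracket \<phi> (Inl j) (Inr j) (fst z) = 0" for z
    by (simp add: \<Phi>_def add_nonneg_eq_0_iff sum_nonneg sum_nonneg_eq_0_iff)
  let ?D = "cball p0 r0 \<times> sphere 0 1 :: ('n heis \<times> 'n heis) set"
  have c: "continuous_on ?D (\<lambda>z. V (fst z))" if "continuous_on U V" for V :: "'n heis \<Rightarrow> 'n heis"
    by (rule continuous_on_compose2[OF that continuous_on_fst[OF continuous_on_id]]) (use r0 in auto)
  have cX: "continuous_on U transl_field"
    by (intro continuous_at_imp_continuous_on ballI has_derivative_continuous[OF transl_field_has_derivative])
  have "continuous_on ?D \<Phi>"
    unfolding \<Phi>_def
    by (intro continuous_on_add continuous_on_sum continuous_on_power continuous_on_inner
        continuous_on_snd continuous_on_id c continuous_on_hor[OF f] cX continuous_on_hor_bracket[OF f cont])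
  moreover have D: "compact ?D" by (intro compact_Times compact_cball compact_sphere)
  ultimately have "closed {z \<in> ?D. \<Phi> z = 0}"
    by (intro continuous_closed_preimage_constant compact_imp_closed)
  then have "compact (?D \<inter> {z \<in> ?D. \<Phi> z = 0})" by (rule compact_Int_closed[OF D])
  then have "closed (fst ` (?D \<inter> {z \<in> ?D. \<Phi> z = 0}))" (is "closed ?A")
    by (intro compact_imp_closed compact_continuous_image continuous_on_fst continuous_on_id)
  moreover have "p0 \<notin> ?A"
  proof
    assume "p0 \<in> ?A"
    then obtain \<nu> where "norm \<nu> = 1" "\<Phi> (p0, \<nu>) = 0" by auto
    then show False using normal_eq_0[OF f cont p0 d j, of \<nu>] unfolding \<Phi> by auto
  qed
  ultimately have "open (- ?A)" "p0 \<in> - ?A" by auto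
  then obtain r1 where r1: "r1 > 0" "ball p0 r1 \<subseteq> - ?A" by (rule openE)
  show thesis
  proof (rule that[of "min r0 r1"])
    show "min r0 r1 > 0" using r0 r1 by simp
    fix y \<nu> assume y: "dist p0 y < min r0 r1" and \<nu>: "\<And>I. \<nu> \<bullet> hor \<phi> I y = 0"
      "\<nu> \<bullet> transl_field y = 0" "\<nu> \<bullet> hor_bracket \<phi> (Inl j) (Inr j) y = 0"
    show "\<nu> = 0"
    proof (rule ccontr)
      assume nz: "\<nu> \<noteq> 0"
      define z where "z = (y, (1 / norm \<nu>) *\<^sub>R \<nu>)"
      have "\<Phi> z = 0" unfolding \<Phi> using \<nu> by (simp add: z_def)
      moreover have "z \<in> ?D" using y nz by (simp add: z_def)
      ultimately have "fst z \<in> ?A" by blast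
      moreover have "fst z \<in> ball p0 r1" using y by (simp add: z_def)
      ultimately show False using r1(2) by blast
    qed
  qed
qed

text \<open>The tangent space determines the differential up to a factor; compatibility fixes the
  factor, since \<phi> decreases at unit speed along \<open>transl_field\<close>, whose
  x^1-component is 1.\<close>

lemma diff1_vertical:
  fixes p0 :: "'n::{finite,linorder} heis"
  assumes c: "compatible_defining \<Sigma> p0 U \<phi>" and p0: "p0 \<in> \<Sigma>"
    and tan: "tangent_space \<Sigma> p0 = {v. v \<bullet> (- d_x1) = 0}"
  shows "diff1 \<phi> p0 v = - (fst v $ Inl first_index)"
proof -
  note U = compatible_definingD[OF c]
  have \<phi>': "(\<phi> has_derivative diff1 \<phi> p0) (at p0)" by (rule twice_diff_onD(1)[OF U(3,2)])
  have lin: "linear (diff1 \<phi> p0)" by (rule has_derivative_linear[OF \<phi>'])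
  have tangent: "diff1 \<phi> p0 w = 0" if "fst w $ Inl first_index = 0" for w
  proof -
    have "w \<in> tangent_space \<Sigma> p0"
      using that by (simp add: tan d_x1_def inner_prod_def inner_axis)
    then obtain e \<gamma> where e: "e > 0" and \<gamma>: "\<And>t. t \<in> {-e<..<e} \<Longrightarrow> \<gamma> t \<in> \<Sigma>" "\<gamma> 0 = p0"
      and \<gamma>': "(\<gamma> has_vector_derivative w) (at 0)"
      unfolding tangent_space_def by blast
    have "isCont \<gamma> 0" by (rule has_vector_derivative_continuous[OF \<gamma>'])
    then have "(\<gamma> \<longlongrightarrow> p0) (nhds 0)"
      using \<gamma>(2) by (simp add: isCont_def tendsto_nhds_iff)
    then have "\<forall>\<^sub>F t in nhds 0. \<gamma> t \<in> U" by (rule topological_tendstoD[OF _ U(1,2)])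
    moreover have "\<forall>\<^sub>F t in nhds 0. t \<in> {-e<..<e}"
      using e by (intro eventually_nhds_in_open) auto
    ultimately have ev: "\<forall>\<^sub>F t in nhds 0. \<phi> (\<gamma> t) = 0"
      by eventually_elim (use \<gamma>(1) U(5) in blast)
    have "((\<lambda>t. \<phi> (\<gamma> t)) has_derivative (\<lambda>t. diff1 \<phi> p0 (t *\<^sub>R w))) (at 0)"
      using has_derivative_compose[OF \<gamma>'[unfolded has_vector_derivative_def]] \<phi>' \<gamma>(2) by simp
    from frechet_derivative_at[OF this] have "diff1 \<phi> p0 (1 *\<^sub>R w) = frechet_derivative (\<lambda>t. \<phi> (\<gamma> t)) (at 0) 1"
      by metis
    also have "\<dots> = 0" unfolding frechet_derivative_cong_ev[OF ev] by (simp add: frechet_derivative_const)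
    finally show ?thesis by simp
  qed
  have "diff1 \<phi> p0 (transl_field p0) = - 1"
  proof -
    have "((\<lambda>a. l_transl a p0) has_derivative (\<lambda>t. t *\<^sub>R transl_field p0)) (at 0)"
      unfolding l_transl_eq by (auto intro!: derivative_eq_intros)
    then have "((\<lambda>a. \<phi> (l_transl a p0)) has_derivative (\<lambda>t. diff1 \<phi> p0 (t *\<^sub>R transl_field p0))) (at 0)"
      by (rule has_derivative_compose) (simp add: l_transl_eq \<phi>')
    from frechet_derivative_at[OF this]
    have 1: "diff1 \<phi> p0 (1 *\<^sub>R transl_field p0) = frechet_derivative (\<lambda>a. \<phi> (l_transl a p0)) (at 0) 1"
      by metis
    have "((\<lambda>a. l_transl a p0) \<longlongrightarrow> p0 + 0 *\<^sub>R transl_field p0) (nhds 0)"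
      unfolding l_transl_eq by (intro tendsto_intros filterlim_ident)
    then have "\<forall>\<^sub>F a in nhds 0. l_transl a p0 \<in> U"
      using topological_tendstoD[OF _ U(1,2)] by simp
    then have "\<forall>\<^sub>F a in nhds 0. \<phi> (l_transl a p0) = \<phi> p0 - a"
      by (rule eventually_mono) (use U(2,7) in blast)
    from frechet_derivative_cong_ev[OF this]
    have "frechet_derivative (\<lambda>a. \<phi> (l_transl a p0)) (at 0) = frechet_derivative (\<lambda>a. \<phi> p0 - a) (at 0)" .
    also have "\<dots> = (\<lambda>t. - t)"
      by (rule frechet_derivative_at[symmetric]) (auto intro!: derivative_eq_intros)
    finally show ?thesis using 1 by simp
  qed
  moreover have "diff1 \<phi> p0 (v - (fst v $ Inl first_index) *\<^sub>R transl_field p0) = 0"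
    by (rule tangent) (simp add: transl_field_def axis_def)
  ultimately show ?thesis
    by (simp add: linear_diff[OF lin] linear_scale[OF lin])
qed

lemma sum_hderiv_pos:
  assumes "compatible_defining \<Sigma> p0 U \<phi>" "x \<in> U"
  shows "(\<Sum>I\<in>UNIV. (hderiv I \<phi> x)\<^sup>2) > 0"
proof -
  have "(\<Sum>I\<in>UNIV. (hderiv I \<phi> x)\<^sup>2) \<noteq> 0"
    using compatible_definingD(6)[OF assms]
    by (simp add: co_norm_def co_inner_def hderiv_def power2_eq_square)
  then show ?thesis by (simp add: less_le sum_nonneg)
qed

text \<open>
  Translating a point near \<open>p0\<close> onto \<open>\<Sigma>1\<close> shows that the comparison hypothesis, stated on
  \<open>\<Sigma>1\<close> only, holds for \<open>\<phi>\<close> and \<open>\<psi>\<close> themselves on a neighbourhood of \<open>p0\<close>.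
\<close>

lemma comparison_near:
  fixes p0 :: "'n::{finite,linorder} heis"
  assumes \<phi>: "compatible_defining \<Sigma>1 p0 U \<phi>" and \<psi>: "compatible_defining \<Sigma>2 p0 V \<psi>"
    and p0: "p0 \<in> \<Sigma>1"
    and hyp: "\<forall>\<^sub>F q in nhds p0. q \<in> \<Sigma>1 \<longrightarrow>
           (\<exists>a\<ge>0. l_transl a q \<in> \<Sigma>2 \<inter> V \<and> mean_curv \<psi> p (l_transl a q) \<le> mean_curv \<phi> p q)"
  shows "\<forall>\<^sub>F x in nhds p0. x \<in> U \<and> x \<in> V \<and> \<phi> x \<le> \<psi> x \<and> mean_curv \<psi> p x \<le> mean_curv \<phi> p x"
proof -
  note U = compatible_definingD[OF \<phi>] and V = compatible_definingD[OF \<psi>]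
  have "\<phi> p0 = 0" using U(2,5) p0 by blast
  have "isCont \<phi> p0" by (rule has_derivative_continuous[OF twice_diff_onD(1)[OF U(3,2)]])
  then have "(\<phi> \<longlongrightarrow> \<phi> p0) (nhds p0)" unfolding isCont_def tendsto_at_iff_tendsto_nhds .
  moreover have "isCont transl_field p0"
    by (rule has_derivative_continuous[OF transl_field_has_derivative])
  then have "(transl_field \<longlongrightarrow> transl_field p0) (nhds p0)"
    unfolding isCont_def tendsto_at_iff_tendsto_nhds .
  ultimately have "((\<lambda>x. x + \<phi> x *\<^sub>R transl_field x) \<longlongrightarrow> p0 + \<phi> p0 *\<^sub>R transl_field p0) (nhds p0)"
    by (intro tendsto_intros filterlim_ident)
  then have lim: "((\<lambda>x. l_transl (\<phi> x) x) \<longlongrightarrow> p0) (nhds p0)"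
    by (simp add: l_transl_eq \<open>\<phi> p0 = 0\<close>)
  have inUV: "\<forall>\<^sub>F x in nhds p0. x \<in> U \<and> x \<in> V"
    by (intro eventually_conj eventually_nhds_in_open U(1,2) V(1,2))
  have "\<forall>\<^sub>F x in nhds p0. x \<in> U \<and> x \<in> V \<and> (x \<in> \<Sigma>1 \<longrightarrow>
      (\<exists>a\<ge>0. l_transl a x \<in> \<Sigma>2 \<inter> V \<and> mean_curv \<psi> p (l_transl a x) \<le> mean_curv \<phi> p x))"
    using inUV hyp by eventually_elim simp
  from inUV eventually_compose_filterlim[OF this lim] show ?thesis
  proof eventually_elim
    case (elim x)
    define y where "y = l_transl (\<phi> x) x"
    have x: "x \<in> U" "x \<in> V" and y: "y \<in> U" "y \<in> V" using elim by (auto simp: y_def)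
    have "\<phi> y = 0" using U(7)[OF x(1), of "\<phi> x"] y by (simp add: y_def)
    then have "y \<in> \<Sigma>1" using U(5) y by blast
    then obtain a where a: "a \<ge> 0" "l_transl a y \<in> \<Sigma>2" "l_transl a y \<in> V"
        "mean_curv \<psi> p (l_transl a y) \<le> mean_curv \<phi> p y"
      using elim(2) by (auto simp: y_def)
    \<comment> \<open>The translation from \<open>y\<close> to \<Sigma>2 has length \<psi> y, and
      the one from \<open>x\<close> to \<open>y\<close> lowers \<psi> by \<phi> x. So a \<ge> 0 says
      exactly \<phi> x \<le> \<psi> x.\<close>
    have "\<psi> y = a" using V(5)[OF a(3)] V(7)[OF y(2) a(3)] a(2) by simp
    moreover have "\<psi> y = \<psi> x - \<phi> x" using V(7)[OF x(2), of "\<phi> x"] y by (simp add: y_def)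
    moreover have "mean_curv \<psi> p (l_transl a y) = mean_curv \<psi> p x" "mean_curv \<phi> p y = mean_curv \<phi> p x"
      using mean_curv_l_transl[OF \<psi> y(2) a(3)] mean_curv_l_transl[OF \<psi> x(2), of "\<phi> x"]
        mean_curv_l_transl[OF \<phi> x(1), of "\<phi> x"] y by (simp_all add: y_def)
    ultimately show ?case using a x by simp
  qed
qed

theorem corollaryD:
  fixes \<Sigma>1 \<Sigma>2 U V :: "'n::{finite,linorder} heis set"
    and p0 :: "'n heis"
    and \<phi> \<psi> :: "'n heis \<Rightarrow> real"
    and p :: real
  assumes "CARD('n) \<ge> 2"
    and "hypersurface \<Sigma>1" and "hypersurface \<Sigma>2"
    and "p0 \<in> \<Sigma>1" and "p0 \<in> \<Sigma>2"
    and "tangent_space \<Sigma>1 p0 = {v. v \<bullet> (- d_x1) = 0}"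
    and "tangent_space \<Sigma>2 p0 = {v. v \<bullet> (- d_x1) = 0}"
    and "compatible_defining \<Sigma>1 p0 U \<phi>"
    and "compatible_defining \<Sigma>2 p0 V \<psi>"
    and "p \<ge> 0"
    and "\<forall>\<^sub>F q in nhds p0. q \<in> \<Sigma>1 \<longrightarrow>
           (\<exists>a\<ge>0. l_transl a q \<in> \<Sigma>2 \<inter> V \<and> mean_curv \<psi> p (l_transl a q) \<le> mean_curv \<phi> p q)"
  shows "\<forall>\<^sub>F q in nhds p0. q \<in> \<Sigma>1 \<longleftrightarrow> q \<in> \<Sigma>2"
proof -
  note \<phi> = assms(8) and \<psi> = assms(9)
  note U = compatible_definingD[OF \<phi>] and V = compatible_definingD[OF \<psi>]
  let ?o = "Inl first_index :: 'n + 'n"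
  obtain j :: 'n where j: "j \<noteq> first_index"
  proof -
    have "(UNIV :: 'n set) \<noteq> {first_index}"
      using assms(1) card.insert[of "{}" "first_index :: 'n"] by (metis One_nat_def card_1_singleton_iff not_less_eq_eq numeral_2_eq_2 order_refl)
    then show thesis using that by blast
  qed
  obtain r1 where r1: "r1 > 0" "\<And>y \<nu>. dist p0 y < r1 \<Longrightarrow> (\<And>I. \<nu> \<bullet> hor \<phi> I y = 0) \<Longrightarrow>
      \<nu> \<bullet> transl_field y = 0 \<Longrightarrow> \<nu> \<bullet> hor_bracket \<phi> (Inl j) (Inr j) y = 0 \<Longrightarrow> \<nu> = 0"
    using normal_eq_0_nearby[OF U(1,3,4,2) diff1_vertical[OF \<phi> assms(4,6)] j] by blast
  obtain r2 where r2: "r2 > 0" "\<And>x. dist x p0 < r2 \<Longrightarrow>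
      x \<in> U \<and> x \<in> V \<and> \<phi> x \<le> \<psi> x \<and> mean_curv \<psi> p x \<le> mean_curv \<phi> p x"
    using comparison_near[OF \<phi> \<psi> assms(4,11)] unfolding eventually_nhds_metric by blast
  define r where "r = min r1 r2 / 2"
  have r: "r > 0" using r1 r2 by (simp add: r_def)
  have near: "x \<in> U" "x \<in> V" "\<phi> x \<le> \<psi> x" "mean_curv \<psi> p x \<le> mean_curv \<phi> p x" if "x \<in> cball p0 r" for x
    using r2(2)[of x] that r by (auto simp: r_def dist_commute)
  \<comment> \<open>The local comparison needs the open ball; \<open>Z\<close> is taken in the
    closed ball in order to be closed, so that nearest points exist.\<close>
  define W where "W = ball p0 r"
  have W: "W \<subseteq> U" "W \<subseteq> V" using near by (auto simp: W_def)
  have twW: "twice_diff_on W \<phi>" "twice_diff_on W \<psi>"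
    using U(3) V(3) W by (auto simp: twice_diff_on_def W_def)
  define Z where "Z = {x \<in> cball p0 r. \<phi> x - \<psi> x = 0}"
  have "continuous_on (cball p0 r) (\<lambda>x. \<phi> x - \<psi> x)"
    using near by (intro continuous_on_diff twice_diff_on_continuous_on[OF U(3)] twice_diff_on_continuous_on[OF V(3)]) auto
  then have Z: "closed Z" unfolding Z_def by (rule continuous_closed_preimage_constant) simp
  have p0: "p0 \<in> Z" using U(2,5) V(2,5) assms(4,5) r by (simp add: Z_def)
  have normal_hor: "(c - y) \<bullet> hor \<phi> I y = 0"
    if y: "y \<in> Z" "y \<in> W" and c: "\<And>z. z \<in> Z \<Longrightarrow> dist c y \<le> dist c z" for c y I
  proof -
    have "hderiv ?o \<phi> y * ((c - y) \<bullet> frame y I) = hderiv I \<phi> y * ((c - y) \<bullet> frame y ?o)"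
    proof (rule normal_parallel_gradient[OF twW])
      show "continuous_on W (hderiv I (hderiv J \<phi>))" for I J
        using continuous_on_subset[OF continuous_on_hderiv_hderiv[OF U(3,4)] W(1)] .
      show "curv p (\<lambda>I. hderiv I \<psi> x) (\<lambda>I J. hderiv I (hderiv J \<psi>) x) \<le> curv p (\<lambda>I. hderiv I \<phi> x) (\<lambda>I J. hderiv I (hderiv J \<phi>) x)"
        if "x \<in> W" for x
        using near[of x] that mean_curv_compatible[OF \<phi>, of x] mean_curv_compatible[OF \<psi>, of x]
        by (simp add: W_def)
      show "\<phi> x \<le> \<psi> x" "(\<Sum>I\<in>UNIV. (hderiv I \<phi> x)\<^sup>2) > 0" if "x \<in> W" for x
        using near[of x] sum_hderiv_pos[OF \<phi>] that by (auto simp: W_def)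
      show "dist c y \<le> dist c z" if "z \<in> W" "\<phi> z = \<psi> z" for z
        using that by (intro c) (simp add: Z_def W_def)
    qed (use y assms(10) in \<open>auto simp: Z_def\<close>)
    then show ?thesis by (simp add: hor_def inner_diff_right)
  qed
  have normal_transl: "(c - y) \<bullet> transl_field y = 0"
    if y: "y \<in> Z" "y \<in> W" and c: "\<And>z. z \<in> Z \<Longrightarrow> dist c y \<le> dist c z" for c y
  proof -
    \<comment> \<open>Translation lowers \<phi> and \<psi> by the same amount, so the orbit of
      \<open>y\<close> stays in \<open>Z\<close> as long as it stays in \<open>W\<close>. Hence
      \<open>g\<close> has a local minimum at 0.\<close>
    define g where "g a = (c - l_transl a y) \<bullet> (c - l_transl a y)" for a
    have "(g has_real_derivative - 2 * ((c - y) \<bullet> transl_field y)) (at 0)"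
      unfolding g_def l_transl_eq has_field_derivative_def
      by (auto intro!: derivative_eq_intros simp: inner_commute algebra_simps)
    moreover have "((\<lambda>a. l_transl a y) \<longlongrightarrow> y + 0 *\<^sub>R transl_field y) (nhds 0)"
      unfolding l_transl_eq by (intro tendsto_intros filterlim_ident)
    then have "\<forall>\<^sub>F a in nhds 0. l_transl a y \<in> W"
      by (rule topological_tendstoD) (use y in \<open>auto simp: W_def\<close>)
    then obtain d where d: "d > 0" "\<And>a. dist a 0 < d \<Longrightarrow> l_transl a y \<in> W"
      unfolding eventually_nhds_metric by blast
    have "g 0 \<le> g a" if "\<bar>0 - a\<bar> < d" for a
    proof -
      have a: "l_transl a y \<in> W" using d(2)[of a] that by (simp add: dist_real_def)
      have "y \<in> U" "l_transl a y \<in> U" "y \<in> V" "l_transl a y \<in> V" using y(2) a W by blast+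
      then have "\<phi> (l_transl a y) = \<psi> (l_transl a y)"
        using U(7)[of y a] V(7)[of y a] y(1) by (simp add: Z_def)
      then have "dist c y \<le> dist c (l_transl a y)"
        using a by (intro c) (simp add: Z_def W_def)
      then show ?thesis by (simp add: g_def l_transl_eq dist_norm norm_le)
    qed
    ultimately have "- 2 * ((c - y) \<bullet> transl_field y) = 0"
      using DERIV_local_min[OF _ d(1)] by blast
    then show ?thesis by simp
  qed
  have no_normal: "c = y"
    if y: "y \<in> Z" "y \<in> W" and c: "\<And>z. z \<in> Z \<Longrightarrow> dist c y \<le> dist c z" for c y
  proof -
    define s where "s = (r - dist p0 y) / 2"
    have s: "s > 0" and sub: "cball y s \<subseteq> W"
    proof -
      show "s > 0" using y(2) by (simp add: s_def W_def)
      then have "dist p0 x < r" if "dist y x \<le> s" for x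
        using dist_triangle[of p0 x y] that by (simp add: s_def)
      then show "cball y s \<subseteq> W" by (auto simp: W_def)
    qed
    obtain L1 L2 where L: "L1-lipschitz_on (cball y s) (hor \<phi> (Inl j))" "L2-lipschitz_on (cball y s) (hor \<phi> (Inr j))"
      using hor_lipschitz[OF U(3,4)] sub W(1) by (meson order_trans)
    have yU: "y \<in> U" using y(2) W by blast
    have "(c - y) \<bullet> (dhor \<phi> (Inr j) y (hor \<phi> (Inl j) y) - dhor \<phi> (Inl j) y (hor \<phi> (Inr j) y)) = 0"
    proof (rule bracket_normal_eq_0[OF Z y(1) s, where L = "max L1 L2"
          and ?V1.0 = "hor \<phi> (Inl j)" and ?V2.0 = "hor \<phi> (Inr j)"
          and ?D1.0 = "dhor \<phi> (Inl j) y" and ?D2.0 = "dhor \<phi> (Inr j) y"])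
      show "(max L1 L2)-lipschitz_on (ball y s) (hor \<phi> (Inl j))"
        by (rule lipschitz_on_mono[OF L(1)]) auto
      show "(max L1 L2)-lipschitz_on (ball y s) (hor \<phi> (Inr j))"
        by (rule lipschitz_on_mono[OF L(2)]) auto
      show "(c - x) \<bullet> hor \<phi> (Inl j) x = 0 \<and> (c - x) \<bullet> hor \<phi> (Inr j) x = 0"
        if "x \<in> Z" "dist y x < s" "\<And>z. z \<in> Z \<Longrightarrow> dist c x \<le> dist c z" for x c
      proof -
        have "x \<in> W" using that(2) by (intro subsetD[OF sub]) simp
        then show ?thesis using normal_hor[OF that(1) _ that(3)] by blast
      qed
    qed (use c hor_has_derivative[OF U(3) yU] in auto)
    then have "(c - y) \<bullet> hor_bracket \<phi> (Inl j) (Inr j) y = 0" by (simp add: hor_bracket_def)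
    moreover have "dist p0 y < r1" using y(2) r by (simp add: W_def r_def)
    ultimately have "c - y = 0"
      by (intro r1(2)[of y] normal_hor[OF y c] normal_transl[OF y c]) auto
    then show ?thesis by simp
  qed
  \<comment> \<open>Since \<open>p0\<close> is itself in \<open>Z\<close>, the point of
    \<open>Z\<close> nearest to \<open>x\<close> is at distance less than r / 2 from
    \<open>x\<close>, hence in \<open>W\<close> and not on the bounding sphere.\<close>
  have "x \<in> Z" if x: "dist x p0 < r / 2" for x
  proof -
    have "Z \<noteq> {}" using p0 by blast
    obtain y where y: "y \<in> Z" "infdist x Z = dist x y"
      using infdist_attains_inf[OF Z \<open>Z \<noteq> {}\<close>] by metis
    have min: "dist x y \<le> dist x z" if "z \<in> Z" for z
      using infdist_le[OF that, of x] y(2) by simp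
    have "dist p0 y < r"
      using dist_triangle[of p0 y x] min[OF p0] x by (simp add: dist_commute)
    then have "x = y" by (intro no_normal y min) (simp add: W_def)
    then show ?thesis using y by simp
  qed
  then have "x \<in> \<Sigma>1 \<longleftrightarrow> x \<in> \<Sigma>2" if "dist x p0 < r / 2" for x
    using that near(1,2)[of x] U(5)[of x] V(5)[of x] by (auto simp: Z_def)
  moreover have "r / 2 > 0" using r by simp
  ultimately show ?thesis unfolding eventually_nhds_metric by blast
qed

end
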